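(* Let $n\in\mathbb{N}$, $0<\alpha<n$, $1<p<\frac{n}{\alpha}$, $0<\rho<\infty$, and $\omega\in A_1^{\rm loc}$. For any Lebesgue measurable function $f:\mathbb{R}^n\to[-\infty,\infty]$ and $q>\frac{n-\alpha p}{n}$, it holds that $$\left\|\mathbf{M}_\rho^{\rm loc}f\right\|_{L^{q}(\mathcal{R}_{\alpha,p;\rho}^{\omega})}\le C(n,\alpha,p,[\omega]_{A_{1;160\rho}^{\rm loc}})\,\|f\|_{L^q(\mathcal{R}_{\alpha,p;\rho}^{\omega})},$$ where $C(n,\alpha,p,[\omega]_{A_{1;160\rho}^{\rm loc}})$ is a positive constant depending only on the indicated parameters.
   Context: $|x|_\infty=\max_i|x_i|$; $\omega'=\omega^{-\frac{1}{p-1}}$. Cubes are open with sides parallel to the axes; $\ell(Q)$ is the side length. A weight is a locally integrable function $\omega\ge0$ on $\mathbb{R}^n$ with $\omega>0$ a.e. $[\omega]_{A_{1;\rho}^{\rm loc}}=\sup_{\ell(Q)\le\rho}\left(\frac{1}{|Q|}\int_Q\omega\,dx\right)\|\omega^{-1}\|_{L^\infty(Q)}$; the class of weights for which this is finite does not depend on $0<\rho<\infty$ and is denoted $A_1^{\rm loc}$. $\mathbf{M}_\rho^{\rm loc}f(x)=\sup\left\{\frac{1}{|Q|}\int_Q|f|\,dy:\ x\in Q,\ \ell(Q)\le\rho\right\}$. The capacity of $E\subseteq\mathbb{R}^n$ is $\mathcal{R}_{\alpha,p;\rho}^{\omega}(E)=\inf\int_0^\rho\int_{\mathbb{R}^n}g(y,t)^p\,\omega'(y)\,dy\frac{dt}{t}$,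 the infimum over measurable $g\ge0$ on $\mathbb{R}^n\times(0,\rho)$ with $\int_0^\rho\left(\int_{|x-y|_\infty<t}\frac{g(y,t)}{t^{n-\alpha}}\,\omega'(y)\,dy\right)\frac{dt}{t}\ge1$ for every $x\in E$. For a capacity $\mathcal{R}$ and $0<q<\infty$: $\|f\|_{L^q(\mathcal{R})}=\left(\int_0^\infty\mathcal{R}(\{x\in\mathbb{R}^n:|f(x)|^q>t\})\,dt\right)^{1/q}$.
   Formalization: The constant C is allowed to depend on q as well as on n, α, p and the A_1 constant; a constant uniform over all q > (n−αp)/n cannot exist (take ω = 1, indicators of small cubes, and let q tend to (n−αp)/n). *)

theory Defs
  imports "HOL-Analysis.Analysis" "HOL-Probability.Essential_Supremum"
begin

definition cubes :: "real \<Rightarrow> (real^'n) set set" where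
  "cubes \<rho> = {box a (a + l *\<^sub>R One) | a l. 0 < l \<and> l \<le> \<rho>}"

definition weight :: "(real^'n \<Rightarrow> real) \<Rightarrow> bool" where
  "weight \<omega> \<longleftrightarrow> (\<forall>K. compact K \<longrightarrow> set_integrable lebesgue K \<omega>) \<and>
     (\<forall>x. 0 \<le> \<omega> x) \<and> (AE x in lebesgue. 0 < \<omega> x)"

definition avg :: "(real^'n) set \<Rightarrow> (real^'n \<Rightarrow> ennreal) \<Rightarrow> ennreal" where
  "avg Q h = (\<integral>\<^sup>+x\<in>Q. h x \<partial>lebesgue) / emeasure lebesgue Q"

definition A1_const :: "real \<Rightarrow> (real^'n \<Rightarrow> real) \<Rightarrow> ennreal" where
  "A1_const \<rho> \<omega> = (SUP Q\<in>cubes \<rho>.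
     avg Q (\<lambda>x. ennreal (\<omega> x)) * esssup (lebesgue_on Q) (\<lambda>x. inverse (ennreal (\<omega> x))))"

(* Finiteness of A1_const does not depend on the scale, so one scale suffices. *)
definition A1_loc :: "(real^'n \<Rightarrow> real) \<Rightarrow> bool" where
  "A1_loc \<omega> \<longleftrightarrow> weight \<omega> \<and> (\<exists>\<rho>>0. A1_const \<rho> \<omega> < \<infinity>)"

definition M_loc :: "real \<Rightarrow> (real^'n \<Rightarrow> ereal) \<Rightarrow> real^'n \<Rightarrow> ereal" where
  "M_loc \<rho> f x = enn2ereal (SUP Q\<in>{Q \<in> cubes \<rho>. x \<in> Q}. avg Q (\<lambda>y. e2ennreal \<bar>f y\<bar>))"

definition dual_weight :: "real \<Rightarrow> (real^'n \<Rightarrow> real) \<Rightarrow> real^'n \<Rightarrow> real" where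
  "dual_weight p \<omega> x = \<omega> x powr (- (1 / (p - 1)))"

definition admissible ::
  "real \<Rightarrow> real \<Rightarrow> real \<Rightarrow> (real^'n \<Rightarrow> real) \<Rightarrow> (real^'n) set \<Rightarrow> ((real^'n) \<times> real \<Rightarrow> real) \<Rightarrow> bool" where
  "admissible \<alpha> p \<rho> \<omega> E g \<longleftrightarrow>
     g \<in> borel_measurable (lebesgue_on (UNIV \<times> {0<..<\<rho>})) \<and>
     (\<forall>y. \<forall>t\<in>{0<..<\<rho>}. 0 \<le> g (y, t)) \<and>
     (\<forall>x\<in>E. 1 \<le> (\<integral>\<^sup>+t\<in>{0<..<\<rho>}.
        (\<integral>\<^sup>+y\<in>{y. infnorm (x - y) < t}.
           ennreal (g (y, t) / t powr (real CARD('n) - \<alpha>) * dual_weight p \<omega> y) \<partial>lebesgue)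
        * ennreal (1 / t) \<partial>lebesgue))"

definition capacity ::
  "real \<Rightarrow> real \<Rightarrow> real \<Rightarrow> (real^'n \<Rightarrow> real) \<Rightarrow> (real^'n) set \<Rightarrow> ennreal" where
  "capacity \<alpha> p \<rho> \<omega> E = (INF g\<in>Collect (admissible \<alpha> p \<rho> \<omega> E).
     \<integral>\<^sup>+t\<in>{0<..<\<rho>}.
       (\<integral>\<^sup>+y. ennreal (g (y, t) powr p * dual_weight p \<omega> y) \<partial>lebesgue)
       * ennreal (1 / t) \<partial>lebesgue)"

(* Real powers on [0, \<infinity>]; intended for r > 0 only. *)
definition ennreal_powr :: "ennreal \<Rightarrow> real \<Rightarrow> ennreal" where
  "ennreal_powr x r = (if x = \<infinity> then \<infinity> else ennreal (enn2real x powr r))"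

definition cap_Lq_norm ::
  "((real^'n) set \<Rightarrow> ennreal) \<Rightarrow> real \<Rightarrow> (real^'n \<Rightarrow> ereal) \<Rightarrow> ennreal" where
  "cap_Lq_norm R q f =
     ennreal_powr
       (\<integral>\<^sup>+t\<in>{0<..}. R {x. ennreal t < ennreal_powr (e2ennreal \<bar>f x\<bar>) q} \<partial>lebesgue)
       (1 / q)"

end

theory Submission
  imports Defs
begin

text \<open>
  By countable subadditivity and the layer decomposition \<open>f \<le> s + (\<Sum>j. s 2^j 1_{f > s 2^j})\<close>,
  it suffices to have a restricted weak type estimate: for every \<open>\<theta> < \<alpha> p / n\<close>, the capacity of
  \<open>{M 1_E > \<tau>}\<close> is at most a constant times \<open>\<tau> powr (\<theta> - 1)\<close> times that of E. This gives
  all \<open>q > 1 - \<theta>\<close>. For the weak type estimate, cover the level set by dilates of cubes Q whose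
  moderate enlargements are disjoint, and split the potential of a test function g for E at the
  scale of Q. If the part from larger scales is at least 1/2 somewhere in \<open>E \<inter> Q\<close>, then averaging
  g against the dual weight w gives a test function whose potential is bounded below on the whole
  dilate. Otherwise the part from smaller scales is at least 1/2 on all of \<open>E \<inter> Q\<close>; integrating
  it over \<open>E \<inter> Q\<close> and using \<open>|E \<inter> Q \<inter> B| \<le> |E \<inter> Q| powr \<theta> * |B| powr (1 - \<theta>)\<close> bounds the local
  energy of g from below by a power of \<open>\<tau>\<close> times the capacity of the dilate, and the local
  energies are summable by disjointness. Of the weight only the inequality
  \<open>w \<le> K * (average of w)\<close> on cubes is used; it follows from the local A1 condition.
\<close>

section \<open>Powers of extended nonnegative reals and cubes\<close>

text \<open>The lower bound on q comes from one integral: after Young's inequality the small scales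
  leave the integral of t powr (b - 1) over (0, l) with b = (\<alpha> p - n \<theta>) / (p - 1),
  which is finite near 0 exactly when \<theta> < \<alpha> p / n. The weight disappears from the
  one-cube comparison, since the capacity bound of a cube and the lower bound of its local energy
  both carry the factor m powr (1 - p), m being the mass of w on the cube. Disjointness gives no
  control of the part of a potential that comes from scales above that of the cube, so one averaged
  test function has to serve all those cubes at once; Jensen and doubling keep its energy
  comparable. Null sets need care: test functions may be altered almost everywhere, because
  potentials integrate over (y, t), but capacity is not controlled by Lebesgue measure, so f may
  only be replaced by a function below it everywhere. The dilates reach half-side 40 n \<rho>,
  whereas the given A1 constant lives at half-side 80 \<rho>; n enlargements by 3/2 bridge the gap
  with explicit constants.\<close>

lemma ennreal_powr_top [simp]: "ennreal_powr top r = top"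
  by (simp add: ennreal_powr_def)

lemma ennreal_powr_ennreal: "0 \<le> x \<Longrightarrow> ennreal_powr (ennreal x) r = ennreal (x powr r)"
  by (simp add: ennreal_powr_def)

lemma ennreal_powr_0 [simp]: "ennreal_powr 0 r = 0"
  by (simp add: ennreal_powr_def)

lemma ennreal_powr_mono: "0 \<le> r \<Longrightarrow> x \<le> y \<Longrightarrow> ennreal_powr x r \<le> ennreal_powr y r"
  by (cases x; cases y) (auto simp: ennreal_powr_ennreal top_unique intro!: ennreal_leI powr_mono2)

lemma ennreal_powr_cmult:
  "0 < c \<Longrightarrow> ennreal_powr (ennreal c * x) r = ennreal (c powr r) * ennreal_powr x r"
  by (cases x) (auto simp: ennreal_powr_ennreal powr_mult ennreal_mult ennreal_mult_top
      simp flip: ennreal_mult)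

lemma ennreal_powr_inverse: "0 < r \<Longrightarrow> ennreal_powr (ennreal_powr x (1 / r)) r = x"
  by (cases x) (auto simp: ennreal_powr_ennreal powr_powr)

lemma ennreal_powr_inverse': "0 < r \<Longrightarrow> ennreal_powr (ennreal_powr x r) (1 / r) = x"
  by (cases x) (auto simp: ennreal_powr_ennreal powr_powr)

lemma ennreal_powr_le_iff: "0 < r \<Longrightarrow> ennreal_powr x r \<le> ennreal_powr y r \<longleftrightarrow> x \<le> y"
  using ennreal_powr_mono[of r x y] ennreal_powr_mono[of "1/r" "ennreal_powr x r" "ennreal_powr y r"]
  by (auto simp: ennreal_powr_inverse')

lemma less_ennreal_powr_iff:
  "0 < r \<Longrightarrow> 0 \<le> t \<Longrightarrow> ennreal t < ennreal_powr x r \<longleftrightarrow> ennreal (t powr (1 / r)) < x"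
  using ennreal_powr_le_iff[of r x "ennreal (t powr (1/r))"]
  by (simp add: ennreal_powr_ennreal powr_powr not_le[symmetric])

lemma ennreal_powr_eq_top_iff [simp]: "ennreal_powr x r = top \<longleftrightarrow> x = top"
  by (simp add: ennreal_powr_def)

lemma borel_measurable_ennreal_powr [measurable (raw)]:
  assumes [measurable]: "f \<in> borel_measurable M"
  shows "(\<lambda>x. ennreal_powr (f x) r) \<in> borel_measurable M"
  unfolding ennreal_powr_def by measurable

text \<open>If x > c, then (x / c) powr (p - 1) > 1 and the second term alone dominates. Integrated
  against a weight, with c tied to the mean, this yields Jensen's inequality up to a
  constant.\<close>

lemma ennreal_le_const_add_powr:
  assumes "0 < c" "1 < p"
  shows "x \<le> ennreal c + ennreal (c powr (1 - p)) * ennreal_powr x p"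
proof (cases x)
  case (real r)
  have "r \<le> c + c powr (1 - p) * r powr p"
  proof (cases "r \<le> c")
    case False
    have "r = c powr (1 - p) * (c powr (p - 1) * r)"
      using assms by (simp flip: mult.assoc powr_add)
    also have "\<dots> \<le> c powr (1 - p) * (r powr (p - 1) * r)"
      using False assms by (intro mult_left_mono mult_right_mono powr_mono2) auto
    also have "r powr (p - 1) * r = r powr p"
      using False assms powr_mult_base[of r "p - 1"] by (simp add: mult.commute)
    finally show ?thesis using assms by linarith
  qed (use assms real in \<open>simp add: add_increasing2\<close>)
  then show ?thesis using real assms
    by (simp add: ennreal_powr_ennreal ennreal_leI flip: ennreal_mult ennreal_plus)
qed (use assms in \<open>simp add: ennreal_mult_top\<close>)

text \<open>Young's inequality with conjugate exponent p / (p - 1) = 1 + 1 / (p - 1) and non-sharp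
  constants: according to whether k \<le> d * x powr (p - 1), one of the two terms alone dominates.
  The free parameter d is later tuned to the cube.\<close>

lemma ennreal_young:
  assumes "0 < d" "1 < p" "0 \<le> k"
  shows "x * ennreal k \<le> ennreal d * ennreal_powr x p
           + ennreal (d powr (- (1 / (p - 1))) * k powr (1 + 1 / (p - 1)))"
proof (cases x)
  case (real r)
  have "r * k \<le> d * r powr p + d powr (- (1 / (p - 1))) * k powr (1 + 1 / (p - 1))"
  proof (cases "k \<le> d * r powr (p - 1)")
    case True
    have "r * k \<le> r * (d * r powr (p - 1))"
      using True real by (intro mult_left_mono) auto
    also have "\<dots> = d * r powr p"
      using real assms powr_mult_base[of r "p - 1"] by (simp add: algebra_simps)
    finally show ?thesis by (simp add: add_increasing2)
  next
    case False
    then have k: "0 < k" using assms real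
      by (metis less_eq_real_def linorder_not_less mult_nonneg_nonneg powr_ge_zero le_less_trans)
    have "r powr (p - 1) \<le> k / d" using False assms by (simp add: field_simps)
    then have "(r powr (p - 1)) powr (1 / (p - 1)) \<le> (k / d) powr (1 / (p - 1))"
      using assms by (intro powr_mono2) auto
    then have "r \<le> (k / d) powr (1 / (p - 1))"
      using real assms by (simp add: powr_powr)
    then have "r * k \<le> (k / d) powr (1 / (p - 1)) * k"
      using k by (intro mult_right_mono) auto
    also have "\<dots> = d powr (- (1 / (p - 1))) * k powr (1 + 1 / (p - 1))"
      using k assms by (simp add: powr_divide powr_add powr_minus_divide)
    finally show ?thesis using assms
      by (smt (verit) mult_nonneg_nonneg powr_ge_zero)
  qed
  then show ?thesis using real assms
    by (simp add: ennreal_powr_ennreal ennreal_leI flip: ennreal_mult ennreal_plus)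
qed (use assms in \<open>simp add: ennreal_mult_top\<close>)

lemma ennreal_divide_mult_cancel: "b \<noteq> 0 \<Longrightarrow> b \<noteq> top \<Longrightarrow> a / b * b = (a :: ennreal)"
  by (simp add: ennreal_divide_times less_top)

lemma ennreal_inverse_antimono: "a \<le> b \<Longrightarrow> inverse b \<le> inverse (a :: ennreal)"
proof (cases "a = 0 \<or> b = top")
  case False
  moreover assume "a \<le> b"
  ultimately obtain a' b' where "a = ennreal a'" "b = ennreal b'" "0 < a'" "a' \<le> b'"
    by (cases a; cases b) (auto simp: top_unique less_le)
  then show ?thesis by (simp add: inverse_ennreal ennreal_leI le_imp_inverse_le)
qed auto

lemma ennreal_inverse_le_divide:
  assumes "m \<le> ennreal c * d" "0 \<le> c" "0 < m" "m < top" "0 < d" "d < top"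
  shows "1 / d \<le> ennreal c / m"
proof -
  obtain m' d' where md: "m = ennreal m'" "d = ennreal d'" "0 < m'" "0 < d'"
    using assms by (cases m; cases d) (auto simp: ennreal_less_zero_iff)
  then have "m' \<le> c * d'" using assms by (simp flip: ennreal_mult)
  then have "ennreal (1 / d') \<le> ennreal (c / m')"
    using md by (intro ennreal_leI) (simp add: field_simps)
  then show ?thesis using md assms divide_ennreal[of 1 d'] divide_ennreal[of c m'] by simp
qed

section \<open>Cubes as balls of the sup norm, described by centre and half-side\<close>

definition cube :: "real^'n \<Rightarrow> real \<Rightarrow> (real^'n) set" where
  "cube x r = {y. infnorm (x - y) < r}"

lemma infnorm_less_iff: "0 < r \<Longrightarrow> infnorm (x :: real^'n) < r \<longleftrightarrow> (\<forall>i. \<bar>x $ i\<bar> < r)"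
  unfolding infnorm_cart by (subst cSup_eq_Max) (auto simp: full_SetCompr_eq)

lemma One_nth [simp]: "(One :: real^'n) $ i = 1"
  by (simp add: cart_eq_inner_axis axis_in_Basis_iff del: sum_component)

lemma cube_eq_box:
  assumes "0 < r" shows "cube x r = box (x - r *\<^sub>R One) (x + r *\<^sub>R (One :: real^'n))"
  using assms unfolding cube_def
  by (auto simp: infnorm_less_iff mem_box_cart abs_less_iff simp del: sum_component) (smt (verit))+

lemma open_cube [simp]: "open (cube x r)"
proof (cases "0 < r")
  case False
  then have "cube x r = {}" by (auto simp: cube_def) (meson infnorm_pos_le not_less order_trans)
  then show ?thesis by simp
qed (simp add: cube_eq_box open_box)

lemma sets_cube [measurable]: "cube x r \<in> sets borel"
  by simp

lemma mem_cube_commute: "y \<in> cube x r \<longleftrightarrow> x \<in> cube y r"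
  by (simp add: cube_def infnorm_sub)

lemma cube_subset:
  assumes "infnorm (x - y) + s \<le> r" shows "cube y s \<subseteq> cube x r"
proof
  fix z assume "z \<in> cube y s"
  then have "infnorm (y - z) < s" by (simp add: cube_def)
  moreover have "infnorm (x - z) \<le> infnorm (x - y) + infnorm (y - z)"
    using infnorm_triangle[of "x - y" "y - z"] by simp
  ultimately show "z \<in> cube x r" using assms by (simp add: cube_def)
qed

lemma scaleR_double: "x + r *\<^sub>R v = (x - r *\<^sub>R v) + (2 * r) *\<^sub>R (v :: 'a :: real_vector)"
proof -
  have "(2 * r) *\<^sub>R v = r *\<^sub>R v + r *\<^sub>R v"
    by (simp only: mult_2 scaleR_left_distrib)
  then show ?thesis by simp
qed

lemma emeasure_cube:
  assumes "0 < r" shows "emeasure lborel (cube x r :: (real^'n) set) = ennreal ((2 * r) ^ CARD('n))"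
proof -
  have "emeasure lborel (cube x r) = ennreal (\<Prod>b\<in>Basis. (x + r *\<^sub>R (One :: real^'n) - (x - r *\<^sub>R One)) \<bullet> b)"
    unfolding cube_eq_box[OF assms] using assms
    by (subst emeasure_lborel_box) (auto simp: inner_add_left inner_diff_left)
  also have "(\<Prod>b\<in>Basis. (x + r *\<^sub>R (One :: real^'n) - (x - r *\<^sub>R One)) \<bullet> b) = (\<Prod>b\<in>(Basis :: (real^'n) set). 2 * r)"
    by (subst scaleR_double) (intro prod.cong; simp)
  finally show ?thesis by simp
qed

lemma infnorm_borel [measurable (raw)]:
  fixes f :: "'a \<Rightarrow> real^'n"
  assumes [measurable]: "f \<in> borel_measurable M"
  shows "(\<lambda>x. infnorm (f x)) \<in> borel_measurable M"
proof -
  have "continuous_on UNIV (infnorm :: real^'n \<Rightarrow> real)"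
    by (intro continuous_at_imp_continuous_on ballI continuous_infnorm continuous_ident)
  then have "(infnorm :: real^'n \<Rightarrow> real) \<in> borel_measurable borel"
    by (rule borel_measurable_continuous_onI)
  then show ?thesis by measurable
qed

lemma pred_mem_cube [measurable (raw)]:
  fixes f g :: "'a \<Rightarrow> real^'n"
  assumes [measurable]: "f \<in> borel_measurable M" "g \<in> borel_measurable M" "h \<in> borel_measurable M"
  shows "Measurable.pred M (\<lambda>x. f x \<in> cube (g x) (h x))"
  unfolding cube_def by measurable

lemma cubes_eq: "(cubes \<rho> :: (real^'n) set set) = {cube x r | x r. 0 < r \<and> 2 * r \<le> \<rho>}"
proof safe
  fix Q :: "(real^'n) set" assume "Q \<in> cubes \<rho>"
  then obtain a l where Q: "Q = box a (a + l *\<^sub>R One)" "0 < l" "l \<le> \<rho>" by (auto simp: cubes_def)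
  have "Q = cube (a + (l/2) *\<^sub>R One) (l/2)"
    using Q by (subst cube_eq_box) (simp_all add: add.assoc flip: scaleR_add_left)
  then show "\<exists>x r. Q = cube x r \<and> 0 < r \<and> 2 * r \<le> \<rho>" using Q by force
next
  fix x :: "real^'n" and r assume "0 < r" "2 * r \<le> \<rho>"
  then show "cube x r \<in> cubes \<rho>"
    unfolding cubes_def cube_eq_box[OF \<open>0 < r\<close>] scaleR_double[of x] by (auto intro!: exI[of _ "x - r *\<^sub>R One"] exI[of _ "2 * r"])
qed

lemma nn_integral_powr_Ioo:
  assumes "0 < b" "0 < (l :: real)"
  shows "(\<integral>\<^sup>+t\<in>{0<..<l}. ennreal (t powr (b - 1)) \<partial>lborel) = ennreal (l powr b / b)"
proof -
  have "((\<lambda>t. t powr (b - 1)) has_integral (l powr b / b)) {0..l}"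
    using has_integral_powr_from_0[of "b - 1" l] assms by simp
  then have "(\<integral>\<^sup>+t. ennreal (t powr (b - 1)) * indicator {0..l} t \<partial>lborel) = ennreal (l powr b / b)"
    using nn_integral_has_integral_lebesgue'[of "{0..l}" "\<lambda>t. t powr (b - 1)" "l powr b / b"] assms by auto
  moreover have "(\<integral>\<^sup>+t\<in>{0<..<l}. ennreal (t powr (b - 1)) \<partial>lborel)
      = (\<integral>\<^sup>+t. ennreal (t powr (b - 1)) * indicator {0..l} t \<partial>lborel)"
  proof (rule nn_integral_cong_AE)
    show "AE t in lborel. ennreal (t powr (b - 1)) * indicator {0<..<l} t = ennreal (t powr (b - 1)) * indicator {0..l} t"
      using AE_lborel_singleton[of 0] AE_lborel_singleton[of l]
      by eventually_elim (auto simp: indicator_def)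
  qed
  ultimately show ?thesis by simp
qed

text \<open>Tonelli and the symmetry of \<open>y \<in> cube x t\<close>: each point of F is counted
  with the volume of a cube of half-side t.\<close>

lemma nn_integral_emeasure_Int_cube:
  assumes [measurable]: "F \<in> sets borel" and t: "0 < t"
  shows "(\<integral>\<^sup>+y. emeasure lborel (F \<inter> cube (y :: real^'n) t) \<partial>lborel) = ennreal ((2 * t) ^ CARD('n)) * emeasure lborel F"
proof -
  have "(\<integral>\<^sup>+y. emeasure lborel (F \<inter> cube (y :: real^'n) t) \<partial>lborel)
      = (\<integral>\<^sup>+y. (\<integral>\<^sup>+x. indicator (F \<inter> cube y t) x \<partial>lborel) \<partial>lborel)"
    by simp
  also have "\<dots> = (\<integral>\<^sup>+x. (\<integral>\<^sup>+y. indicator (F \<inter> cube y t) x \<partial>lborel) \<partial>lborel)"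
    by (rule lborel_pair.Fubini') measurable
  also have "\<dots> = (\<integral>\<^sup>+x. (\<integral>\<^sup>+y. indicator F x * indicator (cube x t) y \<partial>lborel) \<partial>lborel)"
    by (intro nn_integral_cong) (auto simp: indicator_def mem_cube_commute)
  also have "\<dots> = (\<integral>\<^sup>+x. ennreal ((2 * t) ^ CARD('n)) * indicator F x \<partial>lborel)"
    using t by (intro nn_integral_cong) (simp add: nn_integral_cmult_indicator emeasure_cube mult.commute)
  also have "\<dots> = ennreal ((2 * t) ^ CARD('n)) * emeasure lborel F"
    by (rule nn_integral_cmult_indicator) simp
  finally show ?thesis .
qed

lemma measurable_measure_Int_cube [measurable (raw)]:
  assumes [measurable]: "F \<in> sets borel" "a \<in> borel_measurable M" "b \<in> borel_measurable M"
  shows "(\<lambda>x. measure lborel (F \<inter> cube (a x :: real^'n) (b x))) \<in> borel_measurable M"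
  unfolding measure_def by measurable

section \<open>Averaging test functions\<close>

definition mass :: "(real^'n \<Rightarrow> ennreal) \<Rightarrow> real^'n \<Rightarrow> real \<Rightarrow> ennreal" where
  "mass w x r = (\<integral>\<^sup>+y\<in>cube x r. w y \<partial>lborel)"

definition energy :: "real \<Rightarrow> real \<Rightarrow> (real^'n \<Rightarrow> ennreal) \<Rightarrow> ((real^'n) \<times> real \<Rightarrow> ennreal) \<Rightarrow> ennreal" where
  "energy p \<rho> w G = (\<integral>\<^sup>+t\<in>{0<..<\<rho>}. (\<integral>\<^sup>+y. ennreal_powr (G (y, t)) p * w y \<partial>lborel) * ennreal (1 / t) \<partial>lborel)"

text \<open>The kernel t powr (\<alpha> - n) and the factor 1 / t are merged into one power. The set
  T of scales is a parameter so that the potential can be cut at the scale of a cube.\<close>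

definition potential :: "real \<Rightarrow> real set \<Rightarrow> (real^'n \<Rightarrow> ennreal) \<Rightarrow> ((real^'n) \<times> real \<Rightarrow> ennreal) \<Rightarrow> real^'n \<Rightarrow> ennreal" where
  "potential \<alpha> T w G x = (\<integral>\<^sup>+t\<in>T. (\<integral>\<^sup>+y\<in>cube x t. G (y, t) * w y \<partial>lborel)
      * ennreal (t powr (\<alpha> - real CARD('n) - 1)) \<partial>lborel)"

text \<open>Unlike in \<^const>\<open>capacity\<close>, test functions are Borel measurable and may take the value infinity.\<close>

definition borel_capacity :: "real \<Rightarrow> real \<Rightarrow> real \<Rightarrow> (real^'n \<Rightarrow> ennreal) \<Rightarrow> (real^'n) set \<Rightarrow> ennreal" where
  "borel_capacity \<alpha> p \<rho> w E =
     (INF G\<in>{G \<in> borel_measurable (borel \<Otimes>\<^sub>M borel). \<forall>x\<in>E. 1 \<le> potential \<alpha> {0<..<\<rho>} w G x}. energy p \<rho> w G)"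

text \<open>Jensen's inequality for the probability density v / m, up to the factor 2 powr p,
  obtained by integrating \<open>ennreal_le_const_add_powr\<close> against v and choosing c.\<close>

lemma ennreal_jensen_powr:
  fixes f v :: "'a \<Rightarrow> ennreal"
  assumes [measurable]: "f \<in> borel_measurable M" "v \<in> borel_measurable M"
    and p: "1 < p" and m: "(\<integral>\<^sup>+x. v x \<partial>M) = m" "0 < m" "m < top"
  shows "ennreal_powr ((\<integral>\<^sup>+x. f x * v x \<partial>M) / m) p * m
           \<le> ennreal (2 powr p) * (\<integral>\<^sup>+x. ennreal_powr (f x) p * v x \<partial>M)"
proof -
  let ?S = "\<integral>\<^sup>+x. f x * v x \<partial>M" and ?T = "\<integral>\<^sup>+x. ennreal_powr (f x) p * v x \<partial>M"
  have bound: "?S \<le> ennreal c * m + ennreal (c powr (1 - p)) * ?T" if c: "0 < c" for c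
  proof -
    have "?S \<le> (\<integral>\<^sup>+x. ennreal c * v x + ennreal (c powr (1 - p)) * (ennreal_powr (f x) p * v x) \<partial>M)"
    proof (rule nn_integral_mono)
      fix x
      have "f x * v x \<le> (ennreal c + ennreal (c powr (1 - p)) * ennreal_powr (f x) p) * v x"
        by (intro mult_right_mono ennreal_le_const_add_powr c p) simp
      then show "f x * v x \<le> ennreal c * v x + ennreal (c powr (1 - p)) * (ennreal_powr (f x) p * v x)"
        by (simp add: distrib_right mult.assoc)
    qed
    also have "\<dots> = ennreal c * m + ennreal (c powr (1 - p)) * ?T"
      by (simp add: nn_integral_add nn_integral_cmult m(1))
    finally show ?thesis .
  qed
  obtain mr where mr: "m = ennreal mr" "0 < mr"
    using m by (cases m) (auto simp: ennreal_less_zero_iff)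
  show ?thesis
  proof (cases ?S)
    case (real s)
    show ?thesis
    proof (cases "s = 0 \<or> ?T = top")
      case True then show ?thesis
      proof
        assume "?T = top"
        then show ?thesis by (simp add: ennreal_mult_top)
      qed (simp add: real)
    next
      case False
      then obtain T where T: "?T = ennreal T" "0 \<le> T" by (cases ?T) auto
      define i where "i = s / mr"
      have i: "0 < i" "s = i * mr" using False real mr by (auto simp: i_def)
      \<comment> \<open>With c equal to half of the mean i, the term c * m is half of s and is
        absorbed by the left-hand side.\<close>
      have "ennreal s \<le> ennreal (i/2) * m + ennreal ((i/2) powr (1 - p)) * ?T"
        using bound[of "i/2"] i real by simp
      then have "s \<le> i/2 * mr + (i/2) powr (1 - p) * T"
        using mr T i by (simp flip: ennreal_mult ennreal_plus)
      then have "(i/2) * mr \<le> (i/2) powr (1 - p) * T" using i by simp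
      then have "(i/2) powr (p - 1) * ((i/2) * mr) \<le> (i/2) powr (p - 1) * ((i/2) powr (1 - p) * T)"
        by (intro mult_left_mono) auto
      also have "\<dots> = T" using i by (simp flip: mult.assoc powr_add)
      also have "(i/2) powr (p - 1) * ((i/2) * mr) = (i/2) powr p * mr"
        using i powr_mult_base[of "i/2" "p-1"] by (simp add: algebra_simps)
      finally have "i powr p * mr \<le> 2 powr p * T"
        using i by (simp add: powr_divide field_simps)
      moreover have "?S / m = ennreal i"
        using real mr i by (simp add: divide_ennreal)
      ultimately show ?thesis
        using i mr T by (simp add: ennreal_powr_ennreal ennreal_leI flip: ennreal_mult)
    qed
  next
    case top
    with bound[of 1] have "ennreal 1 * m + ennreal (1 powr (1 - p)) * ?T = top"
      by (simp add: top_unique)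
    then have "?T = top" using m by (auto simp: add_top ennreal_add_eq_top)
    then show ?thesis by (simp add: ennreal_mult_top)
  qed
qed

section \<open>Locally doubling weights and the averaging operator\<close>

definition doubling_const :: "nat \<Rightarrow> real \<Rightarrow> real" where
  "doubling_const n K = K * (80 * real n) ^ n"

text \<open>
  The factor \<open>40 * CARD('n)\<close> leaves room for the dilates below: the Vitali lemma is applied to
  Euclidean balls, and a cube of radius r lies in the ball of radius \<open>CARD('n) * r\<close>, which
  the covering enlarges by the factor 5.
\<close>

locale rh_weight =
  fixes w :: "real^'n \<Rightarrow> ennreal" and \<rho> K \<alpha> p dbl :: real
  assumes w_meas [measurable]: "w \<in> borel_measurable borel"
    and rho_pos: "0 < \<rho>" and K_ge: "1 \<le> K"
    and mass_pos: "\<And>x r. 0 < r \<Longrightarrow> 0 < mass w x r"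
    and mass_fin: "\<And>x r. mass w x r < top"
    and rh: "\<And>x s. 0 < s \<Longrightarrow> s \<le> \<rho> \<Longrightarrow> AE z in lborel. z \<in> cube x (40 * real CARD('n) * s)
               \<longrightarrow> w z \<le> ennreal (K / s ^ CARD('n)) * mass w x s"
    and alpha: "0 < \<alpha>" "\<alpha> * p < real CARD('n)" and p: "1 < p"
    and dbl_def: "dbl = doubling_const CARD('n) K"
begin

lemma n_ge: "1 \<le> real CARD('n)"
  by (simp add: Suc_leI)

lemma le_n_mult: "0 < t \<Longrightarrow> t \<le> real CARD('n) * t"
  using mult_right_mono[OF n_ge, of t] by simp

lemma alpha_less: "\<alpha> < real CARD('n)"
  using alpha p by (smt (verit) mult_less_cancel_left2)

lemma dbl_ge: "1 \<le> dbl"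
proof -
  have "1 \<le> (80 * real CARD('n)) ^ CARD('n)"
    using n_ge by (intro one_le_power) linarith
  then show ?thesis using K_ge unfolding dbl_def doubling_const_def by (simp add: mult_ge1_I)
qed

text \<open>The assumption \<open>rh\<close> is a reverse Hoelder inequality with exponent infinity.
  Integrated over the cube of half-side 40 n s it gives doubling, with K / s^n times the volume (80
  n s)^n as constant. Only s is bounded by \<rho>; R may exceed it.\<close>

lemma mass_doubling:
  assumes s: "0 < s" "s \<le> \<rho>" and "infnorm (x - y) + R \<le> 40 * real CARD('n) * s"
  shows "mass w y R \<le> ennreal dbl * mass w x s"
proof -
  let ?L = "40 * real CARD('n) * s"
  have sub: "cube y R \<subseteq> cube x ?L" by (rule cube_subset) fact
  have "mass w y R \<le> (\<integral>\<^sup>+z. ennreal (K / s ^ CARD('n)) * mass w x s * indicator (cube x ?L) z \<partial>lborel)"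
    unfolding mass_def[of w y]
  proof (rule nn_integral_mono_AE)
    show "AE z in lborel. w z * indicator (cube y R) z \<le> ennreal (K / s ^ CARD('n)) * mass w x s * indicator (cube x ?L) z"
      using rh[OF s, of x] by eventually_elim (use sub in \<open>auto simp: indicator_def\<close>)
  qed
  also have "\<dots> = ennreal (K / s ^ CARD('n)) * mass w x s * ennreal ((2 * ?L) ^ CARD('n))"
    using s n_ge by (subst nn_integral_cmult_indicator) (auto simp: emeasure_cube)
  also have "\<dots> = ennreal ((K / s ^ CARD('n)) * (2 * ?L) ^ CARD('n)) * mass w x s"
    by (subst ennreal_mult) (use s K_ge in \<open>simp_all add: mult_ac\<close>)
  also have "(K / s ^ CARD('n)) * (2 * ?L) ^ CARD('n) = dbl"
    using s by (simp add: dbl_def doubling_const_def power_mult_distrib)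
  finally show ?thesis .
qed

lemma mass_mono: "infnorm (x - y) + s \<le> r \<Longrightarrow> mass w y s \<le> mass w x r"
  unfolding mass_def
  by (intro nn_integral_mono) (use cube_subset in \<open>fastforce simp: indicator_def\<close>)

lemma measurable_mass [measurable (raw)]:
  assumes [measurable]: "f \<in> borel_measurable M" "g \<in> borel_measurable M"
  shows "(\<lambda>z. mass w (f z) (g z)) \<in> borel_measurable M"
  unfolding mass_def by measurable

text \<open>The radius is dictated by \<open>potential_averaged\<close>: for y within t of x, and x
  within (10 n + 2) t of z, the cube of half-side t about z lies in that of half-side (10 n + 4) t
  about y. Dividing by the mass of the small cube is harmless by doubling.\<close>

definition averaged :: "((real^'n) \<times> real \<Rightarrow> ennreal) \<Rightarrow> (real^'n) \<times> real \<Rightarrow> ennreal" where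
  "averaged G = (\<lambda>(y, t). (\<integral>\<^sup>+v\<in>cube y ((10 * real CARD('n) + 4) * t). G (v, t) * w v \<partial>lborel) / mass w y t)"

lemma measurable_averaged [measurable]:
  assumes [measurable]: "G \<in> borel_measurable (borel \<Otimes>\<^sub>M borel)"
  shows "averaged G \<in> borel_measurable (borel \<Otimes>\<^sub>M borel)"
  unfolding averaged_def by measurable

text \<open>Jensen on the large cube. Replacing its mass by \<open>mass w y t\<close> in the
  denominator costs \<open>dbl\<close>, and the outer factor \<open>mass w y t\<close> is at most
  the mass of the large cube.\<close>

lemma averaged_pointwise:
  assumes [measurable]: "G \<in> borel_measurable (borel \<Otimes>\<^sub>M borel)" and t: "0 < t" "t < \<rho>"
  shows "ennreal_powr (averaged G (y, t)) p * mass w y t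
    \<le> ennreal ((2 * dbl) powr p) * (\<integral>\<^sup>+v\<in>cube y ((10 * real CARD('n) + 4) * t). ennreal_powr (G (v, t)) p * w v \<partial>lborel)"
proof -
  let ?c = "(10 * real CARD('n) + 4) * t"
  let ?m = "mass w y ?c" and ?S = "\<integral>\<^sup>+v\<in>cube y ?c. G (v, t) * w v \<partial>lborel"
  let ?d = "mass w y t"
  have c: "0 < ?c" "t \<le> ?c" "?c \<le> 40 * real CARD('n) * t"
    using t le_n_mult[OF t(1)] by (simp_all only: ring_distribs mult.assoc)
  have md: "?m \<le> ennreal dbl * ?d"
    using c t by (intro mass_doubling) (auto simp: infnorm_0)
  have dm: "?d \<le> ?m"
    using c by (intro mass_mono) (auto simp: infnorm_0)
  obtain m d where m: "?m = ennreal m" "0 < m" and d: "?d = ennreal d" "0 < d"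
    using mass_pos[OF c(1), of y] mass_fin[of y ?c] mass_pos[OF t(1), of y] mass_fin[of y t]
    by (cases ?m; cases ?d) (auto simp: ennreal_less_zero_iff)
  have md': "m \<le> dbl * d" using md m d dbl_ge by (simp flip: ennreal_mult)
  have "averaged G (y, t) \<le> ennreal dbl * (?S / ?m)"
  proof -
    have "averaged G (y, t) = ennreal (1 / d) * ?S"
      using d by (simp add: averaged_def divide_ennreal_def inverse_ennreal mult.commute inverse_eq_divide)
    also have "\<dots> \<le> ennreal (dbl / m) * ?S"
      using md' m d dbl_ge by (intro mult_right_mono ennreal_leI) (auto simp: field_simps)
    also have "\<dots> = ennreal dbl * (?S / ?m)"
      using m dbl_ge by (simp add: divide_ennreal_def inverse_ennreal divide_inverse ennreal_mult mult_ac)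
    finally show ?thesis .
  qed
  then have "ennreal_powr (averaged G (y, t)) p \<le> ennreal_powr (ennreal dbl * (?S / ?m)) p"
    using p by (intro ennreal_powr_mono) auto
  also have "\<dots> = ennreal (dbl powr p) * ennreal_powr (?S / ?m) p"
    using dbl_ge by (intro ennreal_powr_cmult) auto
  finally have "ennreal_powr (averaged G (y, t)) p \<le> ennreal (dbl powr p) * ennreal_powr (?S / ?m) p" .
  then have "ennreal_powr (averaged G (y, t)) p * ?d \<le> ennreal (dbl powr p) * ennreal_powr (?S / ?m) p * ?m"
    using dm by (rule mult_mono) auto
  also have "\<dots> = ennreal (dbl powr p) * (ennreal_powr (?S / ?m) p * ?m)" by (simp add: mult.assoc)
  also have "\<dots> \<le> ennreal (dbl powr p) * (ennreal (2 powr p) * (\<integral>\<^sup>+v\<in>cube y ?c. ennreal_powr (G (v, t)) p * w v \<partial>lborel))"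
  proof (intro mult_left_mono)
    show "ennreal_powr (?S / ?m) p * ?m \<le> ennreal (2 powr p) * (\<integral>\<^sup>+v\<in>cube y ?c. ennreal_powr (G (v, t)) p * w v \<partial>lborel)"
      using ennreal_jensen_powr[of "\<lambda>v. G (v, t)" lborel "\<lambda>v. w v * indicator (cube y ?c) v" p ?m] p mass_pos[OF c(1)] mass_fin
      by (simp add: mass_def mult.assoc)
  qed simp
  also have "\<dots> = ennreal ((2 * dbl) powr p) * (\<integral>\<^sup>+v\<in>cube y ?c. ennreal_powr (G (v, t)) p * w v \<partial>lborel)"
    using dbl_ge by (simp add: powr_mult ennreal_mult mult_ac)
  finally show ?thesis .
qed

text \<open>After multiplying and dividing by \<open>mass w y t\<close>, Tonelli leaves for each v
  the integral of w y / \<open>mass w y t\<close> over the cube about v. Doubling replaces the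
  denominator by the mass of that very cube, so the integral is at most \<open>dbl\<close>.\<close>

lemma averaged_level:
  assumes [measurable]: "G \<in> borel_measurable (borel \<Otimes>\<^sub>M borel)" and t: "0 < t" "t < \<rho>"
  shows "(\<integral>\<^sup>+y. ennreal_powr (averaged G (y, t)) p * w y \<partial>lborel)
    \<le> ennreal ((2 * dbl) powr p * dbl) * (\<integral>\<^sup>+v. ennreal_powr (G (v, t)) p * w v \<partial>lborel)"
proof -
  let ?c = "(10 * real CARD('n) + 4) * t"
  let ?A = "ennreal ((2 * dbl) powr p)"
  have c: "0 < ?c" "2 * ?c \<le> 40 * real CARD('n) * t"
    using t le_n_mult[OF t(1)] by (simp_all only: ring_distribs mult.assoc)
  have "(\<integral>\<^sup>+y. ennreal_powr (averaged G (y, t)) p * w y \<partial>lborel)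
      \<le> (\<integral>\<^sup>+y. ?A * (\<integral>\<^sup>+v. ennreal_powr (G (v, t)) p * w v * (indicator (cube y ?c) v * (w y / mass w y t)) \<partial>lborel) \<partial>lborel)"
  proof (rule nn_integral_mono)
    fix y
    have d: "mass w y t \<noteq> 0" "mass w y t \<noteq> top" using mass_pos[OF t(1), of y] mass_fin[of y t] by auto
    have "ennreal_powr (averaged G (y, t)) p * w y = (ennreal_powr (averaged G (y, t)) p * mass w y t) * (w y / mass w y t)"
      using ennreal_divide_mult_cancel[OF d, of "w y"] by (simp add: mult.assoc mult.commute[of "mass w y t"])
    also have "\<dots> \<le> (?A * (\<integral>\<^sup>+v\<in>cube y ?c. ennreal_powr (G (v, t)) p * w v \<partial>lborel)) * (w y / mass w y t)"
      by (intro mult_right_mono averaged_pointwise t assms) simp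
    also have "\<dots> = ?A * (\<integral>\<^sup>+v. ennreal_powr (G (v, t)) p * w v * (indicator (cube y ?c) v * (w y / mass w y t)) \<partial>lborel)"
      by (simp add: mult.assoc nn_integral_multc[symmetric])
    finally show "ennreal_powr (averaged G (y, t)) p * w y \<le> \<dots>" .
  qed
  also have "\<dots> = ?A * (\<integral>\<^sup>+y. (\<integral>\<^sup>+v. ennreal_powr (G (v, t)) p * w v * (indicator (cube y ?c) v * (w y / mass w y t)) \<partial>lborel) \<partial>lborel)"
    by (rule nn_integral_cmult) measurable
  also have "(\<integral>\<^sup>+y. (\<integral>\<^sup>+v. ennreal_powr (G (v, t)) p * w v * (indicator (cube y ?c) v * (w y / mass w y t)) \<partial>lborel) \<partial>lborel)
      = (\<integral>\<^sup>+v. (\<integral>\<^sup>+y. ennreal_powr (G (v, t)) p * w v * (indicator (cube y ?c) v * (w y / mass w y t)) \<partial>lborel) \<partial>lborel)"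
    by (rule lborel_pair.Fubini') measurable
  also have "\<dots> \<le> (\<integral>\<^sup>+v. ennreal dbl * (ennreal_powr (G (v, t)) p * w v) \<partial>lborel)"
  proof (rule nn_integral_mono)
    fix v
    have m: "mass w v ?c \<noteq> 0" "mass w v ?c \<noteq> top" using mass_pos[OF c(1), of v] mass_fin[of v ?c] by auto
    have "(\<integral>\<^sup>+y. indicator (cube y ?c) v * (w y / mass w y t) \<partial>lborel)
        \<le> (\<integral>\<^sup>+y. (ennreal dbl / mass w v ?c) * (w y * indicator (cube v ?c) y) \<partial>lborel)"
    proof (rule nn_integral_mono)
      fix y
      show "indicator (cube y ?c) v * (w y / mass w y t) \<le> (ennreal dbl / mass w v ?c) * (w y * indicator (cube v ?c) y)"
      proof (cases "v \<in> cube y ?c")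
        case True
        have "mass w v ?c \<le> ennreal dbl * mass w y t"
        proof (intro mass_doubling)
          show "infnorm (y - v) + ?c \<le> 40 * real CARD('n) * t"
            using True c(2) unfolding cube_def mem_Collect_eq by linarith
        qed (use t in auto)
        then have "1 / mass w y t \<le> ennreal dbl / mass w v ?c"
          using mass_pos[OF c(1), of v] mass_fin mass_pos[OF t(1), of y] dbl_ge
          by (intro ennreal_inverse_le_divide) auto
        then have "1 / mass w y t * w y \<le> ennreal dbl / mass w v ?c * w y"
          by (rule mult_right_mono) simp
        then show ?thesis using True mem_cube_commute[of v y ?c]
          by (simp add: divide_ennreal_def mult_ac)
      qed simp
    qed
    also have "\<dots> = (ennreal dbl / mass w v ?c) * mass w v ?c"
      unfolding mass_def[of w v ?c, symmetric] by (subst nn_integral_cmult) (simp_all flip: mass_def)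
    also have "\<dots> = ennreal dbl"
      using m by (rule ennreal_divide_mult_cancel)
    finally have "(\<integral>\<^sup>+y. indicator (cube y ?c) v * (w y / mass w y t) \<partial>lborel) \<le> ennreal dbl" .
    then have "(ennreal_powr (G (v, t)) p * w v) * (\<integral>\<^sup>+y. indicator (cube y ?c) v * (w y / mass w y t) \<partial>lborel)
        \<le> (ennreal_powr (G (v, t)) p * w v) * ennreal dbl"
      by (rule mult_left_mono) simp
    then show "(\<integral>\<^sup>+y. ennreal_powr (G (v, t)) p * w v * (indicator (cube y ?c) v * (w y / mass w y t)) \<partial>lborel)
        \<le> ennreal dbl * (ennreal_powr (G (v, t)) p * w v)"
      by (subst nn_integral_cmult) (simp_all add: mult_ac)
  qed
  also have "\<dots> = ennreal dbl * (\<integral>\<^sup>+v. ennreal_powr (G (v, t)) p * w v \<partial>lborel)"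
    by (rule nn_integral_cmult) measurable
  finally show ?thesis using dbl_ge by (simp add: ennreal_mult mult.assoc mult_left_mono)
qed

lemma energy_averaged:
  assumes [measurable]: "G \<in> borel_measurable (borel \<Otimes>\<^sub>M borel)"
  shows "energy p \<rho> w (averaged G) \<le> ennreal ((2 * dbl) powr p * dbl) * energy p \<rho> w G"
proof -
  have "energy p \<rho> w (averaged G) \<le> (\<integral>\<^sup>+t. ennreal ((2 * dbl) powr p * dbl) *
     ((\<integral>\<^sup>+y. ennreal_powr (G (y, t)) p * w y \<partial>lborel) * ennreal (1 / t) * indicator {0<..<\<rho>} t) \<partial>lborel)"
    unfolding energy_def
  proof (rule nn_integral_mono)
    fix t :: real
    show "(\<integral>\<^sup>+y. ennreal_powr (averaged G (y, t)) p * w y \<partial>lborel) * ennreal (1 / t) * indicator {0<..<\<rho>} t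
      \<le> ennreal ((2 * dbl) powr p * dbl) * ((\<integral>\<^sup>+y. ennreal_powr (G (y, t)) p * w y \<partial>lborel) * ennreal (1 / t) * indicator {0<..<\<rho>} t)"
      using averaged_level[OF assms, of t]
      by (auto simp: indicator_def mult.assoc[symmetric] intro!: mult_right_mono)
  qed
  also have "\<dots> = ennreal ((2 * dbl) powr p * dbl) * energy p \<rho> w G"
    unfolding energy_def by (rule nn_integral_cmult) measurable
  finally show ?thesis .
qed

text \<open>A Harnack-type comparison: at a scale t \<ge> l the points x and z are close, so
  \<open>averaged G\<close> on the t-cube about x dominates the integral S of G * w over the t-cube
  about z, divided by \<open>dbl * mass w x t\<close>. Integrating against w over the cube about x
  returns S / \<open>dbl\<close>, scale by scale.\<close>

lemma potential_averaged:
  assumes [measurable]: "G \<in> borel_measurable (borel \<Otimes>\<^sub>M borel)"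
    and l: "0 < l" and xz: "infnorm (x - z) \<le> (10 * real CARD('n) + 2) * l"
  shows "potential \<alpha> {l..<\<rho>} w G z \<le> ennreal dbl * potential \<alpha> {0<..<\<rho>} w (averaged G) x"
proof -
  have "potential \<alpha> {l..<\<rho>} w G z \<le> (\<integral>\<^sup>+t. ennreal dbl * ((\<integral>\<^sup>+y\<in>cube x t. averaged G (y, t) * w y \<partial>lborel)
      * ennreal (t powr (\<alpha> - real CARD('n) - 1)) * indicator {0<..<\<rho>} t) \<partial>lborel)"
    unfolding potential_def
  proof (rule nn_integral_mono)
    fix t :: real
    show "(\<integral>\<^sup>+y\<in>cube z t. G (y, t) * w y \<partial>lborel) * ennreal (t powr (\<alpha> - real CARD('n) - 1)) * indicator {l..<\<rho>} t
       \<le> ennreal dbl * ((\<integral>\<^sup>+y\<in>cube x t. averaged G (y, t) * w y \<partial>lborel)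
      * ennreal (t powr (\<alpha> - real CARD('n) - 1)) * indicator {0<..<\<rho>} t)"
    proof (cases "t \<in> {l..<\<rho>}")
      case True
      then have t: "0 < t" "t < \<rho>" "l \<le> t" using l by auto
      let ?S = "\<integral>\<^sup>+y\<in>cube z t. G (y, t) * w y \<partial>lborel"
      have m: "mass w x t \<noteq> 0" "mass w x t \<noteq> top" using mass_pos[OF t(1), of x] mass_fin[of x t] by auto
      have "?S = ennreal dbl * (?S / (ennreal dbl * mass w x t) * mass w x t)"
        using ennreal_divide_mult_cancel[of "ennreal dbl * mass w x t" ?S] m dbl_ge
        by (simp add: ennreal_mult_eq_top_iff mult_ac)
      also have "?S / (ennreal dbl * mass w x t) * mass w x t
         = (\<integral>\<^sup>+y. ?S / (ennreal dbl * mass w x t) * (w y * indicator (cube x t) y) \<partial>lborel)"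
        unfolding mass_def by (rule nn_integral_cmult[symmetric]) measurable
      also have "\<dots> \<le> (\<integral>\<^sup>+y\<in>cube x t. averaged G (y, t) * w y \<partial>lborel)"
      proof (rule nn_integral_mono)
        fix y
        show "?S / (ennreal dbl * mass w x t) * (w y * indicator (cube x t) y) \<le> averaged G (y, t) * w y * indicator (cube x t) y"
        proof (cases "y \<in> cube x t")
          case y: True
          have "infnorm (y - z) \<le> infnorm (y - x) + infnorm (x - z)"
            using infnorm_triangle[of "y - x" "x - z"] by simp
          also have "infnorm (y - x) \<le> t" using y by (simp add: cube_def infnorm_sub)
          also have "infnorm (x - z) \<le> (10 * real CARD('n) + 2) * t"
            using xz t n_ge by (elim order_trans) (intro mult_left_mono; auto)
          finally have sub: "cube z t \<subseteq> cube y ((10 * real CARD('n) + 4) * t)"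
            by (intro cube_subset) (auto simp: algebra_simps)
          have "mass w y t \<le> ennreal dbl * mass w x t"
          proof (intro mass_doubling)
            show "infnorm (x - y) + t \<le> 40 * real CARD('n) * t"
              using y le_n_mult[OF t(1)] t unfolding cube_def mem_Collect_eq mult.assoc by linarith
          qed (use t in auto)
          then have "?S / (ennreal dbl * mass w x t) \<le> ?S / mass w y t"
            unfolding divide_ennreal_def by (intro mult_left_mono ennreal_inverse_antimono) auto
          also have "\<dots> \<le> averaged G (y, t)"
            unfolding averaged_def prod.case
            by (intro divide_right_mono_ennreal nn_integral_mono) (use sub in \<open>auto simp: indicator_def\<close>)
          finally show ?thesis using y by (auto intro: mult_right_mono)
        qed simp
      qed
      finally have "?S \<le> ennreal dbl * (\<integral>\<^sup>+y\<in>cube x t. averaged G (y, t) * w y \<partial>lborel)"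
        by (simp add: mult_left_mono)
      then show ?thesis using t by (auto simp: mult.assoc[symmetric] intro: mult_right_mono)
    qed simp
  qed
  also have "\<dots> = ennreal dbl * potential \<alpha> {0<..<\<rho>} w (averaged G) x"
    unfolding potential_def by (rule nn_integral_cmult) measurable
  finally show ?thesis .
qed

end

section \<open>Capacity and energy of cubes\<close>

definition cube_capacity_const :: "nat \<Rightarrow> real \<Rightarrow> real \<Rightarrow> real" where
  "cube_capacity_const n K p = (2 * doubling_const n K) powr p * doubling_const n K"

text \<open>The power of l that the scales t < l leave in \<open>kernel_energy\<close>. For p > 1 it
  is positive exactly when n * \<theta> < \<alpha> * p.\<close>

definition energy_exponent :: "real \<Rightarrow> real \<Rightarrow> real \<Rightarrow> real \<Rightarrow> real" where
  "energy_exponent n \<alpha> p \<theta> = (\<alpha> * p - n * \<theta>) / (p - 1)"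

text \<open>The denominator comes from integrating t powr (b - 1) over (0, l), the power of 2 from
  the volumes (2 t)^n.\<close>

definition energy_const :: "real \<Rightarrow> real \<Rightarrow> real \<Rightarrow> real \<Rightarrow> real" where
  "energy_const n \<alpha> p \<theta> = 2 powr (n * (1 - \<theta>) / (p - 1) + n) / energy_exponent n \<alpha> p \<theta>"

context rh_weight begin

lemma mass_real:
  assumes "0 < r"
  obtains m where "mass w x r = ennreal m" "0 < m"
  using mass_pos[OF assms, of x] mass_fin[of x r] by (cases "mass w x r") (auto simp: ennreal_less_zero_iff)

text \<open>The test function is a constant on a slightly larger cube and on the scales between l /
  2 and l, where 1 / t and the kernel are comparable to their values at l. Doubling makes all masses
  involved comparable to m.\<close>

lemma capacity_cube:
  assumes l: "0 < l" "l \<le> \<rho>" and m: "mass w x0 l = ennreal m" "0 < m"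
  shows "borel_capacity \<alpha> p \<rho> w (cube x0 ((10 * real CARD('n) + 1) * l))
    \<le> ennreal (cube_capacity_const CARD('n) K p * (l powr ((real CARD('n) - \<alpha>) * p) * m powr (1 - p)))"
proof -
  let ?N = "real CARD('n)"
  \<comment> \<open>The value that makes the lower bound a * (m / dbl) * l powr (\<alpha> - n - 1) *
    (l / 2) of the potential equal to 1.\<close>
  define a where "a = 2 * dbl * l powr (?N - \<alpha>) / m"
  have a: "0 < a" using dbl_ge l m by (simp add: a_def)
  define G :: "(real^'n) \<times> real \<Rightarrow> ennreal" where
    "G = (\<lambda>(y, t). ennreal a * (indicator (cube x0 ((10 * ?N + 2) * l)) y * indicator {l/2<..<l} t))"
  have G [measurable]: "G \<in> borel_measurable (borel \<Otimes>\<^sub>M borel)"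
    unfolding G_def by measurable
  have half: "emeasure lborel {l/2<..<l} = ennreal (l/2)"
    using l by (simp add: emeasure_lborel_Ioo)
  have pot: "1 \<le> potential \<alpha> {0<..<\<rho>} w G x" if x: "x \<in> cube x0 ((10 * ?N + 1) * l)" for x
  proof -
    have "1 = ennreal (a * (m / dbl) * l powr (\<alpha> - ?N - 1)) * ennreal (l / 2)"
    proof -
      have "l powr (?N - \<alpha>) * (l powr (\<alpha> - ?N - 1) * l) = 1"
        using l powr_mult_base[of l "\<alpha> - ?N - 1"] by (simp add: mult.commute flip: powr_add)
      then have "a * (m / dbl) * l powr (\<alpha> - ?N - 1) * (l / 2) = 1"
        using dbl_ge m by (simp add: a_def field_simps)
      then show ?thesis using a m l dbl_ge by (simp flip: ennreal_mult)
    qed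
    also have "\<dots> = (\<integral>\<^sup>+t. ennreal (a * (m / dbl) * l powr (\<alpha> - ?N - 1)) * indicator {l/2<..<l} t \<partial>lborel)"
      by (subst nn_integral_cmult_indicator) (simp_all add: half)
    also have "\<dots> \<le> potential \<alpha> {0<..<\<rho>} w G x"
      unfolding potential_def
    proof (rule nn_integral_mono)
      fix t :: real
      show "ennreal (a * (m / dbl) * l powr (\<alpha> - ?N - 1)) * indicator {l/2<..<l} t
        \<le> (\<integral>\<^sup>+y\<in>cube x t. G (y, t) * w y \<partial>lborel) * ennreal (t powr (\<alpha> - ?N - 1)) * indicator {0<..<\<rho>} t"
      proof (cases "t \<in> {l/2<..<l}")
        case True
        then have t: "0 < t" "l/2 < t" "t < l" "t < \<rho>" using l by auto
        have sub: "cube x t \<subseteq> cube x0 ((10 * ?N + 2) * l)"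
          using x t by (intro cube_subset) (simp add: cube_def algebra_simps)
        have "ennreal m \<le> ennreal dbl * mass w x (l/2)"
          unfolding m(1)[symmetric]
        proof (intro mass_doubling)
          have "infnorm (x - x0) < (10 * ?N + 1) * l" using x by (simp add: cube_def infnorm_sub)
          then show "infnorm (x - x0) + l \<le> 40 * ?N * (l/2)"
            using le_n_mult[OF l(1)] l(1) by (simp only: ring_distribs mult.assoc times_divide_eq_right)
        qed (use l in auto)
        also have "\<dots> \<le> ennreal dbl * mass w x t"
          using t by (intro mult_left_mono mass_mono) (auto simp: infnorm_0)
        finally have "ennreal (a / dbl) * ennreal m \<le> ennreal (a / dbl) * (ennreal dbl * mass w x t)"
          by (rule mult_left_mono) simp
        also have "\<dots> = ennreal a * mass w x t"
          using a dbl_ge by (simp flip: ennreal_mult mult.assoc)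
        also have "\<dots> = (\<integral>\<^sup>+y\<in>cube x t. G (y, t) * w y \<partial>lborel)"
          unfolding mass_def using sub True
          by (subst nn_integral_cmult[symmetric], measurable)
            (auto simp: G_def indicator_def intro!: nn_integral_cong)
        finally have "ennreal (a / dbl) * ennreal m * ennreal (l powr (\<alpha> - ?N - 1))
          \<le> (\<integral>\<^sup>+y\<in>cube x t. G (y, t) * w y \<partial>lborel) * ennreal (t powr (\<alpha> - ?N - 1))"
          using t l alpha_less by (intro mult_mono ennreal_leI powr_mono2') auto
        moreover have "ennreal (a * (m / dbl) * l powr (\<alpha> - ?N - 1))
            = ennreal (a / dbl) * ennreal m * ennreal (l powr (\<alpha> - ?N - 1))"
          using a m dbl_ge by (simp flip: ennreal_mult)
        ultimately show ?thesis using True t by simp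
      qed simp
    qed
    finally show ?thesis .
  qed
  have "energy p \<rho> w G \<le> (\<integral>\<^sup>+t. ennreal (a powr p * (dbl * m) * (2 / l)) * indicator {l/2<..<l} t \<partial>lborel)"
    unfolding energy_def
  proof (rule nn_integral_mono)
    fix t :: real
    show "(\<integral>\<^sup>+y. ennreal_powr (G (y, t)) p * w y \<partial>lborel) * ennreal (1 / t) * indicator {0<..<\<rho>} t
      \<le> ennreal (a powr p * (dbl * m) * (2 / l)) * indicator {l/2<..<l} t"
    proof (cases "t \<in> {l/2<..<l}")
      case True
      then have t: "0 < t" "l/2 < t" "t < l" "t < \<rho>" using l by auto
      have "(\<integral>\<^sup>+y. ennreal_powr (G (y, t)) p * w y \<partial>lborel) = ennreal (a powr p) * mass w x0 ((10 * ?N + 2) * l)"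
        unfolding mass_def using True a
        by (subst nn_integral_cmult[symmetric], measurable)
          (auto simp: G_def indicator_def ennreal_powr_ennreal intro!: nn_integral_cong)
      also have "mass w x0 ((10 * ?N + 2) * l) \<le> ennreal dbl * mass w x0 l"
      proof (intro mass_doubling)
        show "infnorm (x0 - x0) + (10 * ?N + 2) * l \<le> 40 * ?N * l"
          using le_n_mult[OF l(1)] l(1) by (simp only: ring_distribs mult.assoc diff_self infnorm_0)
      qed (use l in auto)
      finally have "(\<integral>\<^sup>+y. ennreal_powr (G (y, t)) p * w y \<partial>lborel) \<le> ennreal (a powr p * (dbl * m))"
        using dbl_ge m by (simp add: ennreal_mult mult_left_mono)
      then have "(\<integral>\<^sup>+y. ennreal_powr (G (y, t)) p * w y \<partial>lborel) * ennreal (1 / t)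
          \<le> ennreal (a powr p * (dbl * m)) * ennreal (2 / l)"
        using t l by (intro mult_mono ennreal_leI) (auto simp: field_simps)
      also have "\<dots> = ennreal (a powr p * (dbl * m) * (2 / l))"
        using dbl_ge m l by (intro ennreal_mult[symmetric]) auto
      finally show ?thesis using True t by simp
    next
      case False
      then have "G (y, t) = 0" for y by (simp add: G_def)
      then show ?thesis by simp
    qed
  qed
  also have "\<dots> = ennreal (a powr p * (dbl * m) * (2 / l)) * ennreal (l / 2)"
    by (subst nn_integral_cmult_indicator) (simp_all add: half)
  also have "\<dots> = ennreal (a powr p * (dbl * m))"
    using dbl_ge m l by (simp flip: ennreal_mult)
  also have "a powr p * (dbl * m) = cube_capacity_const CARD('n) K p * (l powr ((?N - \<alpha>) * p) * m powr (1 - p))"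
  proof -
    have "a powr p = (2 * dbl) powr p * l powr ((?N - \<alpha>) * p) / m powr p"
      using dbl_ge m l unfolding a_def by (simp add: powr_divide powr_mult powr_powr)
    moreover have "m powr (1 - p) = m / m powr p" using m by (simp add: powr_diff)
    ultimately show ?thesis by (simp add: cube_capacity_const_def dbl_def)
  qed
  finally have "energy p \<rho> w G \<le> ennreal (cube_capacity_const CARD('n) K p * (l powr ((?N - \<alpha>) * p) * m powr (1 - p)))" .
  moreover have "borel_capacity \<alpha> p \<rho> w (cube x0 ((10 * ?N + 1) * l)) \<le> energy p \<rho> w G"
    unfolding borel_capacity_def by (rule INF_lower) (use pot in auto)
  ultimately show ?thesis by (rule order_trans[rotated])
qed

section \<open>Lower bounds for the energy of a test function near one cube\<close>

definition local_energy :: "((real^'n) \<times> real \<Rightarrow> ennreal) \<Rightarrow> real^'n \<Rightarrow> real \<Rightarrow> ennreal" where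
  "local_energy G x l = (\<integral>\<^sup>+t\<in>{0<..<l}. (\<integral>\<^sup>+y\<in>cube x (2 * l). ennreal_powr (G (y, t)) p * w y \<partial>lborel)
     * ennreal (1 / t) \<partial>lborel)"

text \<open>Tonelli moves F into the kernel: a point y at scale t contributes to the potential of
  exactly the points of F in \<open>cube y t\<close>.\<close>

lemma nn_integral_potential:
  assumes [measurable]: "G \<in> borel_measurable (borel \<Otimes>\<^sub>M borel)" "F \<in> sets borel"
  shows "(\<integral>\<^sup>+x\<in>F. potential \<alpha> {0<..<l} w G x \<partial>lborel)
    = (\<integral>\<^sup>+t\<in>{0<..<l}. (\<integral>\<^sup>+y. G (y, t) * w y * emeasure lborel (F \<inter> cube y t) \<partial>lborel)
        * ennreal (t powr (\<alpha> - real CARD('n) - 1)) \<partial>lborel)"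
proof -
  let ?k = "\<lambda>t. ennreal (t powr (\<alpha> - real CARD('n) - 1))"
  have "(\<integral>\<^sup>+x\<in>F. potential \<alpha> {0<..<l} w G x \<partial>lborel)
     = (\<integral>\<^sup>+x. (\<integral>\<^sup>+t. (\<integral>\<^sup>+y\<in>cube x t. G (y, t) * w y \<partial>lborel) * ?k t * indicator {0<..<l} t * indicator F x \<partial>lborel) \<partial>lborel)"
    unfolding potential_def by (intro nn_integral_cong nn_integral_multc[symmetric]) measurable
  also have "\<dots> = (\<integral>\<^sup>+t. (\<integral>\<^sup>+x. (\<integral>\<^sup>+y\<in>cube x t. G (y, t) * w y \<partial>lborel) * ?k t * indicator {0<..<l} t * indicator F x \<partial>lborel) \<partial>lborel)"
    by (rule lborel_pair.Fubini') measurable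
  also have "\<dots> = (\<integral>\<^sup>+t\<in>{0<..<l}. (\<integral>\<^sup>+y. G (y, t) * w y * emeasure lborel (F \<inter> cube y t) \<partial>lborel) * ?k t \<partial>lborel)"
  proof (rule nn_integral_cong)
    fix t :: real
    have "(\<integral>\<^sup>+x. (\<integral>\<^sup>+y\<in>cube x t. G (y, t) * w y \<partial>lborel) * ?k t * indicator {0<..<l} t * indicator F x \<partial>lborel)
      = (\<integral>\<^sup>+x. (\<integral>\<^sup>+y. G (y, t) * w y * indicator (F \<inter> cube y t) x \<partial>lborel) * (?k t * indicator {0<..<l} t) \<partial>lborel)"
    proof (rule nn_integral_cong)
      fix x
      have "(\<integral>\<^sup>+y\<in>cube x t. G (y, t) * w y \<partial>lborel) * indicator F x
        = (\<integral>\<^sup>+y. G (y, t) * w y * indicator (cube x t) y * indicator F x \<partial>lborel)"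
        by (rule nn_integral_multc[symmetric]) measurable
      also have "\<dots> = (\<integral>\<^sup>+y. G (y, t) * w y * indicator (F \<inter> cube y t) x \<partial>lborel)"
        by (intro nn_integral_cong) (auto simp: indicator_def mem_cube_commute)
      finally have "(\<integral>\<^sup>+y\<in>cube x t. G (y, t) * w y \<partial>lborel) * indicator F x * (?k t * indicator {0<..<l} t)
        = (\<integral>\<^sup>+y. G (y, t) * w y * indicator (F \<inter> cube y t) x \<partial>lborel) * (?k t * indicator {0<..<l} t)"
        by (rule arg_cong)
      then show "(\<integral>\<^sup>+y\<in>cube x t. G (y, t) * w y \<partial>lborel) * ?k t * indicator {0<..<l} t * indicator F x
        = (\<integral>\<^sup>+y. G (y, t) * w y * indicator (F \<inter> cube y t) x \<partial>lborel) * (?k t * indicator {0<..<l} t)"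
        by (simp add: mult_ac)
    qed
    also have "\<dots> = (\<integral>\<^sup>+x. (\<integral>\<^sup>+y. G (y, t) * w y * indicator (F \<inter> cube y t) x \<partial>lborel) \<partial>lborel) * (?k t * indicator {0<..<l} t)"
      by (rule nn_integral_multc) measurable
    also have "(\<integral>\<^sup>+x. (\<integral>\<^sup>+y. G (y, t) * w y * indicator (F \<inter> cube y t) x \<partial>lborel) \<partial>lborel)
       = (\<integral>\<^sup>+y. (\<integral>\<^sup>+x. G (y, t) * w y * indicator (F \<inter> cube y t) x \<partial>lborel) \<partial>lborel)"
      by (rule lborel_pair.Fubini') measurable
    also have "\<dots> = (\<integral>\<^sup>+y. G (y, t) * w y * emeasure lborel (F \<inter> cube y t) \<partial>lborel)"
      by (intro nn_integral_cong nn_integral_cmult_indicator) measurable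
    finally show "(\<integral>\<^sup>+x. (\<integral>\<^sup>+y\<in>cube x t. G (y, t) * w y \<partial>lborel) * ?k t * indicator {0<..<l} t * indicator F x \<partial>lborel)
      = (\<integral>\<^sup>+y. G (y, t) * w y * emeasure lborel (F \<inter> cube y t) \<partial>lborel) * ?k t * indicator {0<..<l} t"
      by (simp add: mult.assoc)
  qed
  finally show ?thesis .
qed

text \<open>One factor |F \<inter> cube y t| is kept, since its integral over y is (2 t)^n f; the
  remaining power s is interpolated between the bounds f and (2 t)^n with weights \<theta> and 1 -
  \<theta>. The weight is bounded on the cube by \<open>rh\<close>.\<close>

lemma kernel_level:
  assumes [measurable]: "F \<in> sets borel" and f: "emeasure lborel F = ennreal f" "0 < f"
    and t: "0 < t" and \<theta>: "0 \<le> \<theta>" "\<theta> \<le> 1" and s: "0 \<le> s" and R: "0 < R" "R \<le> \<rho>"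
    and m: "mass w x0 R = ennreal m" "0 < m" and r: "r \<le> 40 * real CARD('n) * R"
  shows "(\<integral>\<^sup>+y\<in>cube x0 r. ennreal (measure lborel (F \<inter> cube y t) powr (1 + s)) * w y \<partial>lborel)
    \<le> ennreal (K * m / R ^ CARD('n) * f powr (1 + \<theta> * s) * (2 * t) powr (real CARD('n) * (1 - \<theta>) * s + real CARD('n)))"
proof -
  let ?N = "real CARD('n)" and ?v = "\<lambda>y. measure lborel (F \<inter> cube y t)"
  define W where "W = K * m / R ^ CARD('n)"
  have W: "0 \<le> W" using K_ge m R by (simp add: W_def)
  define A where "A = f powr (\<theta> * s) * (2 * t) powr (?N * (1 - \<theta>) * s)"
  have fin: "emeasure lborel (F \<inter> cube y t) = ennreal (?v y)" for y
    using f emeasure_mono[of "F \<inter> cube y t" F lborel]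
    by (intro emeasure_eq_ennreal_measure) (auto simp: top_unique)
  have vF: "?v y \<le> f" for y
    using f emeasure_mono[of "F \<inter> cube y t" F lborel] by (simp add: fin)
  have vt: "?v y \<le> (2 * t) powr ?N" for y
    using t emeasure_mono[of "F \<inter> cube y t" "cube y t" lborel] by (simp add: fin emeasure_cube powr_realpow)
  have pw: "?v y powr (1 + s) \<le> A * ?v y" for y
  proof (cases "?v y = 0")
    case False
    then have v: "0 < ?v y" by (simp add: zero_less_measure_iff order_less_le)
    have "?v y powr (1 + s) = ?v y powr (\<theta> * s) * ?v y powr ((1 - \<theta>) * s) * ?v y"
      using v by (simp add: powr_add[symmetric] powr_mult_base[symmetric] algebra_simps)
    also have "\<dots> \<le> f powr (\<theta> * s) * ((2 * t) powr ?N) powr ((1 - \<theta>) * s) * ?v y"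
      using v vF vt \<theta> s by (intro mult_right_mono mult_mono powr_mono2) auto
    also have "\<dots> = A * ?v y" by (simp add: A_def powr_powr mult.assoc)
    finally show ?thesis .
  qed simp
  have "(\<integral>\<^sup>+y\<in>cube x0 r. ennreal (?v y powr (1 + s)) * w y \<partial>lborel)
     \<le> (\<integral>\<^sup>+y. ennreal (W * A) * emeasure lborel (F \<inter> cube y t) \<partial>lborel)"
  proof (rule nn_integral_mono_AE)
    show "AE y in lborel. ennreal (?v y powr (1 + s)) * w y * indicator (cube x0 r) y
        \<le> ennreal (W * A) * emeasure lborel (F \<inter> cube y t)"
      using rh[OF R, of x0]
    proof eventually_elim
      case (elim y)
      show ?case
      proof (cases "y \<in> cube x0 r")
        case True
        then have "w y \<le> ennreal (K / R ^ CARD('n)) * ennreal m"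
          using elim r m(1) by (auto simp: cube_def)
        also have "\<dots> = ennreal W" using m R K_ge by (simp add: W_def flip: ennreal_mult)
        finally have "ennreal (?v y powr (1 + s)) * w y \<le> ennreal (A * ?v y) * ennreal W"
          using pw[of y] by (intro mult_mono ennreal_leI) auto
        also have "\<dots> = ennreal (W * A) * emeasure lborel (F \<inter> cube y t)"
          using W by (simp add: fin A_def mult_ac flip: ennreal_mult)
        finally show ?thesis using True by simp
      qed simp
    qed
  qed
  also have "\<dots> = ennreal (W * A) * (ennreal ((2 * t) ^ CARD('n)) * ennreal f)"
    by (subst nn_integral_cmult) (simp_all add: nn_integral_emeasure_Int_cube t f)
  also have "\<dots> = ennreal (W * A * ((2 * t) ^ CARD('n) * f))"
    using W t f by (simp add: A_def flip: ennreal_mult)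
  also have "W * A * ((2 * t) ^ CARD('n) * f) = W * f powr (1 + \<theta> * s) * (2 * t) powr (?N * (1 - \<theta>) * s + ?N)"
    using t f by (simp add: A_def powr_add powr_realpow[symmetric] powr_mult)
  finally show ?thesis by (simp add: W_def)
qed

text \<open>The dual term of Young's inequality, with s = 1 / (p - 1). \<open>kernel_level\<close>
  turns each scale into a multiple of a power of t, and the upper bound on \<theta> makes that power
  integrable at 0.\<close>

lemma kernel_energy:
  assumes [measurable]: "F \<in> sets borel" and f: "emeasure lborel F = ennreal f" "0 < f"
    and \<theta>: "0 < \<theta>" "\<theta> < 1" "\<theta> * real CARD('n) < \<alpha> * p" and l: "0 < l" "l \<le> \<rho>"
    and m: "mass w x0 l = ennreal m" "0 < m"
  shows "(\<integral>\<^sup>+t\<in>{0<..<l}. (\<integral>\<^sup>+y\<in>cube x0 (2 * l). ennreal ((t powr (\<alpha> - real CARD('n)) * measure lborel (F \<inter> cube y t)) powr (1 + 1 / (p - 1))) * w y \<partial>lborel)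
     * ennreal (1 / t) \<partial>lborel)
    \<le> ennreal (K * m / l ^ CARD('n) * f powr (1 + \<theta> / (p - 1)) * energy_const CARD('n) \<alpha> p \<theta> * l powr energy_exponent CARD('n) \<alpha> p \<theta>)"
proof -
  let ?N = "real CARD('n)" and ?b = "energy_exponent CARD('n) \<alpha> p \<theta>"
  define s where "s = 1 / (p - 1)"
  have s: "0 \<le> s" "s * (p - 1) = 1" using p by (auto simp: s_def)
  define B where "B = K * m / l ^ CARD('n) * f powr (1 + \<theta> * s) * 2 powr (?N * (1 - \<theta>) * s + ?N)"
  have B: "0 \<le> B" using K_ge m f l by (simp add: B_def)
  have b: "0 < ?b" using \<theta> p by (simp add: energy_exponent_def mult.commute)
  \<comment> \<open>The exponent of t collects the kernel raised to 1 + s, the interpolated volumes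
    of \<open>kernel_level\<close>, and the factor 1 / t.\<close>
  have beq: "(\<alpha> - ?N) * (1 + s) + (?N * (1 - \<theta>) * s + ?N) - 1 = ?b - 1"
  proof -
    have "?b = (\<alpha> * p - ?N * \<theta>) * s" by (simp add: energy_exponent_def s_def)
    moreover have "p * s = 1 + s" using s(2) by (simp add: algebra_simps)
    then have "\<alpha> * p * s = \<alpha> * (1 + s)" by (simp add: mult.assoc)
    ultimately show ?thesis by (simp add: algebra_simps)
  qed
  have "(\<integral>\<^sup>+t\<in>{0<..<l}. (\<integral>\<^sup>+y\<in>cube x0 (2 * l). ennreal ((t powr (\<alpha> - ?N) * measure lborel (F \<inter> cube y t)) powr (1 + s)) * w y \<partial>lborel) * ennreal (1 / t) \<partial>lborel)
    \<le> (\<integral>\<^sup>+t. ennreal B * (ennreal (t powr (?b - 1)) * indicator {0<..<l} t) \<partial>lborel)"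
  proof (rule nn_integral_mono)
    fix t :: real
    show "(\<integral>\<^sup>+y\<in>cube x0 (2 * l). ennreal ((t powr (\<alpha> - ?N) * measure lborel (F \<inter> cube y t)) powr (1 + s)) * w y \<partial>lborel) * ennreal (1 / t) * indicator {0<..<l} t
       \<le> ennreal B * (ennreal (t powr (?b - 1)) * indicator {0<..<l} t)"
    proof (cases "t \<in> {0<..<l}")
      case True
      then have t: "0 < t" "t < l" by auto
      have "(\<integral>\<^sup>+y\<in>cube x0 (2 * l). ennreal ((t powr (\<alpha> - ?N) * measure lborel (F \<inter> cube y t)) powr (1 + s)) * w y \<partial>lborel)
        = (\<integral>\<^sup>+y. ennreal (t powr ((\<alpha> - ?N) * (1 + s))) * (ennreal (measure lborel (F \<inter> cube y t) powr (1 + s)) * w y * indicator (cube x0 (2 * l)) y) \<partial>lborel)"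
        by (intro nn_integral_cong) (simp add: powr_mult powr_powr ennreal_mult mult.assoc)
      also have "\<dots> = ennreal (t powr ((\<alpha> - ?N) * (1 + s))) * (\<integral>\<^sup>+y\<in>cube x0 (2 * l). ennreal (measure lborel (F \<inter> cube y t) powr (1 + s)) * w y \<partial>lborel)"
        unfolding measure_def by (rule nn_integral_cmult) measurable
      also have "\<dots> \<le> ennreal (t powr ((\<alpha> - ?N) * (1 + s))) * ennreal (K * m / l ^ CARD('n) * f powr (1 + \<theta> * s) * (2 * t) powr (?N * (1 - \<theta>) * s + ?N))"
      proof (rule mult_left_mono)
        have "2 * l \<le> 40 * ?N * l" using le_n_mult[OF l(1)] l(1) unfolding mult.assoc by linarith
        then show "(\<integral>\<^sup>+y\<in>cube x0 (2 * l). ennreal (measure lborel (F \<inter> cube y t) powr (1 + s)) * w y \<partial>lborel)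
           \<le> ennreal (K * m / l ^ CARD('n) * f powr (1 + \<theta> * s) * (2 * t) powr (?N * (1 - \<theta>) * s + ?N))"
          using \<theta> by (intro kernel_level f t s l m assms) auto
      qed simp
      also have "\<dots> = ennreal (t powr ((\<alpha> - ?N) * (1 + s)) * (B * t powr (?N * (1 - \<theta>) * s + ?N)))"
        using t K_ge m l f by (simp add: B_def powr_mult ennreal_mult[symmetric] mult_ac)
      finally have "(\<integral>\<^sup>+y\<in>cube x0 (2 * l). ennreal ((t powr (\<alpha> - ?N) * measure lborel (F \<inter> cube y t)) powr (1 + s)) * w y \<partial>lborel) * ennreal (1 / t)
         \<le> \<dots> * ennreal (1 / t)" by (rule mult_right_mono) simp
      also have "\<dots> = ennreal (B * (t powr ((\<alpha> - ?N) * (1 + s)) * t powr (?N * (1 - \<theta>) * s + ?N) * t powr (-1)))"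
        using t B by (simp add: powr_minus_divide mult_ac flip: ennreal_mult)
      also have "t powr ((\<alpha> - ?N) * (1 + s)) * t powr (?N * (1 - \<theta>) * s + ?N) * t powr (-1) = t powr (?b - 1)"
        unfolding beq[symmetric] powr_add[symmetric] by simp
      finally show ?thesis using True B by (simp add: ennreal_mult)
    qed simp
  qed
  also have "\<dots> = ennreal B * ennreal (l powr ?b / ?b)"
    by (subst nn_integral_cmult) (simp_all add: nn_integral_powr_Ioo b l)
  also have "\<dots> = ennreal (K * m / l ^ CARD('n) * f powr (1 + \<theta> * s) * energy_const CARD('n) \<alpha> p \<theta> * l powr ?b)"
    using B b l by (simp add: B_def energy_const_def s_def mult_ac flip: ennreal_mult)
  finally show ?thesis by (simp add: s_def)
qed

end

definition local_const :: "nat \<Rightarrow> real \<Rightarrow> real \<Rightarrow> real \<Rightarrow> real \<Rightarrow> real" where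
  "local_const n K \<alpha> p \<theta> = cube_capacity_const n K p * (4 * (4 * K * energy_const n \<alpha> p \<theta>) powr (p - 1))"

context rh_weight begin

text \<open>The lower bound 1/2 is integrated over F, F is moved into the kernel, and Young's
  inequality with parameter d separates the p-energy of G from the kernel energy of F.\<close>

lemma half_measure_le_local_energy:
  assumes [measurable]: "G \<in> borel_measurable (borel \<Otimes>\<^sub>M borel)" "F \<in> sets borel"
    and f: "emeasure lborel F = ennreal f" "0 < f"
    and \<theta>: "0 < \<theta>" "\<theta> < 1" "\<theta> * real CARD('n) < \<alpha> * p" and l: "0 < l" "l \<le> \<rho>"
    and m: "mass w x0 l = ennreal m" "0 < m"
    and F: "F \<subseteq> cube x0 l" and pot: "\<And>x. x \<in> F \<Longrightarrow> ennreal (1/2) \<le> potential \<alpha> {0<..<l} w G x"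
    and d: "0 < d"
  shows "ennreal (f / 2) \<le> ennreal d * local_energy G x0 l + ennreal (d powr (- (1 / (p - 1))) *
    (K * m / l ^ CARD('n) * f powr (1 + \<theta> / (p - 1)) * energy_const CARD('n) \<alpha> p \<theta> * l powr energy_exponent CARD('n) \<alpha> p \<theta>))"
    (is "_ \<le> _ + ennreal (_ * ?J)")
proof -
  let ?N = "real CARD('n)"
  define s where "s = 1 / (p - 1)"
  let ?k = "\<lambda>t y. t powr (\<alpha> - ?N) * measure lborel (F \<inter> cube y t)"
  have fin: "emeasure lborel (F \<inter> cube y t) = ennreal (measure lborel (F \<inter> cube y t))" for y t
    using f emeasure_mono[of "F \<inter> cube y t" F lborel]
    by (intro emeasure_eq_ennreal_measure) (auto simp: top_unique)
  have "ennreal (f / 2) = ennreal (1/2) * emeasure lborel F"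
    unfolding f(1) using f(2) by (subst ennreal_mult[symmetric]) auto
  also have "\<dots> = (\<integral>\<^sup>+x. ennreal (1/2) * indicator F x \<partial>lborel)"
    by (rule nn_integral_cmult_indicator[symmetric]) simp
  also have "\<dots> \<le> (\<integral>\<^sup>+x\<in>F. potential \<alpha> {0<..<l} w G x \<partial>lborel)"
    using pot by (intro nn_integral_mono) (auto simp: indicator_def)
  also have "\<dots> = (\<integral>\<^sup>+t\<in>{0<..<l}. (\<integral>\<^sup>+y. G (y, t) * w y * emeasure lborel (F \<inter> cube y t) \<partial>lborel)
        * ennreal (t powr (\<alpha> - ?N - 1)) \<partial>lborel)"
    by (rule nn_integral_potential) measurable
  also have "\<dots> \<le> (\<integral>\<^sup>+t. ennreal d * ((\<integral>\<^sup>+y\<in>cube x0 (2 * l). ennreal_powr (G (y, t)) p * w y \<partial>lborel) * ennreal (1 / t) * indicator {0<..<l} t)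
      + ennreal (d powr - s) * ((\<integral>\<^sup>+y\<in>cube x0 (2 * l). ennreal (?k t y powr (1 + s)) * w y \<partial>lborel) * ennreal (1 / t) * indicator {0<..<l} t) \<partial>lborel)"
  proof (rule nn_integral_mono)
    fix t :: real
    let ?e = "\<integral>\<^sup>+y\<in>cube x0 (2 * l). ennreal_powr (G (y, t)) p * w y \<partial>lborel"
    let ?g = "\<integral>\<^sup>+y\<in>cube x0 (2 * l). ennreal (?k t y powr (1 + s)) * w y \<partial>lborel"
    show "(\<integral>\<^sup>+y. G (y, t) * w y * emeasure lborel (F \<inter> cube y t) \<partial>lborel) * ennreal (t powr (\<alpha> - ?N - 1)) * indicator {0<..<l} t
      \<le> ennreal d * (?e * ennreal (1 / t) * indicator {0<..<l} t) + ennreal (d powr - s) * (?g * ennreal (1 / t) * indicator {0<..<l} t)"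
    proof (cases "t \<in> {0<..<l}")
      case True
      then have t: "0 < t" "t < l" by auto
      have "(\<integral>\<^sup>+y. G (y, t) * w y * emeasure lborel (F \<inter> cube y t) \<partial>lborel) * ennreal (t powr (\<alpha> - ?N))
        = (\<integral>\<^sup>+y. G (y, t) * ennreal (?k t y) * w y \<partial>lborel)"
        by (subst nn_integral_multc[symmetric], measurable)
          (auto intro!: nn_integral_cong simp: fin ennreal_mult mult_ac)
      also have "\<dots> \<le> (\<integral>\<^sup>+y. ennreal d * (ennreal_powr (G (y, t)) p * w y * indicator (cube x0 (2 * l)) y)
           + ennreal (d powr - s) * (ennreal (?k t y powr (1 + s)) * w y * indicator (cube x0 (2 * l)) y) \<partial>lborel)"
      proof (rule nn_integral_mono)
        fix y
        show "G (y, t) * ennreal (?k t y) * w y \<le> ennreal d * (ennreal_powr (G (y, t)) p * w y * indicator (cube x0 (2 * l)) y)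
           + ennreal (d powr - s) * (ennreal (?k t y powr (1 + s)) * w y * indicator (cube x0 (2 * l)) y)"
        proof (cases "y \<in> cube x0 (2 * l)")
          case True
          have "G (y, t) * ennreal (?k t y) \<le> ennreal d * ennreal_powr (G (y, t)) p + ennreal (d powr - s * ?k t y powr (1 + s))"
            using ennreal_young[of d p "?k t y" "G (y, t)"] d p by (simp add: s_def)
          then have "G (y, t) * ennreal (?k t y) * w y \<le> (ennreal d * ennreal_powr (G (y, t)) p + ennreal (d powr - s * ?k t y powr (1 + s))) * w y"
            by (rule mult_right_mono) simp
          then show ?thesis using True by (simp add: distrib_right ennreal_mult mult.assoc)
        next
          case False
          \<comment> \<open>A cube of half-side t < l centred outside \<open>cube x0 (2 * l)\<close>
            cannot meet F; this is why \<open>local_energy\<close> is taken over the doubled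
            cube.\<close>
          have "F \<inter> cube y t = {}"
          proof (rule equals0I)
            fix z assume z: "z \<in> F \<inter> cube y t"
            then have "infnorm (x0 - z) < l" "infnorm (z - y) < t" using F by (auto simp: cube_def infnorm_sub)
            moreover have "infnorm (x0 - y) \<le> infnorm (x0 - z) + infnorm (z - y)"
              using infnorm_triangle[of "x0 - z" "z - y"] by simp
            ultimately show False using False t by (simp add: cube_def)
          qed
          then show ?thesis by simp
        qed
      qed
      also have "\<dots> = ennreal d * ?e + ennreal (d powr - s) * ?g"
        by (subst nn_integral_add, measurable) (simp add: nn_integral_cmult)
      finally have "(\<integral>\<^sup>+y. G (y, t) * w y * emeasure lborel (F \<inter> cube y t) \<partial>lborel) * ennreal (t powr (\<alpha> - ?N))
         * ennreal (1 / t) \<le> (ennreal d * ?e + ennreal (d powr - s) * ?g) * ennreal (1 / t)"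
        by (rule mult_right_mono) simp
      moreover have "(\<integral>\<^sup>+y. G (y, t) * w y * emeasure lborel (F \<inter> cube y t) \<partial>lborel) * ennreal (t powr (\<alpha> - ?N - 1))
        = (\<integral>\<^sup>+y. G (y, t) * w y * emeasure lborel (F \<inter> cube y t) \<partial>lborel) * ennreal (t powr (\<alpha> - ?N)) * ennreal (1 / t)"
        using t by (simp add: powr_diff mult.assoc flip: ennreal_mult)
      ultimately have "(\<integral>\<^sup>+y. G (y, t) * w y * emeasure lborel (F \<inter> cube y t) \<partial>lborel) * ennreal (t powr (\<alpha> - ?N - 1))
         \<le> (ennreal d * ?e + ennreal (d powr - s) * ?g) * ennreal (1 / t)"
        by simp
      then show ?thesis using True by (simp add: distrib_right mult.assoc)
    qed simp
  qed
  also have "\<dots> = ennreal d * local_energy G x0 l + ennreal (d powr - s) *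
     (\<integral>\<^sup>+t\<in>{0<..<l}. (\<integral>\<^sup>+y\<in>cube x0 (2 * l). ennreal (?k t y powr (1 + s)) * w y \<partial>lborel) * ennreal (1 / t) \<partial>lborel)"
    unfolding local_energy_def by (subst nn_integral_add, measurable) (simp add: nn_integral_cmult)
  also have "\<dots> \<le> ennreal d * local_energy G x0 l + ennreal (d powr - s) * ennreal ?J"
    unfolding s_def by (intro add_left_mono mult_left_mono kernel_energy assms f) auto
  finally show ?thesis
    by (subst ennreal_mult') (simp_all add: s_def)
qed

text \<open>Inserting d, the powers of m cancel and those of l combine to l powr (N * (1 -
  \<theta>)). The density bound \<tau> * l powr N \<le> f turns this into \<tau> powr - (1 -
  \<theta>) * f powr (1 - \<theta>), and f powr \<theta> from d completes the factor f.\<close>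

lemma local_real_estimate:
  fixes N f m l \<tau> E \<theta> b :: real
  assumes pos: "0 < f" "0 < m" "0 < l" "0 < \<tau>" "0 < E" and \<theta>: "\<theta> < 1" and tf: "\<tau> * l powr N \<le> f"
    and b: "b * (p - 1) = \<alpha> * p - N * \<theta>"
    and d: "d = (4 * (E * m / l powr N * f powr (\<theta> / (p - 1)) * l powr b)) powr (p - 1)"
  shows "l powr ((N - \<alpha>) * p) * m powr (1 - p) \<le> 4 * (4 * E) powr (p - 1) * \<tau> powr - (1 - \<theta>) * (f / (4 * d))"
proof -
  have d': "d = (4 * E) powr (p - 1) * m powr (p - 1) * l powr (\<alpha> * p - N * \<theta> - N * (p - 1)) * f powr \<theta>"
  proof -
    have "4 * (E * m / l powr N * f powr (\<theta> / (p - 1)) * l powr b) = (4 * E) * m * l powr (b - N) * f powr (\<theta> / (p - 1))"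
      using pos by (simp add: powr_diff)
    then have "d = (4 * E) powr (p - 1) * m powr (p - 1) * l powr ((b - N) * (p - 1)) * f powr (\<theta> / (p - 1) * (p - 1))"
      unfolding d by (simp only: powr_mult powr_powr)
    also have "(b - N) * (p - 1) = \<alpha> * p - N * \<theta> - N * (p - 1)" using b by (simp add: left_diff_distrib)
    also have "\<theta> / (p - 1) * (p - 1) = \<theta>" using p by simp
    finally show ?thesis .
  qed
  have dpos: "0 < d" using pos unfolding d' by simp
  have "\<tau> powr (1 - \<theta>) * (l powr (N * (1 - \<theta>))) = (\<tau> * l powr N) powr (1 - \<theta>)"
    using pos by (simp add: powr_mult powr_powr)
  also have "\<dots> \<le> f powr (1 - \<theta>)" using pos tf \<theta> by (intro powr_mono2) auto
  finally have tl: "l powr (N * (1 - \<theta>)) \<le> \<tau> powr - (1 - \<theta>) * f powr (1 - \<theta>)"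
    unfolding powr_minus_divide using pos by (simp add: pos_le_divide_eq mult.commute)
  have "l powr ((N - \<alpha>) * p) * m powr (1 - p) * d
      = (4 * E) powr (p - 1) * (l powr ((N - \<alpha>) * p) * l powr (\<alpha> * p - N * \<theta> - N * (p - 1))) * (m powr (1 - p) * m powr (p - 1)) * f powr \<theta>"
    unfolding d' by (simp add: mult_ac)
  also have "l powr ((N - \<alpha>) * p) * l powr (\<alpha> * p - N * \<theta> - N * (p - 1)) = l powr (N * (1 - \<theta>))"
    by (simp add: algebra_simps flip: powr_add)
  also have "m powr (1 - p) * m powr (p - 1) = 1" using pos by (simp flip: powr_add)
  also have "(4 * E) powr (p - 1) * l powr (N * (1 - \<theta>)) * 1 * f powr \<theta>
      \<le> (4 * E) powr (p - 1) * (\<tau> powr - (1 - \<theta>) * f powr (1 - \<theta>)) * 1 * f powr \<theta>"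
    using tl pos by (intro mult_right_mono mult_left_mono) auto
  also have "\<dots> = (4 * E) powr (p - 1) * \<tau> powr - (1 - \<theta>) * (f powr (1 - \<theta>) * f powr \<theta>)" by (simp add: mult_ac)
  also have "f powr (1 - \<theta>) * f powr \<theta> = f" using pos by (simp flip: powr_add)
  finally show ?thesis using dpos by (simp add: field_simps)
qed

text \<open>Links the upper bound of \<open>capacity_cube\<close> with a lower bound for the local
  energy through f / (4 * d).\<close>

lemma capacity_cube_le_local_energy:
  assumes G: "G \<in> borel_measurable (borel \<Otimes>\<^sub>M borel)" and F': "F \<in> sets borel"
    and \<theta>: "0 < \<theta>" "\<theta> < 1" "\<theta> * real CARD('n) < \<alpha> * p" and l: "0 < l" "l \<le> \<rho>"
    and F: "F \<subseteq> cube x0 l" and pot: "\<And>x. x \<in> F \<Longrightarrow> ennreal (1/2) \<le> potential \<alpha> {0<..<l} w G x"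
    and \<tau>: "0 < \<tau>" and Fl: "ennreal (\<tau> * l ^ CARD('n)) \<le> emeasure lborel F"
  shows "borel_capacity \<alpha> p \<rho> w (cube x0 ((10 * real CARD('n) + 1) * l))
    \<le> ennreal (local_const CARD('n) K \<alpha> p \<theta> * \<tau> powr - (1 - \<theta>)) * local_energy G x0 l"
proof -
  let ?N = "real CARD('n)" and ?e = "local_energy G x0 l" and ?b = "energy_exponent CARD('n) \<alpha> p \<theta>"
  obtain m where m: "mass w x0 l = ennreal m" "0 < m" using mass_real[OF l(1)] .
  have "emeasure lborel F \<le> emeasure lborel (cube x0 l)" using F by (intro emeasure_mono) auto
  then obtain f where f: "emeasure lborel F = ennreal f" "0 \<le> f"
    using l by (cases "emeasure lborel F") (auto simp: emeasure_cube top_unique)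
  have tf: "\<tau> * l ^ CARD('n) \<le> f" using Fl f \<tau> l by (simp add: f)
  moreover have "0 < \<tau> * l ^ CARD('n)" using \<tau> l by simp
  ultimately have f0: "0 < f" by linarith
  define E where "E = K * energy_const CARD('n) \<alpha> p \<theta>"
  have b: "0 < ?b" "?b * (p - 1) = \<alpha> * p - ?N * \<theta>"
    using \<theta> p by (auto simp: energy_exponent_def mult.commute)
  have E: "0 < E" using K_ge b by (simp add: E_def energy_const_def)
  define J where "J = E * m / l powr ?N * f powr (\<theta> / (p - 1)) * l powr ?b"
  \<comment> \<open>The Young parameter for which the second term is f / 4 (\<open>dJ\<close>), half
    of the left-hand side f / 2. What remains says that the local energy is at least f / (4 *
    d).\<close>
  define d where "d = (4 * J) powr (p - 1)"
  have J: "0 < J" using E m l f0 by (simp add: J_def)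
  then have d: "0 < d" by (simp add: d_def)
  have dJ: "d powr (- (1 / (p - 1))) * (J * f) = f / 4"
    using J p by (simp add: d_def powr_powr powr_minus_divide)
  have Jf: "K * m / l ^ CARD('n) * f powr (1 + \<theta> / (p - 1)) * energy_const CARD('n) \<alpha> p \<theta> * l powr ?b = J * f"
    using f0 l by (simp add: J_def E_def powr_add powr_realpow mult_ac)
  have le: "ennreal (f / 2) \<le> ennreal d * ?e + ennreal (f / 4)"
    using half_measure_le_local_energy[OF G F' f(1) f0 \<theta> l m F pot d] unfolding Jf dJ .
  have "ennreal (f / (4 * d)) \<le> ?e"
  proof (cases ?e)
    case (real e)
    then have "ennreal (f / 2) \<le> ennreal (d * e + f / 4)" using le d f0 by (simp add: ennreal_mult)
    then have "f / 2 \<le> d * e + f / 4" using d f0 real by (subst (asm) ennreal_le_iff) auto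
    then show ?thesis using real d by (auto intro!: ennreal_leI simp: field_simps)
  qed simp
  have "borel_capacity \<alpha> p \<rho> w (cube x0 ((10 * ?N + 1) * l))
      \<le> ennreal (cube_capacity_const CARD('n) K p * (l powr ((?N - \<alpha>) * p) * m powr (1 - p)))"
    by (rule capacity_cube[OF l m])
  also have "\<dots> \<le> ennreal (cube_capacity_const CARD('n) K p * (4 * (4 * E) powr (p - 1) * \<tau> powr - (1 - \<theta>) * (f / (4 * d))))"
  proof (intro ennreal_leI mult_left_mono)
    show "l powr ((?N - \<alpha>) * p) * m powr (1 - p) \<le> 4 * (4 * E) powr (p - 1) * \<tau> powr - (1 - \<theta>) * (f / (4 * d))"
      using f0 m l \<tau> E \<theta> tf b by (intro local_real_estimate[where b = ?b]) (auto simp: d_def J_def powr_realpow)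
    show "0 \<le> cube_capacity_const CARD('n) K p" using dbl_ge by (simp add: cube_capacity_const_def dbl_def)
  qed
  also have "\<dots> = ennreal (local_const CARD('n) K \<alpha> p \<theta> * \<tau> powr - (1 - \<theta>)) * ennreal (f / (4 * d))"
    using dbl_ge f0 d by (simp add: local_const_def E_def cube_capacity_const_def dbl_def mult_ac flip: ennreal_mult)
  also have "\<dots> \<le> ennreal (local_const CARD('n) K \<alpha> p \<theta> * \<tau> powr - (1 - \<theta>)) * ?e"
    by (intro mult_left_mono) (fact, simp)
  finally show ?thesis .
qed

end

section \<open>Restricted weak type estimate\<close>

context rh_weight begin

section \<open>Countable subadditivity of the capacity\<close>

lemma borel_capacity_mono: "E \<subseteq> E' \<Longrightarrow> borel_capacity \<alpha> p \<rho> w E \<le> borel_capacity \<alpha> p \<rho> w E'"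
  unfolding borel_capacity_def by (rule INF_superset_mono) auto

lemma borel_capacity_empty: "borel_capacity \<alpha> p \<rho> w {} = 0"
proof -
  have "borel_capacity \<alpha> p \<rho> w {} \<le> energy p \<rho> w (\<lambda>_. 0)"
    unfolding borel_capacity_def by (rule INF_lower) auto
  also have "\<dots> = 0" by (simp add: energy_def)
  finally show ?thesis by simp
qed

lemma potential_mono: "(\<And>z. G z \<le> G' z) \<Longrightarrow> potential \<alpha> T w G x \<le> potential \<alpha> T w G' x"
  unfolding potential_def by (intro nn_integral_mono mult_right_mono) auto

text \<open>The l^p combination of test functions is chosen because the energy is then exactly
  additive, while it still dominates every H k.\<close>

lemma energy_suminf:
  assumes [measurable]: "\<And>k. H k \<in> borel_measurable (borel \<Otimes>\<^sub>M borel)"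
  shows "energy p \<rho> w (\<lambda>z. ennreal_powr (\<Sum>k. ennreal_powr (H k z) p) (1 / p)) = (\<Sum>k. energy p \<rho> w (H k))"
proof -
  have "energy p \<rho> w (\<lambda>z. ennreal_powr (\<Sum>k. ennreal_powr (H k z) p) (1 / p))
     = (\<integral>\<^sup>+t\<in>{0<..<\<rho>}. (\<integral>\<^sup>+y. (\<Sum>k. ennreal_powr (H k (y, t)) p * w y) \<partial>lborel) * ennreal (1 / t) \<partial>lborel)"
    using p by (simp add: energy_def ennreal_powr_inverse ennreal_suminf_multc)
  also have "\<dots> = (\<integral>\<^sup>+t. (\<Sum>k. (\<integral>\<^sup>+y. ennreal_powr (H k (y, t)) p * w y \<partial>lborel) * ennreal (1 / t) * indicator {0<..<\<rho>} t) \<partial>lborel)"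
    by (subst nn_integral_suminf) (auto simp: ennreal_suminf_multc)
  also have "\<dots> = (\<Sum>k. energy p \<rho> w (H k))"
    unfolding energy_def by (rule nn_integral_suminf) measurable
  finally show ?thesis .
qed

text \<open>Near-optimal test functions with errors e / 2^(k+1) are combined as in
  \<open>energy_suminf\<close>. The sets E k are arbitrary, as the level sets of capacitary
  integrals require.\<close>

lemma borel_capacity_UN_le: "borel_capacity \<alpha> p \<rho> w (\<Union>k. E k) \<le> (\<Sum>k. borel_capacity \<alpha> p \<rho> w (E k))"
proof (rule ennreal_le_epsilon)
  fix e :: real assume e: "0 < e" and fin: "(\<Sum>k. borel_capacity \<alpha> p \<rho> w (E k)) < top"
  let ?c = "\<lambda>k. borel_capacity \<alpha> p \<rho> w (E k)"
  define A where "A k = {G \<in> borel_measurable (borel \<Otimes>\<^sub>M borel). \<forall>x\<in>E k. 1 \<le> potential \<alpha> {0<..<\<rho>} w G x}" for k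
  have "\<exists>H. H \<in> A k \<and> energy p \<rho> w H < ?c k + ennreal (e * (1 / 2) ^ Suc k)" for k
  proof -
    have ck: "?c k < top" using ennreal_suminf_lessD[OF fin, of k] by simp
    have "0 < ennreal (e * (1 / 2) ^ Suc k)"
      using e by simp
    then have "?c k + 0 < ?c k + ennreal (e * (1 / 2) ^ Suc k)"
      using ck by (subst ennreal_add_left_cancel_less) auto
    then have "(INF G\<in>A k. energy p \<rho> w G) < ?c k + ennreal (e * (1 / 2) ^ Suc k)"
      by (simp add: borel_capacity_def A_def)
    then show ?thesis unfolding INF_less_iff by (auto simp: Bex_def)
  qed
  then obtain H where HA: "\<And>k. H k \<in> A k" and en: "\<And>k. energy p \<rho> w (H k) < ?c k + ennreal (e * (1 / 2) ^ Suc k)"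
    using choice[of "\<lambda>k H. H \<in> A k \<and> energy p \<rho> w H < ?c k + ennreal (e * (1 / 2) ^ Suc k)"] by auto
  have H [measurable]: "H k \<in> borel_measurable (borel \<Otimes>\<^sub>M borel)" for k
    using HA[of k] by (simp add: A_def)
  have pot: "1 \<le> potential \<alpha> {0<..<\<rho>} w (H k) x" if "x \<in> E k" for k x
    using HA[of k] that by (simp add: A_def)
  let ?G = "\<lambda>z. ennreal_powr (\<Sum>k. ennreal_powr (H k z) p) (1 / p)"
  have le: "H k z \<le> ?G z" for k z
  proof -
    have "ennreal_powr (H k z) p \<le> (\<Sum>k. ennreal_powr (H k z) p)"
      using sum_le_suminf[of "\<lambda>k. ennreal_powr (H k z) p" "{k}"] by simp
    then have "ennreal_powr (ennreal_powr (H k z) p) (1 / p) \<le> ?G z"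
      using p by (intro ennreal_powr_mono) auto
    then show ?thesis using p by (simp add: ennreal_powr_inverse')
  qed
  have "borel_capacity \<alpha> p \<rho> w (\<Union>k. E k) \<le> energy p \<rho> w ?G"
    unfolding borel_capacity_def
  proof (rule INF_lower, safe)
    fix x k assume "x \<in> E k"
    from pot[OF this] show "1 \<le> potential \<alpha> {0<..<\<rho>} w ?G x"
      using potential_mono[of "H k" ?G, OF le] by (rule order_trans)
  qed measurable
  also have "\<dots> = (\<Sum>k. energy p \<rho> w (H k))" by (rule energy_suminf) measurable
  also have "\<dots> \<le> (\<Sum>k. ?c k + ennreal (e * (1 / 2) ^ Suc k))"
    by (intro suminf_le less_imp_le en) auto
  also have "\<dots> = (\<Sum>k. ?c k) + (\<Sum>k. ennreal (e * (1 / 2) ^ Suc k))"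
    by (rule suminf_add[symmetric]) (rule summableI)+
  also have "(\<Sum>k. ennreal (e * (1 / 2) ^ Suc k)) = ennreal (e * 1)"
    by (rule suminf_ennreal_eq[OF _ sums_mult[OF power_half_series]]) (use e in simp)
  finally show "borel_capacity \<alpha> p \<rho> w (\<Union>k. E k) \<le> (\<Sum>k. ?c k) + ennreal e" by simp
qed

lemma borel_capacity_Un_le:
  "borel_capacity \<alpha> p \<rho> w (A \<union> B) \<le> borel_capacity \<alpha> p \<rho> w A + borel_capacity \<alpha> p \<rho> w B"
proof -
  let ?E = "\<lambda>k::nat. if k = 0 then A else if k = 1 then B else {}"
  have "borel_capacity \<alpha> p \<rho> w (A \<union> B) \<le> borel_capacity \<alpha> p \<rho> w (\<Union>k. ?E k)"
    by (intro borel_capacity_mono) (auto split: if_splits intro: exI[of _ 0] exI[of _ 1])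
  also have "\<dots> \<le> (\<Sum>k. borel_capacity \<alpha> p \<rho> w (?E k))" by (rule borel_capacity_UN_le)
  also have "\<dots> = (\<Sum>k\<in>{0, 1}. borel_capacity \<alpha> p \<rho> w (?E k))"
    by (rule suminf_finite) (auto simp: borel_capacity_empty)
  finally show ?thesis by simp
qed

lemma suminf_local_energy_le:
  assumes [measurable]: "G \<in> borel_measurable (borel \<Otimes>\<^sub>M borel)"
    and l: "\<And>k. k \<in> J \<Longrightarrow> l k \<le> \<rho>"
    and disj: "disjoint_family (\<lambda>k::nat. if k \<in> J then cube (x k) (2 * l k) else {})"
  shows "(\<Sum>k. if k \<in> J then local_energy G (x k) (l k) else 0) \<le> energy p \<rho> w G"
proof -
  let ?A = "\<lambda>k. if k \<in> J then cube (x k) (2 * l k) else {}"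
  let ?H = "\<lambda>t y. ennreal_powr (G (y, t)) p * w y"
  have "(\<Sum>k. if k \<in> J then local_energy G (x k) (l k) else 0)
     \<le> (\<Sum>k. \<integral>\<^sup>+t. (\<integral>\<^sup>+y. ?H t y * indicator (?A k) y \<partial>lborel) * ennreal (1 / t) * indicator {0<..<\<rho>} t \<partial>lborel)"
  proof (intro suminf_le allI)
    fix k
    show "(if k \<in> J then local_energy G (x k) (l k) else 0) \<le> (\<integral>\<^sup>+t. (\<integral>\<^sup>+y. ?H t y * indicator (?A k) y \<partial>lborel) * ennreal (1 / t) * indicator {0<..<\<rho>} t \<partial>lborel)"
      using l[of k] unfolding local_energy_def
      by (cases "k \<in> J") (auto intro!: nn_integral_mono simp: indicator_def)
  qed auto
  also have "\<dots> = (\<integral>\<^sup>+t. (\<Sum>k. (\<integral>\<^sup>+y. ?H t y * indicator (?A k) y \<partial>lborel) * ennreal (1 / t) * indicator {0<..<\<rho>} t) \<partial>lborel)"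
  proof (rule nn_integral_suminf[symmetric])
    fix k
    have [measurable]: "?A k \<in> sets borel" by simp
    show "(\<lambda>t. (\<integral>\<^sup>+y. ?H t y * indicator (?A k) y \<partial>lborel) * ennreal (1 / t) * indicator {0<..<\<rho>} t) \<in> borel_measurable lborel"
      by measurable
  qed
  also have "\<dots> = (\<integral>\<^sup>+t. (\<integral>\<^sup>+y. (\<Sum>k. ?H t y * indicator (?A k) y) \<partial>lborel) * ennreal (1 / t) * indicator {0<..<\<rho>} t \<partial>lborel)"
    by (subst nn_integral_suminf) (auto simp: ennreal_suminf_multc)
  also have "\<dots> \<le> energy p \<rho> w G"
    unfolding energy_def
  proof (intro nn_integral_mono mult_right_mono)
    fix t y
    have "(\<Sum>k. ?H t y * indicator (?A k) y) = ?H t y * indicator (\<Union>k. ?A k) y"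
      unfolding ennreal_suminf_cmult suminf_indicator[OF disj] ..
    also have "\<dots> \<le> ?H t y" by (simp add: indicator_def)
    finally show "(\<Sum>k. ?H t y * indicator (?A k) y) \<le> ?H t y" .
  qed auto
  finally show ?thesis .
qed

lemma potential_split:
  assumes [measurable]: "G \<in> borel_measurable (borel \<Otimes>\<^sub>M borel)" and l: "0 < l" "l \<le> \<rho>"
  shows "potential \<alpha> {0<..<\<rho>} w G x = potential \<alpha> {0<..<l} w G x + potential \<alpha> {l..<\<rho>} w G x"
  unfolding potential_def using l
  by (subst nn_integral_add[symmetric], measurable) (auto intro!: nn_integral_cong simp: indicator_def)

end

text \<open>The first summand belongs to the cubes where large scales matter
  (\<open>borel_capacity_far\<close>), the second to those where small scales do
  (\<open>borel_capacity_near\<close>).\<close>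

definition weak_const :: "nat \<Rightarrow> real \<Rightarrow> real \<Rightarrow> real \<Rightarrow> real \<Rightarrow> real" where
  "weak_const n K \<alpha> p \<theta> = (2 * doubling_const n K) powr p * ((2 * doubling_const n K) powr p * doubling_const n K)
     + local_const n K \<alpha> p \<theta>"

text \<open>The level set \<open>{x. \<tau> < M 1_E x}\<close> of the local maximal function at scale \<open>\<rho>\<close>.\<close>

definition density_set :: "real \<Rightarrow> real \<Rightarrow> (real^'n) set \<Rightarrow> (real^'n) set" where
  "density_set \<rho> \<tau> E = {x. \<exists>Q\<in>cubes \<rho>. x \<in> Q \<and> ennreal \<tau> * emeasure lborel Q < emeasure lborel (E \<inter> Q)}"

lemma norm_le_card_infnorm: "norm (x :: real^'n) \<le> real CARD('n) * infnorm x"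
proof -
  have "sqrt (real CARD('n)) \<le> real CARD('n)"
    by (rule real_le_lsqrt) (auto simp: self_le_power)
  then have "sqrt (real CARD('n)) * infnorm x \<le> real CARD('n) * infnorm x"
    by (intro mult_right_mono infnorm_pos_le)
  then show ?thesis using norm_le_infnorm[of x] by simp
qed

context rh_weight begin

section \<open>Covering argument: far cubes, near cubes and the weak type bound\<close>

lemma energy_cmult:
  assumes "0 < c" and [measurable]: "G \<in> borel_measurable (borel \<Otimes>\<^sub>M borel)"
  shows "energy p \<rho> w (\<lambda>z. ennreal c * G z) = ennreal (c powr p) * energy p \<rho> w G"
proof -
  have "energy p \<rho> w (\<lambda>z. ennreal c * G z) = (\<integral>\<^sup>+t\<in>{0<..<\<rho>}. (\<integral>\<^sup>+y. ennreal (c powr p) * (ennreal_powr (G (y, t)) p * w y) \<partial>lborel) * ennreal (1 / t) \<partial>lborel)"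
    using assms by (simp add: energy_def ennreal_powr_cmult mult.assoc)
  also have "\<dots> = (\<integral>\<^sup>+t. ennreal (c powr p) * ((\<integral>\<^sup>+y. ennreal_powr (G (y, t)) p * w y \<partial>lborel) * ennreal (1 / t) * indicator {0<..<\<rho>} t) \<partial>lborel)"
    by (subst nn_integral_cmult) (auto simp: mult.assoc)
  also have "\<dots> = ennreal (c powr p) * energy p \<rho> w G"
    unfolding energy_def by (rule nn_integral_cmult) measurable
  finally show ?thesis .
qed

lemma potential_cmult:
  assumes [measurable]: "G \<in> borel_measurable (borel \<Otimes>\<^sub>M borel)" and T [measurable]: "T \<in> sets borel"
  shows "potential \<alpha> T w (\<lambda>z. ennreal c * G z) x = ennreal c * potential \<alpha> T w G x"
proof -
  have "potential \<alpha> T w (\<lambda>z. ennreal c * G z) x = (\<integral>\<^sup>+t\<in>T. (\<integral>\<^sup>+y. ennreal c * (G (y, t) * w y * indicator (cube x t) y) \<partial>lborel)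
      * ennreal (t powr (\<alpha> - real CARD('n) - 1)) \<partial>lborel)"
    by (simp add: potential_def mult.assoc)
  also have "\<dots> = (\<integral>\<^sup>+t. ennreal c * ((\<integral>\<^sup>+y\<in>cube x t. G (y, t) * w y \<partial>lborel)
      * ennreal (t powr (\<alpha> - real CARD('n) - 1)) * indicator T t) \<partial>lborel)"
    by (subst nn_integral_cmult) (auto simp: mult.assoc)
  also have "\<dots> = ennreal c * potential \<alpha> T w G x"
    unfolding potential_def by (rule nn_integral_cmult) measurable
  finally show ?thesis .
qed

text \<open>The single test function 2 * dbl * \<open>averaged G\<close> works for all of A,
  whatever z and l accompany each point: 2 compensates the bound 1/2 and \<open>dbl\<close> the loss
  in \<open>potential_averaged\<close>.\<close>

lemma borel_capacity_far:
  assumes G [measurable]: "G \<in> borel_measurable (borel \<Otimes>\<^sub>M borel)"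
    and far: "\<And>u. u \<in> A \<Longrightarrow> \<exists>z l. 0 < l \<and> infnorm (u - z) \<le> (10 * real CARD('n) + 2) * l \<and>
      ennreal (1/2) \<le> potential \<alpha> {l..<\<rho>} w G z"
  shows "borel_capacity \<alpha> p \<rho> w A \<le> ennreal ((2 * dbl) powr p * ((2 * dbl) powr p * dbl)) * energy p \<rho> w G"
proof -
  let ?G = "\<lambda>z. ennreal (2 * dbl) * averaged G z"
  have "borel_capacity \<alpha> p \<rho> w A \<le> energy p \<rho> w ?G"
    unfolding borel_capacity_def
  proof (rule INF_lower, safe)
    fix u assume "u \<in> A"
    from far[OF this] obtain z l where zl: "0 < l" "infnorm (u - z) \<le> (10 * real CARD('n) + 2) * l"
      "ennreal (1/2) \<le> potential \<alpha> {l..<\<rho>} w G z" by auto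
    have "1 = ennreal 2 * ennreal (1/2)" by (subst ennreal_mult[symmetric]) auto
    also have "\<dots> \<le> ennreal 2 * (ennreal dbl * potential \<alpha> {0<..<\<rho>} w (averaged G) u)"
      by (intro mult_left_mono order_trans[OF zl(3)] potential_averaged G zl) simp
    also have "\<dots> = potential \<alpha> {0<..<\<rho>} w ?G u"
      using dbl_ge by (subst potential_cmult) (auto simp: ennreal_mult mult.assoc)
    finally show "1 \<le> potential \<alpha> {0<..<\<rho>} w ?G u" .
  qed measurable
  also have "\<dots> = ennreal ((2 * dbl) powr p) * energy p \<rho> w (averaged G)"
    using dbl_ge by (intro energy_cmult) auto
  also have "\<dots> \<le> ennreal ((2 * dbl) powr p) * (ennreal ((2 * dbl) powr p * dbl) * energy p \<rho> w G)"
    by (intro mult_left_mono energy_averaged G) simp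
  also have "\<dots> = ennreal ((2 * dbl) powr p * ((2 * dbl) powr p * dbl)) * energy p \<rho> w G"
    using dbl_ge by (simp add: ennreal_mult mult.assoc)
  finally show ?thesis .
qed

lemma local_const_nonneg: "0 \<le> local_const CARD('n) K \<alpha> p \<theta>"
  using dbl_ge by (simp add: local_const_def cube_capacity_const_def dbl_def)

text \<open>Subadditivity and the one-cube estimate reduce the union to a sum of local energies,
  which disjointness of the doubled cubes bounds by the energy of G. The countable index set is
  transported into the naturals.\<close>

lemma borel_capacity_near:
  assumes G [measurable]: "G \<in> borel_measurable (borel \<Otimes>\<^sub>M borel)"
    and \<theta>: "0 < \<theta>" "\<theta> < 1" "\<theta> * real CARD('n) < \<alpha> * p" and \<tau>: "0 < \<tau>"
    and C: "countable C" and l: "\<And>x. x \<in> C \<Longrightarrow> 0 < l x \<and> l x \<le> \<rho>"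
    and disj: "pairwise (\<lambda>x y. disjnt (cube x (2 * l x)) (cube y (2 * l y))) C"
    and F: "\<And>x. x \<in> C \<Longrightarrow> F x \<in> sets borel" "\<And>x. x \<in> C \<Longrightarrow> F x \<subseteq> cube x (l x)"
      "\<And>x. x \<in> C \<Longrightarrow> ennreal (\<tau> * l x ^ CARD('n)) \<le> emeasure lborel (F x)"
      "\<And>x z. x \<in> C \<Longrightarrow> z \<in> F x \<Longrightarrow> ennreal (1/2) \<le> potential \<alpha> {0<..<l x} w G z"
  shows "borel_capacity \<alpha> p \<rho> w (\<Union>x\<in>C. cube x ((10 * real CARD('n) + 1) * l x))
    \<le> ennreal (local_const CARD('n) K \<alpha> p \<theta> * \<tau> powr - (1 - \<theta>)) * energy p \<rho> w G"
proof -
  let ?L = "ennreal (local_const CARD('n) K \<alpha> p \<theta> * \<tau> powr - (1 - \<theta>))"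
  let ?U = "\<lambda>x. cube x ((10 * real CARD('n) + 1) * l x)"
  define J where "J = to_nat_on C ` C"
  define g where "g = from_nat_into C"
  have g: "inj_on g J" "g ` J = C"
    using C by (auto simp: J_def g_def inj_on_def image_image)
  have gC: "k \<in> J \<Longrightarrow> g k \<in> C" for k using g(2) by auto
  have "borel_capacity \<alpha> p \<rho> w (\<Union>x\<in>C. ?U x) \<le> borel_capacity \<alpha> p \<rho> w (\<Union>k. if k \<in> J then ?U (g k) else {})"
    by (intro borel_capacity_mono) (auto simp: g(2)[symmetric])
  also have "\<dots> \<le> (\<Sum>k. borel_capacity \<alpha> p \<rho> w (if k \<in> J then ?U (g k) else {}))"
    by (rule borel_capacity_UN_le)
  also have "\<dots> \<le> (\<Sum>k. ?L * (if k \<in> J then local_energy G (g k) (l (g k)) else 0))"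
  proof (intro suminf_le allI)
    fix k
    show "borel_capacity \<alpha> p \<rho> w (if k \<in> J then ?U (g k) else {}) \<le> ?L * (if k \<in> J then local_energy G (g k) (l (g k)) else 0)"
      using capacity_cube_le_local_energy[OF G F(1) \<theta> _ _ F(2) F(4) \<tau> F(3), of "g k"] gC[of k] l[of "g k"]
      by (simp add: borel_capacity_empty)
  qed auto
  also have "\<dots> = ?L * (\<Sum>k. if k \<in> J then local_energy G (g k) (l (g k)) else 0)" by simp
  also have "\<dots> \<le> ?L * energy p \<rho> w G"
  proof (intro mult_left_mono suminf_local_energy_le G)
    show "disjoint_family (\<lambda>k. if k \<in> J then cube (g k) (2 * l (g k)) else {})"
      unfolding disjoint_family_on_def
    proof safe
      fix i j x assume "i \<noteq> j" "x \<in> (if i \<in> J then cube (g i) (2 * l (g i)) else {})"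
        "x \<in> (if j \<in> J then cube (g j) (2 * l (g j)) else {})"
      then have "i \<in> J" "j \<in> J" "g i \<noteq> g j" "\<not> disjnt (cube (g i) (2 * l (g i))) (cube (g j) (2 * l (g j)))"
        using g(1) by (auto simp: disjnt_def inj_on_def split: if_splits)
      then show "x \<in> {}" using disj gC by (auto simp: pairwise_def)
    qed
  qed (use gC l in auto)
  finally show ?thesis .
qed

lemma near_or_far:
  assumes "G \<in> borel_measurable (borel \<Otimes>\<^sub>M borel)" "0 < l" "l \<le> \<rho>"
    and "1 \<le> potential \<alpha> {0<..<\<rho>} w G z" "\<not> ennreal (1/2) \<le> potential \<alpha> {l..<\<rho>} w G z"
  shows "ennreal (1/2) \<le> potential \<alpha> {0<..<l} w G z"
proof (rule ccontr)
  assume "\<not> ?thesis"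
  then have "potential \<alpha> {0<..<l} w G z < ennreal (1/2)" "potential \<alpha> {l..<\<rho>} w G z < ennreal (1/2)"
    using assms(5) by auto
  then obtain a b where "potential \<alpha> {0<..<l} w G z = ennreal a" "a < 1/2" "0 \<le> a"
    "potential \<alpha> {l..<\<rho>} w G z = ennreal b" "b < 1/2" "0 \<le> b"
    by (cases "potential \<alpha> {0<..<l} w G z"; cases "potential \<alpha> {l..<\<rho>} w G z")
      (auto simp: ennreal_less_iff simp del: ennreal_half)
  then have "potential \<alpha> {0<..<\<rho>} w G z = ennreal (a + b)" "a + b < 1"
    using potential_split[OF assms(1-3), of z] by auto
  then show False using assms(4) \<open>0 \<le> a\<close> \<open>0 \<le> b\<close> by (simp add: ennreal_ge_1 del: ennreal_plus)
qed

text \<open>Each point of the level set is given a cube centred at it, Vitali selects countably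
  many, and these are sorted by whether the scales above l x contribute 1/2 somewhere on F
  x.\<close>

lemma borel_capacity_density_set_le_energy:
  assumes E [measurable]: "E \<in> sets borel" and \<tau>: "0 < \<tau>" "\<tau> \<le> 1"
    and \<theta>: "0 < \<theta>" "\<theta> < 1" "\<theta> * real CARD('n) < \<alpha> * p"
    and G [measurable]: "G \<in> borel_measurable (borel \<Otimes>\<^sub>M borel)"
    and adm: "\<And>x. x \<in> E \<Longrightarrow> 1 \<le> potential \<alpha> {0<..<\<rho>} w G x"
  shows "borel_capacity \<alpha> p \<rho> w (density_set \<rho> \<tau> E)
    \<le> ennreal (weak_const CARD('n) K \<alpha> p \<theta> * \<tau> powr - (1 - \<theta>)) * energy p \<rho> w G"
proof -
  let ?N = "real CARD('n)"
  let ?O = "density_set \<rho> \<tau> E"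
  define P where "P x c r \<longleftrightarrow> 0 < r \<and> 2 * r \<le> \<rho> \<and> x \<in> cube c r \<and>
      ennreal \<tau> * emeasure lborel (cube c r) < emeasure lborel (E \<inter> cube c r)" for x c :: "real^'n" and r
  have "\<forall>x\<in>?O. \<exists>cr. P x (fst cr) (snd cr)"
  proof
    fix x assume "x \<in> ?O"
    then obtain c r where "P x c r" by (auto simp: density_set_def cubes_eq P_def)
    then show "\<exists>cr. P x (fst cr) (snd cr)" by (intro exI[of _ "(c, r)"]) simp
  qed
  from bchoice[OF this] obtain cr' where cr': "\<And>x. x \<in> ?O \<Longrightarrow> P x (fst (cr' x)) (snd (cr' x))" by auto
  define c where "c x = fst (cr' x)" for x
  define r where "r x = snd (cr' x)" for x
  have cr: "0 < r x \<and> 2 * r x \<le> \<rho> \<and> x \<in> cube (c x) (r x) \<and>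
      ennreal \<tau> * emeasure lborel (cube (c x) (r x)) < emeasure lborel (E \<inter> cube (c x) (r x))" if "x \<in> ?O" for x
    using cr'[OF that] by (simp add: P_def c_def r_def)
  define l where "l x = 2 * r x" for x
  define F where "F x = E \<inter> cube (c x) (r x)" for x
  have l: "x \<in> ?O \<Longrightarrow> 0 < l x \<and> l x \<le> \<rho>" for x using cr by (auto simp: l_def)
  have F: "F x \<subseteq> cube x (l x)" if "x \<in> ?O" for x
  proof
    fix z assume "z \<in> F x"
    then have "infnorm (z - c x) < r x" "infnorm (c x - x) < r x"
      using cr[OF that] by (auto simp: F_def cube_def infnorm_sub)
    then show "z \<in> cube x (l x)"
      using infnorm_triangle[of "z - c x" "c x - x"] by (simp add: cube_def l_def infnorm_sub)
  qed
  have Fm: "ennreal (\<tau> * l x ^ CARD('n)) \<le> emeasure lborel (F x)" if "x \<in> ?O" for x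
  proof -
    have "ennreal (\<tau> * l x ^ CARD('n)) = ennreal \<tau> * emeasure lborel (cube (c x) (r x))"
      using cr[OF that] \<tau> by (subst ennreal_mult) (auto simp: emeasure_cube l_def)
    also have "\<dots> \<le> emeasure lborel (F x)" using cr[OF that] by (simp add: F_def less_imp_le)
    finally show ?thesis .
  qed
  \<comment> \<open>The Euclidean radius 2 n l contains the cube of half-side 2 l, so disjoint balls
    give disjoint doubled cubes. The balls enlarged five times lie in open cubes of half-side (10 n
    + 1) l; the extra l gives strictness.\<close>
  have "?O \<subseteq> (\<Union>x\<in>?O. cball x (2 * ?N * l x))" using l n_ge by (force simp: less_imp_le)
  moreover have "0 < 2 * ?N * l x \<and> 2 * ?N * l x \<le> 2 * ?N * \<rho>" if "x \<in> ?O" for x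
    using l[OF that] n_ge by (auto intro!: mult_left_mono)
  ultimately obtain C where C: "countable C" "C \<subseteq> ?O"
     "pairwise (\<lambda>i j. disjnt (cball i (2 * ?N * l i)) (cball j (2 * ?N * l j))) C"
     "?O \<subseteq> (\<Union>i\<in>C. cball i (5 * (2 * ?N * l i)))"
    by (rule Vitali_covering_lemma_cballs[of ?O "\<lambda>x. x" "\<lambda>x. 2 * ?N * l x" ?O])
  have cube_cball: "cube x (2 * l x) \<subseteq> cball x (2 * ?N * l x)" for x
  proof
    fix y assume "y \<in> cube x (2 * l x)"
    then have "?N * infnorm (x - y) \<le> ?N * (2 * l x)" by (simp add: cube_def)
    with norm_le_card_infnorm have "norm (x - y) \<le> ?N * (2 * l x)" by (rule order_trans)
    then show "y \<in> cball x (2 * ?N * l x)" by (simp add: dist_norm mult_ac)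
  qed
  have cball_cube: "cball x (5 * (2 * ?N * l x)) \<subseteq> cube x ((10 * ?N + 1) * l x)" if "x \<in> ?O" for x
  proof
    fix y assume "y \<in> cball x (5 * (2 * ?N * l x))"
    then have "infnorm (x - y) \<le> 10 * ?N * l x" using infnorm_le_norm[of "x - y"] by (simp add: dist_norm)
    then show "y \<in> cube x ((10 * ?N + 1) * l x)" using l[OF that] by (simp add: cube_def algebra_simps)
  qed
  define C1 where "C1 = {x\<in>C. \<exists>z\<in>F x. ennreal (1/2) \<le> potential \<alpha> {l x..<\<rho>} w G z}"
  define U where "U D = (\<Union>x\<in>D. cube x ((10 * ?N + 1) * l x))" for D
  have far: "borel_capacity \<alpha> p \<rho> w (U C1) \<le> ennreal ((2 * dbl) powr p * ((2 * dbl) powr p * dbl)) * energy p \<rho> w G"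
  proof (rule borel_capacity_far[OF G])
    fix u assume "u \<in> U C1"
    then obtain x z where x: "x \<in> C1" "u \<in> cube x ((10 * ?N + 1) * l x)" "z \<in> F x"
      "ennreal (1/2) \<le> potential \<alpha> {l x..<\<rho>} w G z" by (auto simp: U_def C1_def)
    have xO: "x \<in> ?O" using x(1) C(2) by (auto simp: C1_def)
    have "infnorm (u - z) \<le> infnorm (u - x) + infnorm (x - z)"
      using infnorm_triangle[of "u - x" "x - z"] by simp
    also have "infnorm (u - x) \<le> (10 * ?N + 1) * l x" using x(2) by (simp add: cube_def infnorm_sub)
    also have "infnorm (x - z) \<le> l x" using F[OF xO] x(3) by (auto simp: cube_def)
    finally show "\<exists>z l. 0 < l \<and> infnorm (u - z) \<le> (10 * ?N + 2) * l \<and> ennreal (1/2) \<le> potential \<alpha> {l..<\<rho>} w G z"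
      using x(4) l[OF xO] by (intro exI[of _ z] exI[of _ "l x"]) (simp add: algebra_simps)
  qed
  have near: "borel_capacity \<alpha> p \<rho> w (U (C - C1)) \<le> ennreal (local_const CARD('n) K \<alpha> p \<theta> * \<tau> powr - (1 - \<theta>)) * energy p \<rho> w G"
    unfolding U_def
  proof (rule borel_capacity_near[OF G \<theta> \<tau>(1), where F = F])
    show "countable (C - C1)" using C(1) by simp
    show "pairwise (\<lambda>x y. disjnt (cube x (2 * l x)) (cube y (2 * l y))) (C - C1)"
    proof (rule pairwise_mono[OF C(3)])
      fix x y assume "disjnt (cball x (2 * ?N * l x)) (cball y (2 * ?N * l y))"
      then show "disjnt (cube x (2 * l x)) (cube y (2 * l y))"
        using cube_cball[of x] cube_cball[of y] unfolding disjnt_def by blast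
    qed auto
    fix x assume x: "x \<in> C - C1"
    then have xO: "x \<in> ?O" using C(2) by auto
    show "0 < l x \<and> l x \<le> \<rho>" by (rule l[OF xO])
    show "F x \<in> sets borel" by (simp add: F_def E)
    show "F x \<subseteq> cube x (l x)" by (rule F[OF xO])
    show "ennreal (\<tau> * l x ^ CARD('n)) \<le> emeasure lborel (F x)" by (rule Fm[OF xO])
    fix z assume z: "z \<in> F x"
    show "ennreal (1/2) \<le> potential \<alpha> {0<..<l x} w G z"
    proof (rule near_or_far[OF G])
      show "1 \<le> potential \<alpha> {0<..<\<rho>} w G z" using z by (intro adm) (simp add: F_def)
      show "\<not> ennreal (1/2) \<le> potential \<alpha> {l x..<\<rho>} w G z" using x z by (auto simp: C1_def)
    qed (use l[OF xO] in auto)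
  qed
  have "?O \<subseteq> U C1 \<union> U (C - C1)"
  proof
    fix y assume "y \<in> ?O"
    then obtain x where "x \<in> C" "y \<in> cball x (5 * (2 * ?N * l x))" using C(4) by auto
    moreover from this have "x \<in> ?O" using C(2) by auto
    ultimately have "y \<in> cube x ((10 * ?N + 1) * l x)" "x \<in> C1 \<or> x \<in> C - C1" using cball_cube[of x] by blast+
    then show "y \<in> U C1 \<union> U (C - C1)" by (auto simp: U_def)
  qed
  then have "borel_capacity \<alpha> p \<rho> w ?O \<le> borel_capacity \<alpha> p \<rho> w (U C1) + borel_capacity \<alpha> p \<rho> w (U (C - C1))"
    by (rule order_trans[OF borel_capacity_mono borel_capacity_Un_le])
  also have "\<dots> \<le> ennreal ((2 * dbl) powr p * ((2 * dbl) powr p * dbl)) * energy p \<rho> w G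
     + ennreal (local_const CARD('n) K \<alpha> p \<theta> * \<tau> powr - (1 - \<theta>)) * energy p \<rho> w G"
    by (intro add_mono far near)
  also have "\<dots> \<le> ennreal ((2 * dbl) powr p * ((2 * dbl) powr p * dbl) * \<tau> powr - (1 - \<theta>)) * energy p \<rho> w G
     + ennreal (local_const CARD('n) K \<alpha> p \<theta> * \<tau> powr - (1 - \<theta>)) * energy p \<rho> w G"
  proof (intro add_right_mono mult_right_mono ennreal_leI)
    \<comment> \<open>The far bound is independent of \<tau>; as \<tau> \<le> 1 it can be multiplied
      by \<tau> powr - (1 - \<theta>) to match the near bound.\<close>
    have "1 powr - (1 - \<theta>) \<le> \<tau> powr - (1 - \<theta>)" using \<tau> \<theta> by (intro powr_mono2') auto
    then show "(2 * dbl) powr p * ((2 * dbl) powr p * dbl) \<le> (2 * dbl) powr p * ((2 * dbl) powr p * dbl) * \<tau> powr - (1 - \<theta>)"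
      using dbl_ge mult_left_mono[of 1 "\<tau> powr - (1 - \<theta>)" "(2 * dbl) powr p * ((2 * dbl) powr p * dbl)"] by simp
  qed simp
  also have "\<dots> = ennreal (weak_const CARD('n) K \<alpha> p \<theta> * \<tau> powr - (1 - \<theta>)) * energy p \<rho> w G"
  proof -
    have "weak_const CARD('n) K \<alpha> p \<theta> * \<tau> powr - (1 - \<theta>) = (2 * dbl) powr p * ((2 * dbl) powr p * dbl) * \<tau> powr - (1 - \<theta>)
       + local_const CARD('n) K \<alpha> p \<theta> * \<tau> powr - (1 - \<theta>)"
      by (simp add: weak_const_def dbl_def ring_distribs)
    moreover have "0 \<le> (2 * dbl) powr p * ((2 * dbl) powr p * dbl) * \<tau> powr - (1 - \<theta>)"
      "0 \<le> local_const CARD('n) K \<alpha> p \<theta> * \<tau> powr - (1 - \<theta>)"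
      using dbl_ge local_const_nonneg by auto
    ultimately show ?thesis by (simp only: ennreal_plus distrib_right)
  qed
  finally show ?thesis .
qed

lemma borel_capacity_density_set_le:
  assumes E: "E \<in> sets borel" and \<tau>: "0 < \<tau>" "\<tau> \<le> 1"
    and \<theta>: "0 < \<theta>" "\<theta> < 1" "\<theta> * real CARD('n) < \<alpha> * p"
  shows "borel_capacity \<alpha> p \<rho> w (density_set \<rho> \<tau> E)
    \<le> ennreal (weak_const CARD('n) K \<alpha> p \<theta> * \<tau> powr - (1 - \<theta>)) * borel_capacity \<alpha> p \<rho> w E"
proof -
  let ?c = "weak_const CARD('n) K \<alpha> p \<theta> * \<tau> powr - (1 - \<theta>)" and ?X = "borel_capacity \<alpha> p \<rho> w (density_set \<rho> \<tau> E)"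
  have c: "0 < ?c"
    using dbl_ge local_const_nonneg \<tau>
    by (auto simp: weak_const_def dbl_def intro!: mult_pos_pos add_pos_nonneg)
  \<comment> \<open>With the constant on the left, the right-hand side is a bare infimum and can be
    treated one test function at a time.\<close>
  have "ennreal (1 / ?c) * ?X \<le> borel_capacity \<alpha> p \<rho> w E"
    unfolding borel_capacity_def[of _ _ _ _ E]
  proof (rule INF_greatest)
    fix G assume "G \<in> {G \<in> borel_measurable (borel \<Otimes>\<^sub>M borel). \<forall>x\<in>E. 1 \<le> potential \<alpha> {0<..<\<rho>} w G x}"
    then have "ennreal (1 / ?c) * ?X \<le> ennreal (1 / ?c) * (ennreal ?c * energy p \<rho> w G)"
      by (intro mult_left_mono borel_capacity_density_set_le_energy E \<tau> \<theta>) auto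
    also have "\<dots> = energy p \<rho> w G"
      unfolding mult.assoc[symmetric] using c by (subst ennreal_mult[symmetric]) auto
    finally show "ennreal (1 / ?c) * ?X \<le> energy p \<rho> w G" .
  qed
  then have "ennreal ?c * (ennreal (1 / ?c) * ?X) \<le> ennreal ?c * borel_capacity \<alpha> p \<rho> w E"
    by (rule mult_left_mono) simp
  also have "ennreal ?c * (ennreal (1 / ?c) * ?X) = ?X"
    unfolding mult.assoc[symmetric] using c by (subst ennreal_mult[symmetric]) auto
  finally show ?thesis .
qed

end

section \<open>From A1 weights to the dual weight\<close>

text \<open>The local A1 condition for half-sides up to R, without an essential supremum: the
  average is bounded by a multiple of v almost everywhere on the cube, with the factor 2^n of the
  volume absorbed in A.\<close>

definition A1_property :: "(real^'n \<Rightarrow> real) \<Rightarrow> real \<Rightarrow> real \<Rightarrow> bool" where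
  "A1_property v A R \<longleftrightarrow> (\<forall>x r. 0 < r \<longrightarrow> r \<le> R \<longrightarrow>
     (AE z in lborel. z \<in> cube x r \<longrightarrow> mass (\<lambda>y. ennreal (v y)) x r \<le> ennreal (A * r ^ CARD('n)) * ennreal (v z)))"

text \<open>A cube of half-side r is covered by 2^n cubes of half-side 2 r / 3 that all contain the
  central cube of half-side r / 3. The A1 condition on each bounds its mass by A times that of the
  central cube; summing gives 2^n A, and one more use of A1 on the small cube containing z gives the
  second A.\<close>

lemma A1_property_extend_step:
  fixes v :: "real^'n \<Rightarrow> real"
  assumes v [measurable]: "v \<in> borel_measurable borel" and A: "A1_property v A R" "0 \<le> A"
  shows "A1_property v (2 ^ CARD('n) * A\<^sup>2) (3/2 * R)"
  unfolding A1_property_def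
proof (intro allI impI)
  fix x :: "real^'n" and r assume r: "0 < r" "r \<le> 3/2 * R"
  let ?I = "mass (\<lambda>y. ennreal (v y))"
  define r' where "r' = 2/3 * r"
  have r': "0 < r'" "r' \<le> R" "r' = 2 * (r/3)" "r' \<le> r" using r by (auto simp: r'_def)
  \<comment> \<open>Centres shifted by r / 3 in every coordinate, with signs \<sigma>; the cube that
    contains z is the one shifted towards z.\<close>
  define y where "y \<sigma> = x + (\<chi> i. if \<sigma> i then r/3 else - r/3)" for \<sigma> :: "'n \<Rightarrow> bool"
  have dist: "infnorm (y \<sigma> - x) = r/3" for \<sigma>
  proof -
    have "{\<bar>(y \<sigma> - x) $ i\<bar> | i. i \<in> UNIV} = {r/3}" using r by (auto simp: y_def)
    then show ?thesis unfolding infnorm_cart by simp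
  qed
  have cover: "\<exists>\<sigma>. z \<in> cube (y \<sigma>) r'" if z: "z \<in> cube x r" for z
  proof (intro exI)
    have xz: "\<bar>x $ i - z $ i\<bar> < r" for i using z r by (simp add: cube_def infnorm_less_iff)
    have "\<bar>(y (\<lambda>i. x $ i < z $ i) - z) $ i\<bar> < r'" for i
      using xz[of i] r(1) by (cases "x $ i < z $ i") (simp_all add: y_def r'_def abs_if split: if_splits)
    then show "z \<in> cube (y (\<lambda>i. x $ i < z $ i)) r'"
      by (simp add: cube_def infnorm_less_iff[OF r'(1)])
  qed
  have AEy: "AE z in lborel. z \<in> cube (y \<sigma>) r' \<longrightarrow> ?I (y \<sigma>) r' \<le> ennreal (A * r' ^ CARD('n)) * ennreal (v z)" for \<sigma>
    using A(1) r' unfolding A1_property_def by blast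
  have sub: "cube x (r/3) \<subseteq> cube (y \<sigma>) r'" for \<sigma>
    using dist[of \<sigma>] r by (intro cube_subset) (simp add: r'_def)
  have center: "?I (y \<sigma>) r' \<le> ennreal A * ?I x (r/3)" for \<sigma>
  proof -
    \<comment> \<open>The pointwise bound is integrated over the central cube, whose volume (2 r /
      3)^n is exactly r'^n.\<close>
    have "ennreal (r' ^ CARD('n)) * ?I (y \<sigma>) r' = (\<integral>\<^sup>+z. ?I (y \<sigma>) r' * indicator (cube x (r/3)) z \<partial>lborel)"
      using r by (subst nn_integral_cmult_indicator) (auto simp: emeasure_cube r'(3) mult.commute)
    also have "\<dots> \<le> (\<integral>\<^sup>+z. ennreal (A * r' ^ CARD('n)) * (ennreal (v z) * indicator (cube x (r/3)) z) \<partial>lborel)"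
    proof (rule nn_integral_mono_AE)
      show "AE z in lborel. ?I (y \<sigma>) r' * indicator (cube x (r/3)) z
          \<le> ennreal (A * r' ^ CARD('n)) * (ennreal (v z) * indicator (cube x (r/3)) z)"
        using AEy[of \<sigma>] by eventually_elim (use sub in \<open>auto simp: indicator_def\<close>)
    qed
    also have "\<dots> = ennreal (r' ^ CARD('n)) * (ennreal A * ?I x (r/3))"
      using A(2) r' by (subst nn_integral_cmult) (auto simp: mass_def ennreal_mult mult_ac)
    finally have "ennreal (1 / r' ^ CARD('n)) * (ennreal (r' ^ CARD('n)) * ?I (y \<sigma>) r')
        \<le> ennreal (1 / r' ^ CARD('n)) * (ennreal (r' ^ CARD('n)) * (ennreal A * ?I x (r/3)))"
      by (rule mult_left_mono) simp
    moreover have "ennreal (1 / r' ^ CARD('n)) * ennreal (r' ^ CARD('n)) = 1"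
      using r' by (subst ennreal_mult[symmetric]) auto
    ultimately show ?thesis unfolding mult.assoc[symmetric] by simp
  qed
  have all: "?I x r \<le> ennreal (2 ^ CARD('n) * A) * ?I x (r/3)"
  proof -
    have "?I x r \<le> (\<integral>\<^sup>+z. (\<Sum>\<sigma>\<in>UNIV. ennreal (v z) * indicator (cube (y \<sigma>) r') z) \<partial>lborel)"
      unfolding mass_def
    proof (rule nn_integral_mono)
      fix z
      show "ennreal (v z) * indicator (cube x r) z \<le> (\<Sum>\<sigma>\<in>UNIV. ennreal (v z) * indicator (cube (y \<sigma>) r') z)"
      proof (cases "z \<in> cube x r")
        case True
        then obtain \<sigma> where "z \<in> cube (y \<sigma>) r'" using cover by blast
        then have "ennreal (v z) * indicator (cube x r) z = ennreal (v z) * indicator (cube (y \<sigma>) r') z"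
          using True by simp
        also have "\<dots> \<le> (\<Sum>\<sigma>\<in>UNIV. ennreal (v z) * indicator (cube (y \<sigma>) r') z)"
          by (rule member_le_sum) auto
        finally show ?thesis .
      qed simp
    qed
    also have "\<dots> = (\<Sum>\<sigma>\<in>UNIV. ?I (y \<sigma>) r')"
      unfolding mass_def by (rule nn_integral_sum) measurable
    also have "\<dots> \<le> (\<Sum>\<sigma>\<in>(UNIV :: ('n \<Rightarrow> bool) set). ennreal A * ?I x (r/3))"
      by (intro sum_mono center)
    also have "\<dots> = ennreal (2 ^ CARD('n) * A) * ?I x (r/3)"
      using A(2) ennreal_power[of 2 "CARD('n)"] by (simp add: card_fun ennreal_mult mult.assoc)
    finally show ?thesis .
  qed
  have main: "?I x r \<le> ennreal (2 ^ CARD('n) * A) * ?I (y \<sigma>) r'" for \<sigma>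
  proof -
    have "?I x (r/3) \<le> ?I (y \<sigma>) r'"
      unfolding mass_def using sub[of \<sigma>] by (intro nn_integral_mono) (auto simp: indicator_def)
    then show ?thesis by (rule order_trans[OF all mult_left_mono]) simp
  qed
  have "AE z in lborel. \<forall>\<sigma>\<in>UNIV. z \<in> cube (y \<sigma>) r' \<longrightarrow> ?I (y \<sigma>) r' \<le> ennreal (A * r' ^ CARD('n)) * ennreal (v z)"
    using AEy by (intro AE_finite_allI) auto
  then show "AE z in lborel. z \<in> cube x r \<longrightarrow> ?I x r \<le> ennreal (2 ^ CARD('n) * A\<^sup>2 * r ^ CARD('n)) * ennreal (v z)"
  proof eventually_elim
    case (elim z)
    show ?case
    proof
      assume "z \<in> cube x r"
      then obtain \<sigma> where \<sigma>: "z \<in> cube (y \<sigma>) r'" using cover by blast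
      have "?I x r \<le> ennreal (2 ^ CARD('n) * A) * ?I (y \<sigma>) r'" by (rule main)
      also have "\<dots> \<le> ennreal (2 ^ CARD('n) * A) * (ennreal (A * r' ^ CARD('n)) * ennreal (v z))"
        using elim \<sigma> by (intro mult_left_mono) auto
      also have "\<dots> = ennreal (2 ^ CARD('n) * A\<^sup>2 * r' ^ CARD('n)) * ennreal (v z)"
        using A(2) r' by (subst mult.assoc[symmetric], subst ennreal_mult[symmetric]) (auto simp: power2_eq_square mult_ac)
      also have "\<dots> \<le> ennreal (2 ^ CARD('n) * A\<^sup>2 * r ^ CARD('n)) * ennreal (v z)"
        using r' by (intro mult_right_mono ennreal_leI mult_left_mono power_mono) auto
      finally show "?I x r \<le> ennreal (2 ^ CARD('n) * A\<^sup>2 * r ^ CARD('n)) * ennreal (v z)" .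
    qed
  qed
qed

primrec A1_extend :: "nat \<Rightarrow> real \<Rightarrow> nat \<Rightarrow> real" where
  "A1_extend n A 0 = A"
| "A1_extend n A (Suc k) = 2 ^ n * (A1_extend n A k)\<^sup>2"

lemma A1_extend_nonneg: "0 \<le> A \<Longrightarrow> 0 \<le> A1_extend n A k"
  by (cases k) auto

lemma A1_property_extend:
  fixes v :: "real^'n \<Rightarrow> real"
  assumes "v \<in> borel_measurable borel" "A1_property v A R" "0 \<le> A"
  shows "A1_property v (A1_extend CARD('n) A k) ((3/2) ^ k * R)"
  by (induction k) (use assms A1_property_extend_step[OF assms(1) _ A1_extend_nonneg] in \<open>auto simp: mult.assoc\<close>)

lemma A1_property_mono: "A1_property v A R \<Longrightarrow> R' \<le> R \<Longrightarrow> A1_property v A R'"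
  unfolding A1_property_def by (meson order_trans)

text \<open>Serves to obtain finiteness at other scales, where the size of A' is irrelevant;
  quantitative bounds go through \<open>A1_extend\<close> with a fixed number of steps.\<close>

lemma A1_property_extend_to:
  fixes v :: "real^'n \<Rightarrow> real"
  assumes "v \<in> borel_measurable borel" "A1_property v A R" "0 \<le> A" "0 < R"
  obtains A' where "A1_property v A' R'" "0 \<le> A'"
proof -
  obtain k where "R' / R < (3/2 :: real) ^ k" using real_arch_pow[of "3/2" "R' / R"] by auto
  then have "R' \<le> (3/2) ^ k * R" using assms(4) by (simp add: field_simps)
  then show thesis
    using A1_property_mono[OF A1_property_extend[OF assms(1-3)]] A1_extend_nonneg[OF assms(3)] that by blast
qed

section \<open>Reverse Hoelder inequality for the dual weight\<close>

definition rh_const :: "nat \<Rightarrow> real \<Rightarrow> real \<Rightarrow> real" where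
  "rh_const n p A = max 1 ((2 * A * (40 * real n) ^ n) powr (1 / (p - 1)))"

lemma dual_weight_upper:
  fixes v :: "real^'n \<Rightarrow> real"
  assumes v [measurable]: "v \<in> borel_measurable borel" and pos: "AE z in lborel. 0 < v z"
    and A: "A1_property v A R" "0 \<le> A" and p: "1 < p" and r: "0 < r" "r \<le> R"
    and m: "mass (\<lambda>y. ennreal (v y)) x r = ennreal m" "0 < m"
  shows "AE z in lborel. z \<in> cube x r \<longrightarrow> v z powr (- (1 / (p - 1))) \<le> (A * r ^ CARD('n) / m) powr (1 / (p - 1))"
proof -
  have "AE z in lborel. z \<in> cube x r \<longrightarrow> ennreal m \<le> ennreal (A * r ^ CARD('n)) * ennreal (v z)"
    using A(1) r unfolding A1_property_def m(1)[symmetric] by blast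
  then show ?thesis using pos
  proof eventually_elim
    case (elim z)
    show ?case
    proof
      assume "z \<in> cube x r"
      then have "ennreal m \<le> ennreal (A * r ^ CARD('n)) * ennreal (v z)" using elim by simp
      then have "m \<le> A * r ^ CARD('n) * v z" using elim A(2) r by (simp flip: ennreal_mult)
      then have "1 / v z \<le> A * r ^ CARD('n) / m" using elim m by (simp add: field_simps)
      then have "(1 / v z) powr (1 / (p - 1)) \<le> (A * r ^ CARD('n) / m) powr (1 / (p - 1))"
        using elim p by (intro powr_mono2) auto
      then show "v z powr (- (1 / (p - 1))) \<le> (A * r ^ CARD('n) / m) powr (1 / (p - 1))"
        using elim by (simp add: powr_divide powr_minus_divide)
    qed
  qed
qed

text \<open>Chebyshev: v is at most c, twice the upper bound for its average, on at least half of
  the cube, and there the negative power of v is at least that of c.\<close>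

lemma dual_weight_mass_lower:
  fixes v :: "real^'n \<Rightarrow> real"
  assumes v [measurable]: "v \<in> borel_measurable borel" and pos: "AE z in lborel. 0 < v z" and p: "1 < p"
    and s: "0 < s" and m: "mass (\<lambda>y. ennreal (v y)) x s \<le> ennreal m" "0 < m"
  shows "ennreal ((2 * m / (2 * s) ^ CARD('n)) powr (- (1 / (p - 1))) * ((2 * s) ^ CARD('n) / 2))
    \<le> mass (\<lambda>y. ennreal (v y powr (- (1 / (p - 1))))) x s"
proof -
  define V where "V = (2 * s) ^ CARD('n)"
  define c where "c = 2 * m / V"
  have V: "0 < V" and c: "0 < c" using s m by (auto simp: V_def c_def)
  let ?T = "{z \<in> cube x s. c < v z}" and ?S = "{z \<in> cube x s. v z \<le> c}"
  have Tm [measurable]: "?T \<in> sets borel" and Sm [measurable]: "?S \<in> sets borel" by measurable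
  have "ennreal c * emeasure lborel ?T = (\<integral>\<^sup>+z. ennreal c * indicator ?T z \<partial>lborel)"
    by (subst nn_integral_cmult_indicator) auto
  also have "\<dots> \<le> mass (\<lambda>y. ennreal (v y)) x s"
    unfolding mass_def by (intro nn_integral_mono) (auto simp: indicator_def intro: ennreal_leI)
  also have "\<dots> \<le> ennreal m" by fact
  finally have T: "ennreal c * emeasure lborel ?T \<le> ennreal m" .
  have split: "emeasure lborel ?S + emeasure lborel ?T = ennreal V"
  proof -
    have "?S \<union> ?T = cube x s" "?S \<inter> ?T = {}" by auto
    then have "emeasure lborel (cube x s) = emeasure lborel ?S + emeasure lborel ?T"
      using plus_emeasure[of ?S lborel ?T] by simp
    then show ?thesis using s by (simp add: emeasure_cube V_def)
  qed
  then obtain a b where ab: "emeasure lborel ?S = ennreal a" "0 \<le> a" "emeasure lborel ?T = ennreal b" "0 \<le> b"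
    by (cases "emeasure lborel ?S"; cases "emeasure lborel ?T") auto
  have "c * b \<le> m" using T c ab m by (simp flip: ennreal_mult)
  then have "b \<le> V / 2" using c m V by (simp add: c_def field_simps)
  moreover have "a + b = V" using split ab V by (simp flip: ennreal_plus)
  ultimately have a: "V / 2 \<le> a" by simp
  have "ennreal (c powr (- (1 / (p - 1))) * (V / 2)) \<le> ennreal (c powr (- (1 / (p - 1)))) * emeasure lborel ?S"
  proof -
    have "c powr (- (1 / (p - 1))) * (V / 2) \<le> c powr (- (1 / (p - 1))) * a"
      by (rule mult_left_mono[OF a]) simp
    then show ?thesis
      unfolding ab(1) using ab(2) by (subst ennreal_mult[symmetric]) (auto intro: ennreal_leI)
  qed
  also have "\<dots> = (\<integral>\<^sup>+z. ennreal (c powr (- (1 / (p - 1)))) * indicator ?S z \<partial>lborel)"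
    by (subst nn_integral_cmult_indicator) auto
  also have "\<dots> \<le> mass (\<lambda>y. ennreal (v y powr (- (1 / (p - 1))))) x s"
    unfolding mass_def
  proof (rule nn_integral_mono_AE)
    show "AE z in lborel. ennreal (c powr (- (1 / (p - 1)))) * indicator ?S z
        \<le> ennreal (v z powr (- (1 / (p - 1)))) * indicator (cube x s) z"
      using pos by eventually_elim (use p in \<open>auto simp: indicator_def intro!: ennreal_leI powr_mono2'\<close>)
  qed
  finally show ?thesis by (simp add: c_def V_def)
qed

lemma mass_pos_if_AE_pos:
  assumes [measurable]: "v \<in> borel_measurable borel" and pos: "AE z in lborel. 0 < v z" and r: "0 < r"
  shows "0 < mass v (x :: real^'n) r"
proof (rule ccontr)
  assume "\<not> ?thesis"
  then have "mass v x r = 0" by simp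
  then have "AE z in lborel. v z * indicator (cube x r) z = 0"
    unfolding mass_def by (subst (asm) nn_integral_0_iff_AE) auto
  then have "AE z in lborel. z \<notin> cube x r"
    using pos by eventually_elim (auto simp: indicator_def split: if_splits)
  then have "emeasure lborel (cube x r) = 0" by (subst (asm) AE_iff_measurable) auto
  then show False using r by (simp add: emeasure_cube)
qed

text \<open>On the cube of half-side L = 40 n t, A1 bounds the dual weight above in terms of the
  mass m of v; on the cube of half-side t, Chebyshev bounds its mass below in terms of the same m.
  The quotient of the bounds is controlled by (2 A (40 n)^n) powr (1 / (p - 1)), the origin of
  \<open>rh_const\<close>.\<close>

lemma rh_weight_dual:
  fixes v :: "real^'n \<Rightarrow> real"
  assumes v [measurable]: "v \<in> borel_measurable borel" and pos: "AE z in lborel. 0 < v z"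
    and fin: "\<And>x r. mass (\<lambda>y. ennreal (v y)) x r < top"
    and A: "A1_property v A (40 * real CARD('n) * \<rho>)" "0 \<le> A" and \<rho>: "0 < \<rho>"
    and \<alpha>: "0 < \<alpha>" "\<alpha> * p < real CARD('n)" and p: "1 < p"
    and K: "K = rh_const CARD('n) p A"
  shows "rh_weight (\<lambda>x. ennreal (v x powr (- (1 / (p - 1))))) \<rho> K \<alpha> p (doubling_const CARD('n) K)"
proof
  let ?w = "\<lambda>x. ennreal (v x powr (- (1 / (p - 1))))" and ?I = "mass (\<lambda>y. ennreal (v y))"
  let ?N = "real CARD('n)"
  define s where "s = 1 / (p - 1)"
  have s: "0 < s" using p by (simp add: s_def)
  have N: "1 \<le> ?N" by (simp add: Suc_leI)
  have posI: "AE z in lborel. 0 < ennreal (v z)" using pos by eventually_elim simp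
  have posw: "AE z in lborel. 0 < ?w z" using pos by eventually_elim simp
  have I: "\<exists>m>0. ?I x r = ennreal m" if "0 < r" for x r
    using mass_pos_if_AE_pos[OF _ posI that, of x] fin[of x r]
    by (cases "?I x r") (auto simp: ennreal_less_zero_iff)
  show "?w \<in> borel_measurable borel" by measurable
  show "1 \<le> K" by (simp add: K rh_const_def)
  show "0 < mass ?w x r" if "0 < r" for x r
    by (rule mass_pos_if_AE_pos[OF _ posw that]) measurable
  show "mass ?w x r < top" for x r
  proof (cases "0 < r")
    case r: True
    \<comment> \<open>The mass must be finite for every r, also beyond the range of A; any constant
      A' at the scale r will do.\<close>
    obtain A' where A': "A1_property v A' r" "0 \<le> A'"
      using A1_property_extend_to[OF v A, of r] \<rho> N by auto
    obtain m where m: "0 < m" "?I x r = ennreal m" using I[OF r] by blast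
    have "mass ?w x r \<le> (\<integral>\<^sup>+z. ennreal ((A' * r ^ CARD('n) / m) powr (1 / (p - 1))) * indicator (cube x r) z \<partial>lborel)"
      unfolding mass_def
    proof (rule nn_integral_mono_AE)
      show "AE z in lborel. ?w z * indicator (cube x r) z \<le> ennreal ((A' * r ^ CARD('n) / m) powr (1 / (p - 1))) * indicator (cube x r) z"
        using dual_weight_upper[OF v pos A' p r order_refl m(2,1)]
        by eventually_elim (auto simp: indicator_def intro: ennreal_leI)
    qed
    also have "\<dots> < top" using r by (subst nn_integral_cmult_indicator) (auto simp: emeasure_cube ennreal_mult_less_top)
    finally show ?thesis .
  next
    case False
    then have "cube x r = {}" by (auto simp: cube_def) (meson infnorm_pos_le not_less order_trans)
    then show ?thesis by (simp add: mass_def)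
  qed
  fix x t assume t: "0 < t" "t \<le> \<rho>"
  define L where "L = 40 * ?N * t"
  have L: "0 < L" "L \<le> 40 * ?N * \<rho>" using t N by (auto simp: L_def)
  have "1 * t \<le> 40 * ?N * t" by (rule mult_right_mono) (use t N in linarith)+
  then have tL: "t \<le> L" by (simp only: L_def mult_1)
  obtain m where m: "0 < m" "?I x L = ennreal m" using I[OF L(1)] by blast
  have "?I x t \<le> ennreal m"
    unfolding m(2)[symmetric] mass_def using cube_subset[of x x t L] tL
    by (intro nn_integral_mono) (auto simp: indicator_def infnorm_0)
  note lower = dual_weight_mass_lower[OF v pos p t(1) this m(1)]
  have real: "(A * L ^ CARD('n) / m) powr s \<le> K / t ^ CARD('n) * ((2 * m / (2 * t) ^ CARD('n)) powr (- s) * ((2 * t) ^ CARD('n) / 2))"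
  proof -
    have "(A * L ^ CARD('n) / m) powr s = (2 * A * (40 * ?N) ^ CARD('n)) powr s * (t ^ CARD('n) / (2 * m)) powr s"
      using t m A N by (subst powr_mult[symmetric]) (simp_all add: L_def power_mult_distrib mult_ac)
    also have "\<dots> \<le> K * ((2 * t) ^ CARD('n) / (2 * m)) powr s"
      using t m s by (intro mult_mono powr_mono2 divide_right_mono power_mono) (auto simp: K rh_const_def s_def)
    also have "\<dots> = K * (2 * m / (2 * t) ^ CARD('n)) powr (- s)"
      using t m by (simp add: powr_minus_divide powr_divide)
    \<comment> \<open>The surplus factor 2^n / 2 \<ge> 1 is inserted to match the half volume (2
      t)^n / 2 of \<open>dual_weight_mass_lower\<close>.\<close>
    also have "\<dots> \<le> K * (2 * m / (2 * t) ^ CARD('n)) powr (- s) * (2 ^ CARD('n) / 2)"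
      using self_le_power[of "2::real" "CARD('n)"] mult_left_mono[of 1 "2 ^ CARD('n) / 2" "K * (2 * m / (2 * t) ^ CARD('n)) powr (- s)"]
      by (simp add: K rh_const_def)
    also have "\<dots> = K / t ^ CARD('n) * ((2 * m / (2 * t) ^ CARD('n)) powr (- s) * ((2 * t) ^ CARD('n) / 2))"
      using t by (simp add: power_mult_distrib)
    finally show ?thesis .
  qed
  have "ennreal ((A * L ^ CARD('n) / m) powr s) \<le> ennreal (K / t ^ CARD('n)) * mass ?w x t"
  proof -
    have "ennreal ((A * L ^ CARD('n) / m) powr s) \<le> ennreal (K / t ^ CARD('n)) * ennreal ((2 * m / (2 * t) ^ CARD('n)) powr (- s) * ((2 * t) ^ CARD('n) / 2))"
      using real t by (subst ennreal_mult[symmetric]) (auto simp: K rh_const_def intro!: ennreal_leI)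
    also have "\<dots> \<le> ennreal (K / t ^ CARD('n)) * mass ?w x t"
      using lower by (intro mult_left_mono) (auto simp: s_def)
    finally show ?thesis .
  qed
  then have final: "ennreal a \<le> ennreal (K / t ^ CARD('n)) * mass ?w x t" if "a \<le> (A * L ^ CARD('n) / m) powr s" for a
    using ennreal_leI[OF that] by (rule order_trans[rotated])
  show "AE z in lborel. z \<in> cube x (40 * ?N * t) \<longrightarrow> ?w z \<le> ennreal (K / t ^ CARD('n)) * mass ?w x t"
    using dual_weight_upper[OF v pos A p L(1,2) m(2,1)] unfolding L_def[symmetric] s_def[symmetric]
    by eventually_elim (use final in \<open>auto simp: s_def\<close>)
qed (use \<rho> \<alpha> p in auto)

section \<open>Borel test functions\<close>

text \<open>Fubini for null sets, with t outermost as in the iterated integrals of the capacity. A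
  Borel null set covering the exceptional set makes the exchange of order measurable.\<close>

lemma AE_lborel_prod_commute:
  fixes P :: "(real^'n) \<times> real \<Rightarrow> bool"
  assumes "AE z in lborel. P z"
  shows "AE t in lborel. AE y in lborel. P (y, t)"
proof -
  obtain N where N: "{z. \<not> P z} \<subseteq> N" "N \<in> null_sets lborel"
    using assms by (auto elim: AE_E2 simp: AE_iff_null_sets eventually_ae_filter)
  have "AE z in lborel \<Otimes>\<^sub>M lborel. z \<notin> N" unfolding lborel_prod using N(2) by (rule AE_not_in)
  from lborel_pair.AE_pair[OF this] have "AE y in lborel. AE t in lborel. (y, t) \<notin> N" .
  moreover have "(AE y in lborel. AE t in lborel. (y, t) \<notin> N) \<longleftrightarrow> (AE t in lborel. AE y in lborel. (y, t) \<notin> N)"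
  proof (rule lborel_pair.AE_commute)
    have "{z \<in> space (lborel \<Otimes>\<^sub>M lborel). (fst z, snd z) \<notin> N} = - N" by (auto simp: space_pair_measure)
    also have "\<dots> \<in> sets (lborel \<Otimes>\<^sub>M lborel)" using N(2) unfolding lborel_prod by (auto simp: null_sets_def intro: borel_comp)
    finally show "{z \<in> space (lborel \<Otimes>\<^sub>M lborel). (fst z, snd z) \<notin> N} \<in> sets (lborel \<Otimes>\<^sub>M lborel)" .
  qed
  ultimately have "AE t in lborel. AE y in lborel. (y, t) \<notin> N" by simp
  then show ?thesis by eventually_elim (erule eventually_mono, use N(1) in auto)
qed

text \<open>Agreement of g and G for almost every y on almost every slice t suffices, and the
  potentials then agree at every x without exception, since x enters only through the domain of
  integration.\<close>

lemma lebesgue_integrals_eq_borel: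
  fixes \<omega> :: "real^'n \<Rightarrow> real"
  assumes w: "AE y in lborel. ennreal (dual_weight p \<omega> y) = w y" and nn: "\<And>y. 0 \<le> dual_weight p \<omega> y"
    and [measurable]: "w \<in> borel_measurable borel" "G \<in> borel_measurable (borel \<Otimes>\<^sub>M borel)"
    and g: "\<forall>y. \<forall>t\<in>{0<..<\<rho>}. 0 \<le> g (y, t)"
    and gG: "AE t in lborel. t \<in> {0<..<\<rho>} \<longrightarrow> (AE y in lborel. ennreal (g (y, t)) = G (y, t))"
  shows "(\<integral>\<^sup>+t\<in>{0<..<\<rho>}. (\<integral>\<^sup>+y. ennreal (g (y, t) powr p * dual_weight p \<omega> y) \<partial>lebesgue) * ennreal (1 / t) \<partial>lebesgue)
      = energy p \<rho> w G" (is "?E")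
    and "(\<integral>\<^sup>+t\<in>{0<..<\<rho>}. (\<integral>\<^sup>+y\<in>{y. infnorm (x - y) < t}.
        ennreal (g (y, t) / t powr (real CARD('n) - \<alpha>) * dual_weight p \<omega> y) \<partial>lebesgue) * ennreal (1 / t) \<partial>lebesgue)
      = potential \<alpha> {0<..<\<rho>} w G x" (is "?P")
proof -
  show ?E
    unfolding nn_integral_completion energy_def
  proof (rule nn_integral_cong_AE)
    show "AE t in lborel. (\<integral>\<^sup>+y. ennreal (g (y, t) powr p * dual_weight p \<omega> y) \<partial>lborel) * ennreal (1 / t) * indicator {0<..<\<rho>} t
        = (\<integral>\<^sup>+y. ennreal_powr (G (y, t)) p * w y \<partial>lborel) * ennreal (1 / t) * indicator {0<..<\<rho>} t"
      using gG
    proof eventually_elim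
      case (elim t)
      have "(\<integral>\<^sup>+y. ennreal (g (y, t) powr p * dual_weight p \<omega> y) \<partial>lborel) = (\<integral>\<^sup>+y. ennreal_powr (G (y, t)) p * w y \<partial>lborel)"
        if t: "t \<in> {0<..<\<rho>}"
      proof (rule nn_integral_cong_AE)
        have "AE y in lborel. ennreal (g (y, t)) = G (y, t)" using elim t by simp
        then show "AE y in lborel. ennreal (g (y, t) powr p * dual_weight p \<omega> y) = ennreal_powr (G (y, t)) p * w y"
          using w
        proof eventually_elim
          case (elim y)
          show ?case unfolding elim[symmetric] using g t nn[of y]
            by (simp add: ennreal_powr_ennreal ennreal_mult)
        qed
      qed
      then show ?case by (cases "t \<in> {0<..<\<rho>}") simp_all
    qed
  qed
  show ?P
    unfolding nn_integral_completion potential_def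
  proof (rule nn_integral_cong_AE)
    show "AE t in lborel. (\<integral>\<^sup>+y\<in>{y. infnorm (x - y) < t}. ennreal (g (y, t) / t powr (real CARD('n) - \<alpha>) * dual_weight p \<omega> y) \<partial>lborel)
          * ennreal (1 / t) * indicator {0<..<\<rho>} t
        = (\<integral>\<^sup>+y\<in>cube x t. G (y, t) * w y \<partial>lborel) * ennreal (t powr (\<alpha> - real CARD('n) - 1)) * indicator {0<..<\<rho>} t"
      using gG
    proof eventually_elim
      case (elim t)
      have "(\<integral>\<^sup>+y\<in>{y. infnorm (x - y) < t}. ennreal (g (y, t) / t powr (real CARD('n) - \<alpha>) * dual_weight p \<omega> y) \<partial>lborel) * ennreal (1 / t)
         = (\<integral>\<^sup>+y\<in>cube x t. G (y, t) * w y \<partial>lborel) * ennreal (t powr (\<alpha> - real CARD('n) - 1))"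
        if t: "t \<in> {0<..<\<rho>}"
      proof -
        have "(\<integral>\<^sup>+y\<in>{y. infnorm (x - y) < t}. ennreal (g (y, t) / t powr (real CARD('n) - \<alpha>) * dual_weight p \<omega> y) \<partial>lborel)
          = (\<integral>\<^sup>+y. (G (y, t) * w y * indicator (cube x t) y) * ennreal (t powr (\<alpha> - real CARD('n))) \<partial>lborel)"
        proof (rule nn_integral_cong_AE)
          have "AE y in lborel. ennreal (g (y, t)) = G (y, t)" using elim t by simp
          then show "AE y in lborel. ennreal (g (y, t) / t powr (real CARD('n) - \<alpha>) * dual_weight p \<omega> y) * indicator {y. infnorm (x - y) < t} y
              = (G (y, t) * w y * indicator (cube x t) y) * ennreal (t powr (\<alpha> - real CARD('n)))"
            using w
          proof eventually_elim
            case (elim y)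
            have "g (y, t) / t powr (real CARD('n) - \<alpha>) * dual_weight p \<omega> y = g (y, t) * dual_weight p \<omega> y * t powr (\<alpha> - real CARD('n))"
              using t by (simp add: powr_diff)
            then show ?case unfolding elim[symmetric] using g t nn[of y]
              by (simp add: ennreal_mult cube_def mult_ac)
          qed
        qed
        also have "\<dots> = (\<integral>\<^sup>+y\<in>cube x t. G (y, t) * w y \<partial>lborel) * ennreal (t powr (\<alpha> - real CARD('n)))"
          by (rule nn_integral_multc) measurable
        finally show ?thesis
          using t by (simp add: powr_diff mult.assoc flip: ennreal_mult)
      qed
      then show ?case by (cases "t \<in> {0<..<\<rho>}") simp_all
    qed
  qed
qed

lemma dual_weight_nonneg: "0 \<le> dual_weight p \<omega> y"
  by (simp add: dual_weight_def)

text \<open>If the energy of G is finite, then G is finite almost everywhere on almost every slice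
  because w > 0 almost everywhere; thus \<open>enn2real\<close> changes neither the energy nor any
  potential.\<close>

lemma capacity_le_borel_capacity:
  fixes \<omega> :: "real^'n \<Rightarrow> real"
  assumes w: "AE y in lborel. ennreal (dual_weight p \<omega> y) = w y" and pos: "AE y in lborel. 0 < w y"
    and [measurable]: "w \<in> borel_measurable borel"
  shows "capacity \<alpha> p \<rho> \<omega> E \<le> borel_capacity \<alpha> p \<rho> w E"
  unfolding borel_capacity_def
proof (rule INF_greatest)
  fix G assume "G \<in> {G \<in> borel_measurable (borel \<Otimes>\<^sub>M borel). \<forall>x\<in>E. 1 \<le> potential \<alpha> {0<..<\<rho>} w G x}"
  then have G [measurable]: "G \<in> borel_measurable (borel \<Otimes>\<^sub>M borel)"
    and adm: "\<And>x. x \<in> E \<Longrightarrow> 1 \<le> potential \<alpha> {0<..<\<rho>} w G x" by auto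
  show "capacity \<alpha> p \<rho> \<omega> E \<le> energy p \<rho> w G"
  proof (cases "energy p \<rho> w G = top")
    case False
    let ?g = "\<lambda>z. enn2real (G z)"
    have "AE t in lborel. (\<integral>\<^sup>+y. ennreal_powr (G (y, t)) p * w y \<partial>lborel) * ennreal (1 / t) * indicator {0<..<\<rho>} t \<noteq> \<infinity>"
      using False unfolding energy_def by (intro nn_integral_PInf_AE) auto
    then have gG: "AE t in lborel. t \<in> {0<..<\<rho>} \<longrightarrow> (AE y in lborel. ennreal (?g (y, t)) = G (y, t))"
    proof eventually_elim
      case (elim t)
      show ?case
      proof
        assume t: "t \<in> {0<..<\<rho>}"
        then have "(\<integral>\<^sup>+y. ennreal_powr (G (y, t)) p * w y \<partial>lborel) \<noteq> \<infinity>"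
          using elim by (auto simp: ennreal_mult_eq_top_iff)
        then have "AE y in lborel. ennreal_powr (G (y, t)) p * w y \<noteq> \<infinity>"
          by (intro nn_integral_PInf_AE) auto
        then show "AE y in lborel. ennreal (?g (y, t)) = G (y, t)"
          using pos by eventually_elim (auto simp: ennreal_mult_eq_top_iff less_top[symmetric])
      qed
    qed
    have "\<forall>y. \<forall>t\<in>{0<..<\<rho>}. 0 \<le> ?g (y, t)" by simp
    note eq = lebesgue_integrals_eq_borel[where g = ?g and G = G, OF w dual_weight_nonneg assms(3) G this gG]
    have "(\<lambda>z. ?g z) \<in> borel_measurable borel"
      using G unfolding borel_prod by measurable
    then have "?g \<in> borel_measurable (lebesgue_on (UNIV \<times> {0<..<\<rho>}))"
      by (intro measurable_restrict_space1 measurable_completion) simp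
    then have "admissible \<alpha> p \<rho> \<omega> E ?g"
      unfolding admissible_def eq(2) using adm by auto
    then have "capacity \<alpha> p \<rho> \<omega> E \<le> (\<integral>\<^sup>+t\<in>{0<..<\<rho>}. (\<integral>\<^sup>+y. ennreal (?g (y, t) powr p * dual_weight p \<omega> y) \<partial>lebesgue) * ennreal (1 / t) \<partial>lebesgue)"
      unfolding capacity_def by (intro INF_lower) simp
    also have "\<dots> = energy p \<rho> w G" by (rule eq(1))
    finally show ?thesis .
  qed simp
qed

text \<open>A Lebesgue measurable test function is extended by zero off the strip and replaced by a
  Borel representative, which Fubini shows to agree with it on almost every slice.\<close>

lemma borel_capacity_le_capacity:
  fixes \<omega> :: "real^'n \<Rightarrow> real"
  assumes w: "AE y in lborel. ennreal (dual_weight p \<omega> y) = w y"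
    and [measurable]: "w \<in> borel_measurable borel"
  shows "borel_capacity \<alpha> p \<rho> w E \<le> capacity \<alpha> p \<rho> \<omega> E"
  unfolding capacity_def
proof (rule INF_greatest)
  fix g :: "(real^'n) \<times> real \<Rightarrow> real" assume "g \<in> Collect (admissible \<alpha> p \<rho> \<omega> E)"
  then have adm: "admissible \<alpha> p \<rho> \<omega> E g" by simp
  let ?S = "UNIV \<times> {0<..<\<rho>} :: ((real^'n) \<times> real) set"
  have S: "?S \<in> sets borel" by (intro borel_open open_Times) auto
  have "(\<lambda>z. indicator ?S z *\<^sub>R g z) \<in> borel_measurable lebesgue"
    using adm S unfolding admissible_def by (subst borel_measurable_restrict_space_iff[symmetric]) auto
  then obtain h where h: "h \<in> borel_measurable lborel" and ae: "AE z in lborel. indicator ?S z *\<^sub>R g z = h z"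
    using completion_ex_borel_measurable_real by blast
  \<comment> \<open>\<open>ennreal\<close> sends negative values of h to 0; almost everywhere on the
    strip h equals the nonnegative g.\<close>
  let ?G = "\<lambda>z. ennreal (h z)"
  have G: "?G \<in> borel_measurable (borel \<Otimes>\<^sub>M borel)"
    using h unfolding borel_prod by simp
  have "AE t in lborel. AE y in lborel. indicator ?S (y, t) *\<^sub>R g (y, t) = h (y, t)"
    by (rule AE_lborel_prod_commute[OF ae])
  then have gG: "AE t in lborel. t \<in> {0<..<\<rho>} \<longrightarrow> (AE y in lborel. ennreal (g (y, t)) = ?G (y, t))"
  proof eventually_elim
    case (elim t)
    show ?case
    proof
      assume "t \<in> {0<..<\<rho>}"
      with elim show "AE y in lborel. ennreal (g (y, t)) = ?G (y, t)" by (auto elim!: eventually_mono)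
    qed
  qed
  have nn: "\<forall>y. \<forall>t\<in>{0<..<\<rho>}. 0 \<le> g (y, t)" using adm by (simp add: admissible_def)
  note eq = lebesgue_integrals_eq_borel[where g = g and G = ?G, OF w dual_weight_nonneg assms(2) G nn gG]
  have "borel_capacity \<alpha> p \<rho> w E \<le> energy p \<rho> w ?G"
    unfolding borel_capacity_def
  proof (rule INF_lower, safe)
    fix x assume "x \<in> E"
    then have "1 \<le> (\<integral>\<^sup>+t\<in>{0<..<\<rho>}. (\<integral>\<^sup>+y\<in>{y. infnorm (x - y) < t}.
        ennreal (g (y, t) / t powr (real CARD('n) - \<alpha>) * dual_weight p \<omega> y) \<partial>lebesgue) * ennreal (1 / t) \<partial>lebesgue)"
      using adm by (auto simp: admissible_def)
    then show "1 \<le> potential \<alpha> {0<..<\<rho>} w ?G x" unfolding eq(2) .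
  qed (fact G)
  then show "borel_capacity \<alpha> p \<rho> w E \<le> (\<integral>\<^sup>+t\<in>{0<..<\<rho>}. (\<integral>\<^sup>+y. ennreal (g (y, t) powr p * dual_weight p \<omega> y) \<partial>lebesgue) * ennreal (1 / t) \<partial>lebesgue)"
    unfolding eq(1) .
qed

section \<open>Borel version of the weight, and \<open>A1_const\<close> against
  \<open>A1_property\<close>\<close>

lemma weight_borel_version:
  fixes \<omega> :: "real^'n \<Rightarrow> real"
  assumes "weight \<omega>"
  obtains v where "v \<in> borel_measurable borel" "AE z in lborel. \<omega> z = v z" "AE z in lborel. 0 < v z"
    "\<And>x r. mass (\<lambda>y. ennreal (v y)) x r < top" "\<omega> \<in> borel_measurable lebesgue"
proof -
  have int: "\<And>C. compact C \<Longrightarrow> set_integrable lebesgue C \<omega>" and nn: "\<And>x. 0 \<le> \<omega> x" and pos: "AE x in lborel. 0 < \<omega> x"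
    using assms by (auto simp: weight_def AE_completion_iff)
  have meas: "\<omega> \<in> borel_measurable lebesgue"
  proof (rule borel_measurable_LIMSEQ_real)
    show "(\<lambda>z. indicator (cball 0 (real k)) z *\<^sub>R \<omega> z) \<in> borel_measurable lebesgue" for k
      using int[of "cball 0 (real k)"] unfolding set_integrable_def by auto
    fix z :: "real^'n"
    obtain k where k: "norm z \<le> real k" using real_arch_simple by blast
    have "eventually (\<lambda>j. indicator (cball 0 (real j)) z *\<^sub>R \<omega> z = \<omega> z) sequentially"
      using eventually_ge_at_top[of k] by eventually_elim (use k in auto)
    then show "(\<lambda>j. indicator (cball 0 (real j)) z *\<^sub>R \<omega> z) \<longlonglongrightarrow> \<omega> z"
      by (rule tendsto_eventually)
  qed
  then obtain v where v: "v \<in> borel_measurable lborel" "AE z in lborel. \<omega> z = v z"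
    using completion_ex_borel_measurable_real by blast
  have posv: "AE z in lborel. 0 < v z" using v(2) pos by eventually_elim simp
  have fin: "mass (\<lambda>y. ennreal (v y)) x r < top" for x r
  proof -
    let ?C = "cball x (real CARD('n) * \<bar>r\<bar>)"
    have sub: "cube x r \<subseteq> ?C"
    proof
      fix y assume "y \<in> cube x r"
      then have "real CARD('n) * infnorm (x - y) \<le> real CARD('n) * \<bar>r\<bar>"
        by (intro mult_left_mono) (auto simp: cube_def)
      with norm_le_card_infnorm have "norm (x - y) \<le> real CARD('n) * \<bar>r\<bar>" by (rule order_trans)
      then show "y \<in> ?C" by (simp add: dist_norm)
    qed
    have "mass (\<lambda>y. ennreal (v y)) x r \<le> (\<integral>\<^sup>+z. ennreal (norm (indicator ?C z *\<^sub>R \<omega> z)) \<partial>lborel)"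
      unfolding mass_def
    proof (rule nn_integral_mono_AE)
      show "AE z in lborel. ennreal (v z) * indicator (cube x r) z \<le> ennreal (norm (indicator ?C z *\<^sub>R \<omega> z))"
        using v(2) by eventually_elim (use sub nn in \<open>auto simp: indicator_def\<close>)
    qed
    also have "\<dots> < top"
      using int[of ?C] unfolding set_integrable_def integrable_iff_bounded nn_integral_completion by simp
    finally show ?thesis .
  qed
  show thesis by (rule that[OF _ v(2) posv fin meas]) (use v(1) in simp)
qed

lemma AE_lebesgue_on_cube: "(AE z in lebesgue_on (cube x r). P z) \<longleftrightarrow> (AE z in lborel. z \<in> cube (x :: real^'n) r \<longrightarrow> P z)"
  by (subst AE_restrict_space_iff) (auto simp: AE_completion_iff)

lemma A1_property_of_A1_const:
  fixes \<omega> v :: "real^'n \<Rightarrow> real"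
  assumes [measurable]: "v \<in> borel_measurable borel" and eq: "AE z in lborel. \<omega> z = v z" and pos: "AE z in lborel. 0 < v z"
    and fin: "A1_const (2 * R) \<omega> < top"
  shows "A1_property v (2 ^ CARD('n) * enn2real (A1_const (2 * R) \<omega>)) R"
  unfolding A1_property_def
proof (intro allI impI)
  fix x :: "real^'n" and r assume r: "0 < r" "r \<le> R"
  let ?A = "A1_const (2 * R) \<omega>" and ?I = "mass (\<lambda>y. ennreal (v y)) x r"
  let ?S = "esssup (lebesgue_on (cube x r)) (\<lambda>x. inverse (ennreal (\<omega> x)))"
  have V: "emeasure lborel (cube x r) = ennreal ((2 * r) ^ CARD('n))" using r by (simp add: emeasure_cube)
  have avg: "avg (cube x r) (\<lambda>x. ennreal (\<omega> x)) = ?I / ennreal ((2 * r) ^ CARD('n))"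
  proof -
    have "(\<integral>\<^sup>+z\<in>cube x r. ennreal (\<omega> z) \<partial>lborel) = ?I"
      unfolding mass_def by (rule nn_integral_cong_AE) (use eq in eventually_elim, simp)
    then show ?thesis unfolding avg_def nn_integral_completion by (simp add: V emeasure_completion)
  qed
  have "cube x r \<in> cubes (2 * R)" unfolding cubes_eq using r by auto
  then have "avg (cube x r) (\<lambda>x. ennreal (\<omega> x)) * ?S \<le> ?A"
    unfolding A1_const_def by (rule SUP_upper)
  then have "?I / ennreal ((2 * r) ^ CARD('n)) * ?S * ennreal ((2 * r) ^ CARD('n)) \<le> ?A * ennreal ((2 * r) ^ CARD('n))"
    unfolding avg by (rule mult_right_mono) simp
  moreover have "?I / ennreal ((2 * r) ^ CARD('n)) * ?S * ennreal ((2 * r) ^ CARD('n)) = ?I * ?S"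
  proof -
    have "?I / ennreal ((2 * r) ^ CARD('n)) * ennreal ((2 * r) ^ CARD('n)) = ?I"
      using r by (intro ennreal_divide_mult_cancel) (auto simp: ennreal_eq_0_iff not_le)
    moreover have "a * c = b \<Longrightarrow> a * s * c = b * s" for a b c s :: ennreal by (auto simp: mult_ac)
    ultimately show ?thesis by blast
  qed
  ultimately have IS: "?I * ?S \<le> ennreal (2 ^ CARD('n) * enn2real ?A * r ^ CARD('n))"
    using fin r by (cases ?A) (auto simp: power_mult_distrib mult_ac simp flip: ennreal_mult)
  have "AE z in lborel. z \<in> cube x r \<longrightarrow> inverse (ennreal (\<omega> z)) \<le> ?S"
    using esssup_AE[of "\<lambda>x. inverse (ennreal (\<omega> x))" "lebesgue_on (cube x r)"] unfolding AE_lebesgue_on_cube .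
  then show "AE z in lborel. z \<in> cube x r \<longrightarrow> ?I \<le> ennreal (2 ^ CARD('n) * enn2real ?A * r ^ CARD('n)) * ennreal (v z)"
    using eq pos
  proof eventually_elim
    case (elim z)
    show ?case
    proof
      assume "z \<in> cube x r"
      then have le: "inverse (ennreal (v z)) \<le> ?S" using elim by simp
      have "?I = ?I * inverse (ennreal (v z)) * ennreal (v z)"
        using elim(3) by (simp add: inverse_ennreal mult.assoc flip: ennreal_mult)
      also have "\<dots> \<le> ?I * ?S * ennreal (v z)"
        using le by (intro mult_right_mono mult_left_mono) auto
      also have "\<dots> \<le> ennreal (2 ^ CARD('n) * enn2real ?A * r ^ CARD('n)) * ennreal (v z)"
        by (intro mult_right_mono IS) simp
      finally show "?I \<le> ennreal (2 ^ CARD('n) * enn2real ?A * r ^ CARD('n)) * ennreal (v z)" .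
    qed
  qed
qed

text \<open>\<open>A1_loc\<close> provides finiteness at one unspecified scale only. This converse
  of \<open>A1_property_of_A1_const\<close> transfers it to the scale 160 \<rho>, where
  \<open>enn2real\<close> would otherwise return the meaningless value 0.\<close>

lemma A1_const_finite:
  fixes \<omega> v :: "real^'n \<Rightarrow> real"
  assumes v [measurable]: "v \<in> borel_measurable borel" and eq: "AE z in lborel. \<omega> z = v z" and pos: "AE z in lborel. 0 < v z"
    and meas [measurable]: "\<omega> \<in> borel_measurable lebesgue" and fin: "\<And>x r. mass (\<lambda>y. ennreal (v y)) x r < top"
    and A: "A1_property v A R" "0 \<le> A"
  shows "A1_const (2 * R) \<omega> < top"
proof -
  have "A1_const (2 * R) \<omega> \<le> ennreal A"
    unfolding A1_const_def
  proof (rule SUP_least)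
    fix Q :: "(real^'n) set" assume "Q \<in> cubes (2 * R)"
    then obtain x r where Q: "Q = cube x r" and r: "0 < r" "r \<le> R" unfolding cubes_eq by auto
    let ?I = "mass (\<lambda>y. ennreal (v y)) x r"
    have "AE z in lborel. 0 < ennreal (v z)" using pos by eventually_elim simp
    then have "0 < ?I" using r by (intro mass_pos_if_AE_pos) auto
    then obtain m where m: "?I = ennreal m" "0 < m"
      using fin[of x r] by (cases ?I) (auto simp: ennreal_less_zero_iff)
    have "avg Q (\<lambda>x. ennreal (\<omega> x)) = ?I / ennreal ((2 * r) ^ CARD('n))"
    proof -
      have "(\<integral>\<^sup>+z\<in>cube x r. ennreal (\<omega> z) \<partial>lborel) = ?I"
        unfolding mass_def by (rule nn_integral_cong_AE) (use eq in eventually_elim, simp)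
      then show ?thesis unfolding avg_def nn_integral_completion Q using r by (simp add: emeasure_cube)
    qed
    also have "\<dots> = ennreal (m / (2 * r) ^ CARD('n))" using m r by (simp add: divide_ennreal)
    finally have avg: "avg Q (\<lambda>x. ennreal (\<omega> x)) = ennreal (m / (2 * r) ^ CARD('n))" .
    have "esssup (lebesgue_on Q) (\<lambda>x. inverse (ennreal (\<omega> x))) \<le> ennreal (A * r ^ CARD('n) / m)"
    proof (rule esssup_I)
      show "(\<lambda>x. inverse (ennreal (\<omega> x))) \<in> borel_measurable (lebesgue_on Q)"
        by (intro measurable_restrict_space1) measurable
      have "AE z in lborel. z \<in> cube x r \<longrightarrow> ?I \<le> ennreal (A * r ^ CARD('n)) * ennreal (v z)"
        using A(1) r unfolding A1_property_def by blast
      then show "AE z in lebesgue_on Q. inverse (ennreal (\<omega> z)) \<le> ennreal (A * r ^ CARD('n) / m)"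
        unfolding Q AE_lebesgue_on_cube using eq pos
      proof eventually_elim
        case (elim z)
        show ?case
        proof
          assume "z \<in> cube x r"
          then have "ennreal m \<le> ennreal (A * r ^ CARD('n)) * ennreal (v z)" using elim m by simp
          then have "m \<le> A * r ^ CARD('n) * v z" using elim A(2) r by (simp flip: ennreal_mult)
          then have "inverse (v z) \<le> A * r ^ CARD('n) / m" using elim m by (simp add: field_simps)
          then show "inverse (ennreal (\<omega> z)) \<le> ennreal (A * r ^ CARD('n) / m)"
            using elim by (simp add: inverse_ennreal ennreal_leI)
        qed
      qed
    qed
    then have "avg Q (\<lambda>x. ennreal (\<omega> x)) * esssup (lebesgue_on Q) (\<lambda>x. inverse (ennreal (\<omega> x)))
        \<le> ennreal (m / (2 * r) ^ CARD('n)) * ennreal (A * r ^ CARD('n) / m)"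
      unfolding avg by (rule mult_left_mono) simp
    also have "\<dots> = ennreal (A / 2 ^ CARD('n))"
      using m r A by (simp add: power_mult_distrib flip: ennreal_mult)
    also have "\<dots> \<le> ennreal A"
      using A mult_left_mono[of 1 "2 ^ CARD('n)" A] by (intro ennreal_leI) (simp add: field_simps)
    finally show "avg Q (\<lambda>x. ennreal (\<omega> x)) * esssup (lebesgue_on Q) (\<lambda>x. inverse (ennreal (\<omega> x))) \<le> ennreal A" .
  qed
  then show ?thesis using le_less_trans ennreal_less_top by blast
qed

section \<open>Interpolation for Choquet integrals\<close>

text \<open>Doubling the truncation height from s 2^J to s 2^(J+1) adds at most s 2^J, and only if X
  exceeds s 2^J. Starting at height s explains the leading term; J then tends to infinity.\<close>

lemma ennreal_layer_sum:
  fixes X :: ennreal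
  assumes s: "0 < s"
  shows "X \<le> ennreal s + (\<Sum>j. ennreal (s * 2 ^ j) * of_bool (ennreal (s * 2 ^ j) < X))"
proof -
  let ?f = "\<lambda>j. ennreal (s * 2 ^ j) * of_bool (ennreal (s * 2 ^ j) < X)"
  have part: "min X (ennreal (s * 2 ^ J)) \<le> ennreal s + (\<Sum>j<J. ?f j)" for J
  proof (induction J)
    case (Suc J)
    have "min X (ennreal (s * 2 ^ Suc J)) \<le> min X (ennreal (s * 2 ^ J)) + ?f J"
    proof (cases "ennreal (s * 2 ^ J) < X")
      case True
      have "ennreal (s * 2 ^ Suc J) = ennreal (s * 2 ^ J) + ennreal (s * 2 ^ J)"
        using s by (simp flip: ennreal_plus)
      moreover have "min X (ennreal (s * 2 ^ J)) = ennreal (s * 2 ^ J)" using True by (intro min_absorb2) simp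
      ultimately show ?thesis using True by (simp add: min.coboundedI2 del: power_Suc)
    next
      case False
      then have "min X (ennreal (s * 2 ^ J)) = X" by (intro min_absorb1) simp
      then show ?thesis by (simp add: min.coboundedI1 add_increasing2 del: power_Suc)
    qed
    also have "\<dots> \<le> (ennreal s + (\<Sum>j<J. ?f j)) + ?f J" by (rule add_right_mono[OF Suc])
    finally show ?case by (simp add: add.assoc)
  qed simp
  have all: "min X (ennreal (s * 2 ^ J)) \<le> ennreal s + (\<Sum>j. ?f j)" for J
    by (rule order_trans[OF part add_left_mono]) (rule sum_le_suminf, auto)
  have large: "\<exists>J. b < s * 2 ^ J" for b
    using real_arch_pow[of 2 "b / s"] s by (auto simp: field_simps)
  show ?thesis
  proof (cases "ennreal s + (\<Sum>j. ?f j)")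
    case (real b)
    obtain J where J: "b < s * 2 ^ J" using large by blast
    then have "ennreal b < ennreal (s * 2 ^ J)" using real by (simp add: ennreal_less_iff)
    moreover have "min X (ennreal (s * 2 ^ J)) \<le> ennreal b" using all[of J] unfolding real .
    ultimately have "X \<le> ennreal b" by (auto simp: min_def split: if_splits)
    then show ?thesis unfolding real .
  qed simp
qed

text \<open>The densities \<tau> j are chosen so that the sum of s 2^j \<tau> j equals s. If every
  layer had density at most \<tau> j in the cube Q, then F would have average at most s + s there; e
  > 0 makes the series converge.\<close>

lemma maximal_level_subset:
  fixes F :: "real^'n \<Rightarrow> ennreal"
  assumes F [measurable]: "F \<in> borel_measurable borel" and s: "0 < s" and e: "0 < e"
  shows "{x. ennreal (2 * s) < (SUP Q\<in>{Q \<in> cubes \<rho>. x \<in> Q}. avg Q F)}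
    \<subseteq> (\<Union>j. density_set \<rho> ((1 - 2 powr - e) * 2 powr (- real j * (1 + e))) {y. ennreal (s * 2 ^ j) < F y})"
proof
  let ?\<tau> = "\<lambda>j. (1 - 2 powr - e) * 2 powr (- real j * (1 + e))" and ?E = "\<lambda>j. {y. ennreal (s * 2 ^ j) < F y}"
  have \<kappa>: "0 \<le> 1 - 2 powr - e" using e by (simp add: powr_le_one_le powr_minus_divide ge_one_powr_ge_zero)
  fix x assume "x \<in> {x. ennreal (2 * s) < (SUP Q\<in>{Q \<in> cubes \<rho>. x \<in> Q}. avg Q F)}"
  then obtain Q where Q: "Q \<in> cubes \<rho>" "x \<in> Q" and big: "ennreal (2 * s) < avg Q F"
    by (auto simp: less_SUP_iff)
  from Q(1) obtain c r where cr: "Q = cube c r" "0 < r" unfolding cubes_eq by auto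
  define V where "V = (2 * r) ^ CARD('n)"
  have V: "emeasure lborel Q = ennreal V" "0 < V" using cr by (auto simp: emeasure_cube V_def)
  have [measurable]: "Q \<in> sets borel" by (simp add: cr)
  show "x \<in> (\<Union>j. density_set \<rho> (?\<tau> j) (?E j))"
  proof (rule ccontr)
    assume "\<not> ?thesis"
    then have small: "emeasure lborel (?E j \<inter> Q) \<le> ennreal (?\<tau> j) * ennreal V" for j
      using Q unfolding V(1)[symmetric] by (auto simp: density_set_def not_less)
    have "(\<integral>\<^sup>+y\<in>Q. F y \<partial>lborel) \<le> (\<integral>\<^sup>+y. ennreal s * indicator Q y + (\<Sum>j. ennreal (s * 2 ^ j) * indicator (?E j \<inter> Q) y) \<partial>lborel)"
    proof (rule nn_integral_mono)
      fix y
      show "F y * indicator Q y \<le> ennreal s * indicator Q y + (\<Sum>j. ennreal (s * 2 ^ j) * indicator (?E j \<inter> Q) y)"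
        using ennreal_layer_sum[OF s, of "F y"] by (cases "y \<in> Q") (simp_all add: indicator_def)
    qed
    also have "\<dots> = ennreal s * ennreal V + (\<Sum>j. ennreal (s * 2 ^ j) * emeasure lborel (?E j \<inter> Q))"
      by (subst nn_integral_add, measurable)
        (simp_all add: nn_integral_cmult_indicator nn_integral_suminf V(1)[symmetric])
    also have "\<dots> \<le> ennreal s * ennreal V + (\<Sum>j. ennreal (s * V * ((1 - 2 powr - e) * (2 powr - e) ^ j)))"
    proof (intro add_left_mono suminf_le allI)
      fix j
      have "ennreal (s * 2 ^ j) * emeasure lborel (?E j \<inter> Q) \<le> ennreal (s * 2 ^ j) * (ennreal (?\<tau> j) * ennreal V)"
        by (intro mult_left_mono small) simp
      also have "\<dots> = ennreal (s * 2 ^ j * (?\<tau> j * V))"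
        using s V \<kappa> by (simp add: ennreal_mult)
      also have "s * 2 ^ j * (?\<tau> j * V) = s * V * ((1 - 2 powr - e) * (2 powr - e) ^ j)"
        by (simp add: powr_realpow[symmetric] powr_powr powr_add[symmetric] algebra_simps)
      finally show "ennreal (s * 2 ^ j) * emeasure lborel (?E j \<inter> Q) \<le> ennreal (s * V * ((1 - 2 powr - e) * (2 powr - e) ^ j))" .
    qed auto
    also have "(\<Sum>j. ennreal (s * V * ((1 - 2 powr - e) * (2 powr - e) ^ j))) = ennreal (s * V)"
    proof (rule suminf_ennreal_eq)
      have lt: "2 powr - e < (1::real)" using e by (simp add: powr_less_one)
      then have "(\<lambda>j. s * V * ((1 - 2 powr - e) * (2 powr - e) ^ j)) sums (s * V * ((1 - 2 powr - e) * (1 / (1 - 2 powr - e))))"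
        by (intro sums_mult geometric_sums) simp
      then show "(\<lambda>j. s * V * ((1 - 2 powr - e) * (2 powr - e) ^ j)) sums (s * V)" using lt e by simp
    qed (use s V \<kappa> in auto)
    also have "ennreal s * ennreal V + ennreal (s * V) = ennreal (2 * s) * ennreal V"
      using s V by (simp flip: ennreal_mult ennreal_plus)
    finally have "(\<integral>\<^sup>+y\<in>Q. F y \<partial>lborel) / ennreal V \<le> ennreal (2 * s) * ennreal V / ennreal V"
      by (rule divide_right_mono_ennreal)
    also have "\<dots> = ennreal (2 * s)" using V s by (simp add: divide_ennreal flip: ennreal_mult)
    also have "(\<integral>\<^sup>+y\<in>Q. F y \<partial>lborel) / ennreal V = avg Q F"
      unfolding avg_def nn_integral_completion by (simp add: V(1)[symmetric])
    finally show False using big by simp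
  qed
qed

text \<open>Makes the capacity of {h > t} a measurable function of t from monotonicity of the
  capacity alone, for arbitrary level sets.\<close>

lemma borel_measurable_antimono_ennreal:
  fixes f :: "real \<Rightarrow> ennreal"
  assumes "antimono f" shows "f \<in> borel_measurable borel"
proof (rule borel_measurableI_greater)
  fix a
  have "{x. a < f x} \<in> sets borel"
  proof (rule real_interval_borel_measurable)
    show "is_interval {x. a < f x}"
      unfolding is_interval_1 using antimonoD[OF assms] by (auto intro: less_le_trans)
  qed
  then show "{x \<in> space borel. a < f x} \<in> sets borel" by simp
qed

lemma nn_integral_scale:
  fixes f :: "real \<Rightarrow> ennreal"
  assumes [measurable]: "f \<in> borel_measurable borel" and c: "0 < c"
  shows "(\<integral>\<^sup>+u\<in>{0<..}. f (c * u) \<partial>lborel) = ennreal (1 / c) * (\<integral>\<^sup>+t\<in>{0<..}. f t \<partial>lborel)"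
proof -
  have "(\<integral>\<^sup>+t\<in>{0<..}. f t \<partial>lborel) = ennreal c * (\<integral>\<^sup>+u. f (0 + c * u) * indicator {0<..} (0 + c * u) \<partial>lborel)"
    using c by (subst nn_integral_real_affine[where c = c and t = 0]) auto
  also have "(\<integral>\<^sup>+u. f (0 + c * u) * indicator {0<..} (0 + c * u) \<partial>lborel) = (\<integral>\<^sup>+u\<in>{0<..}. f (c * u) \<partial>lborel)"
    using c by (intro nn_integral_cong) (auto simp: indicator_def zero_less_mult_iff)
  finally have "ennreal (1 / c) * (\<integral>\<^sup>+t\<in>{0<..}. f t \<partial>lborel) = (ennreal (1 / c) * ennreal c) * (\<integral>\<^sup>+u\<in>{0<..}. f (c * u) \<partial>lborel)"
    by (simp add: mult.assoc)
  also have "ennreal (1 / c) * ennreal c = 1" using c by (subst ennreal_mult[symmetric]) auto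
  finally show ?thesis by simp
qed

definition choquet_const :: "real \<Rightarrow> real \<Rightarrow> real" where
  "choquet_const q r = 2 powr q * (1 - 2 powr - ((q - r) / (2 * r))) powr - r / (1 - 2 powr ((r - q) / 2))"

text \<open>Subadditivity is applied to the level sets before integrating in t. Layer j then
  contributes the weak type loss 2 powr (j (1 + e) r) times 2 powr (- j q) from rescaling t, and the
  series is geometric.\<close>

lemma choquet_maximal_bound:
  fixes R :: "(real^'n) set \<Rightarrow> ennreal" and F :: "real^'n \<Rightarrow> ennreal"
  assumes mono: "\<And>A B. A \<subseteq> B \<Longrightarrow> R A \<le> R B"
    and sub: "\<And>E :: nat \<Rightarrow> (real^'n) set. R (\<Union>k. E k) \<le> (\<Sum>k. R (E k))"
    and weak: "\<And>E \<tau>. E \<in> sets borel \<Longrightarrow> 0 < \<tau> \<Longrightarrow> \<tau> \<le> 1 \<Longrightarrow> R (density_set \<rho> \<tau> E) \<le> ennreal (c * \<tau> powr - r) * R E"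
    and c: "0 \<le> c" and r: "0 < r" "r < q" and F [measurable]: "F \<in> borel_measurable borel"
  shows "(\<integral>\<^sup>+t\<in>{0<..}. R {x. ennreal t < ennreal_powr (SUP Q\<in>{Q \<in> cubes \<rho>. x \<in> Q}. avg Q F) q} \<partial>lborel)
    \<le> ennreal (c * choquet_const q r) * (\<integral>\<^sup>+t\<in>{0<..}. R {x. ennreal t < ennreal_powr (F x) q} \<partial>lborel)"
proof -
  let ?M = "\<lambda>x. SUP Q\<in>{Q \<in> cubes \<rho>. x \<in> Q}. avg Q F"
  let ?\<phi> = "\<lambda>t. R {x. ennreal t < ennreal_powr (F x) q}" and ?\<psi> = "\<lambda>t. R {x. ennreal t < ennreal_powr (?M x) q}"
  have q: "0 < q" using r by simp
  have anti: "antimono (\<lambda>t::real. R {x. ennreal t < ennreal_powr (h x) q})" for h :: "real^'n \<Rightarrow> ennreal"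
    by (intro antimonoI mono) (auto intro: le_less_trans[OF ennreal_leI])
  have \<phi> [measurable]: "?\<phi> \<in> borel_measurable borel" and \<psi> [measurable]: "?\<psi> \<in> borel_measurable borel"
    by (rule borel_measurable_antimono_ennreal[OF anti])+
  \<comment> \<open>Chosen so that (1 + e) * r is the midpoint of r and q; the common ratio of the
    series is then 2 powr ((r - q) / 2) < 1.\<close>
  define e where "e = (q - r) / (2 * r)"
  define k where "k = 1 - 2 powr - e"
  have e: "0 < e" "(1 + e) * r = (q + r) / 2" using r by (auto simp: e_def field_simps)
  have k: "0 < k" "k \<le> 1" using e by (auto simp: k_def powr_less_one)
  let ?I = "\<integral>\<^sup>+t\<in>{0<..}. ?\<phi> t \<partial>lborel"
  have level: "?\<psi> (2 powr q * u) \<le> (\<Sum>j. ennreal (c * k powr - r * 2 powr (real j * ((q + r) / 2))) * ?\<phi> (2 powr (real j * q) * u))"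
    if u: "0 < u" for u
  proof -
    \<comment> \<open>With u = s powr q, the heights 2 s and s 2^j become the levels 2 powr q * u
      and 2 powr (j q) * u of the q-th powers.\<close>
    define s where "s = u powr (1 / q)"
    have s: "0 < s" using u by (simp add: s_def)
    have scale: "ennreal (a powr q * u) < ennreal_powr X q \<longleftrightarrow> ennreal (s * a) < X" if "0 < a" for a X
      using that u q by (subst less_ennreal_powr_iff) (auto simp: powr_mult powr_powr s_def mult.commute)
    let ?\<tau> = "\<lambda>j. k * 2 powr (- real j * (1 + e))" and ?E = "\<lambda>j. {y. ennreal (s * 2 ^ j) < F y}"
    have "?\<psi> (2 powr q * u) = R {x. ennreal (2 * s) < ?M x}"
      using scale[of 2] by (simp add: mult.commute)
    also have "\<dots> \<le> R (\<Union>j. density_set \<rho> (?\<tau> j) (?E j))"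
      unfolding k_def by (intro mono maximal_level_subset F s e)
    also have "\<dots> \<le> (\<Sum>j. R (density_set \<rho> (?\<tau> j) (?E j)))" by (rule sub)
    also have "\<dots> \<le> (\<Sum>j. ennreal (c * k powr - r * 2 powr (real j * ((q + r) / 2))) * ?\<phi> (2 powr (real j * q) * u))"
    proof (intro suminf_le allI)
      fix j
      have "2 powr (- real j * (1 + e)) \<le> 2 powr 0" using e by (intro powr_mono) auto
      then have "?\<tau> j \<le> 1 * 1" using k by (intro mult_mono) auto
      then have "R (density_set \<rho> (?\<tau> j) (?E j)) \<le> ennreal (c * ?\<tau> j powr - r) * R (?E j)"
        using k by (intro weak) auto
      also have "?\<tau> j powr - r = k powr - r * 2 powr (real j * ((q + r) / 2))"
        unfolding e(2)[symmetric] using k by (simp add: powr_mult powr_powr algebra_simps)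
      finally have "R (density_set \<rho> (?\<tau> j) (?E j)) \<le> ennreal (c * (k powr - r * 2 powr (real j * ((q + r) / 2)))) * R (?E j)" .
      moreover have "{x. ennreal (2 powr (real j * q) * u) < ennreal_powr (F x) q} = ?E j"
        using scale[of "2 ^ j"] by (simp add: powr_realpow[symmetric] powr_powr)
      ultimately show "R (density_set \<rho> (?\<tau> j) (?E j)) \<le> ennreal (c * k powr - r * 2 powr (real j * ((q + r) / 2))) * ?\<phi> (2 powr (real j * q) * u)"
        by (simp only: mult.assoc)
    qed auto
    finally show ?thesis .
  qed
  have "(\<integral>\<^sup>+t\<in>{0<..}. ?\<psi> t \<partial>lborel) = ennreal (2 powr q) * (\<integral>\<^sup>+u\<in>{0<..}. ?\<psi> (2 powr q * u) \<partial>lborel)"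
    by (subst nn_integral_scale) (simp_all add: mult.assoc[symmetric] ennreal_mult[symmetric])
  also have "\<dots> \<le> ennreal (2 powr q) * (\<integral>\<^sup>+u. (\<Sum>j. ennreal (c * k powr - r * 2 powr (real j * ((q + r) / 2))) * (?\<phi> (2 powr (real j * q) * u) * indicator {0<..} u)) \<partial>lborel)"
    using level by (intro mult_left_mono nn_integral_mono) (auto simp: indicator_def)
  also have "(\<integral>\<^sup>+u. (\<Sum>j. ennreal (c * k powr - r * 2 powr (real j * ((q + r) / 2))) * (?\<phi> (2 powr (real j * q) * u) * indicator {0<..} u)) \<partial>lborel)
    = (\<Sum>j. ennreal (c * k powr - r * 2 powr (real j * ((q + r) / 2))) * (\<integral>\<^sup>+u\<in>{0<..}. ?\<phi> (2 powr (real j * q) * u) \<partial>lborel))"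
    by (subst nn_integral_suminf) (simp_all add: nn_integral_cmult)
  also have "\<dots> = (\<Sum>j. ennreal (c * k powr - r * (2 powr ((r - q) / 2)) ^ j) * ?I)"
  proof (intro suminf_cong)
    fix j
    have "ennreal (c * k powr - r * 2 powr (real j * ((q + r) / 2))) * (\<integral>\<^sup>+u\<in>{0<..}. ?\<phi> (2 powr (real j * q) * u) \<partial>lborel)
       = ennreal (c * k powr - r * 2 powr (real j * ((q + r) / 2))) * ennreal (1 / 2 powr (real j * q)) * ?I"
      by (subst nn_integral_scale[of ?\<phi>]) (simp_all add: mult.assoc)
    also have "ennreal (c * k powr - r * 2 powr (real j * ((q + r) / 2))) * ennreal (1 / 2 powr (real j * q))
       = ennreal (c * k powr - r * (2 powr (real j * ((q + r) / 2)) / 2 powr (real j * q)))"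
      using c by (subst ennreal_mult[symmetric]) auto
    also have "2 powr (real j * ((q + r) / 2)) / 2 powr (real j * q) = (2 powr ((r - q) / 2)) ^ j"
      by (simp add: powr_realpow[symmetric] powr_powr powr_diff[symmetric] field_simps)
    finally show "ennreal (c * k powr - r * 2 powr (real j * ((q + r) / 2))) * (\<integral>\<^sup>+u\<in>{0<..}. ?\<phi> (2 powr (real j * q) * u) \<partial>lborel)
      = ennreal (c * k powr - r * (2 powr ((r - q) / 2)) ^ j) * ?I" .
  qed
  also have "\<dots> = (\<Sum>j. ennreal (c * k powr - r * (2 powr ((r - q) / 2)) ^ j)) * ?I"
    by (rule ennreal_suminf_multc)
  also have "(\<Sum>j. ennreal (c * k powr - r * (2 powr ((r - q) / 2)) ^ j)) = ennreal (c * k powr - r * (1 / (1 - 2 powr ((r - q) / 2))))"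
  proof (rule suminf_ennreal_eq)
    have "2 powr ((r - q) / 2) < (1::real)" using r by (intro powr_less_one) auto
    then show "(\<lambda>j. c * k powr - r * (2 powr ((r - q) / 2)) ^ j) sums (c * k powr - r * (1 / (1 - 2 powr ((r - q) / 2))))"
      by (intro sums_mult geometric_sums) simp
  qed (use c in auto)
  also have "ennreal (2 powr q) * (ennreal (c * k powr - r * (1 / (1 - 2 powr ((r - q) / 2)))) * ?I)
    = ennreal (2 powr q * (c * k powr - r * (1 / (1 - 2 powr ((r - q) / 2))))) * ?I"
    by (subst mult.assoc[symmetric], subst ennreal_mult'[symmetric]) auto
  also have "2 powr q * (c * k powr - r * (1 / (1 - 2 powr ((r - q) / 2)))) = c * choquet_const q r"
    by (simp add: choquet_const_def k_def e_def)
  finally show ?thesis .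
qed

text \<open>The inequality F \<le> h must hold everywhere: it puts the level sets of F inside those
  of h, whereas equality almost everywhere says nothing about their capacities.\<close>

lemma borel_minorant_AE_eq:
  fixes h :: "'a :: euclidean_space \<Rightarrow> ennreal"
  assumes "h \<in> borel_measurable lebesgue"
  obtains F where "F \<in> borel_measurable borel" "AE y in lborel. h y = F y" "\<And>y. F y \<le> h y"
proof -
  obtain F' where F': "F' \<in> borel_measurable lborel" "AE y in lborel. h y = F' y"
    using completion_ex_borel_measurable[OF assms] by blast
  from AE_E[OF F'(2)] obtain N where N: "{y \<in> space lborel. h y \<noteq> F' y} \<subseteq> N" "emeasure lborel N = 0" "N \<in> sets lborel"
    by blast
  show thesis
  proof (rule that)
    have [measurable]: "F' \<in> borel_measurable borel" "N \<in> sets borel" using F'(1) N(3) by simp_all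
    show "(\<lambda>y. F' y * indicator (- N) y) \<in> borel_measurable borel" by measurable
    have "N \<in> null_sets lborel" using N by auto
    from AE_not_in[OF this] show "AE y in lborel. h y = F' y * indicator (- N) y"
      by eventually_elim (use N(1) in auto)
    show "F' y * indicator (- N) y \<le> h y" for y
    proof (cases "y \<in> N")
      case False
      then have "h y = F' y" using N(1) by auto
      then show ?thesis by (simp add: indicator_def)
    qed simp
  qed
qed

lemma A1_loc_rh_weight:
  fixes \<omega> :: "real^'n \<Rightarrow> real"
  assumes \<omega>: "A1_loc \<omega>" and \<rho>: "0 < \<rho>" and \<alpha>: "0 < \<alpha>" "\<alpha> * p < real CARD('n)" and p: "1 < p"
    and K: "K = rh_const CARD('n) p (A1_extend CARD('n) (2 ^ CARD('n) * enn2real (A1_const (160 * \<rho>) \<omega>)) CARD('n))"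
  obtains w where "rh_weight w \<rho> K \<alpha> p (doubling_const CARD('n) K)"
    "AE y in lborel. ennreal (dual_weight p \<omega> y) = w y" "AE y in lborel. 0 < w y"
proof -
  have "weight \<omega>" using \<omega> by (simp add: A1_loc_def)
  then obtain v where v: "v \<in> borel_measurable borel" and eq: "AE z in lborel. \<omega> z = v z" and pos: "AE z in lborel. 0 < v z"
    and fin: "\<And>x r. mass (\<lambda>y. ennreal (v y)) x r < top" and meas: "\<omega> \<in> borel_measurable lebesgue"
    by (rule weight_borel_version) blast
  obtain \<rho>0 where \<rho>0: "0 < \<rho>0" "A1_const \<rho>0 \<omega> < top" using \<omega> by (auto simp: A1_loc_def)
  have "A1_property v (2 ^ CARD('n) * enn2real (A1_const (2 * (\<rho>0 / 2)) \<omega>)) (\<rho>0 / 2)"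
    by (rule A1_property_of_A1_const[OF v eq pos]) (use \<rho>0 in simp)
  then obtain A' where A': "A1_property v A' (80 * \<rho>)" "0 \<le> A'"
    by (rule A1_property_extend_to[OF v]) (use \<rho>0 in auto)
  have fin160: "A1_const (160 * \<rho>) \<omega> < top"
    using A1_const_finite[OF v eq pos meas fin A'] by simp
  let ?A = "2 ^ CARD('n) * enn2real (A1_const (160 * \<rho>) \<omega>)"
  have "A1_property v ?A (80 * \<rho>)"
    using A1_property_of_A1_const[OF v eq pos, of "80 * \<rho>"] fin160 by simp
  then have "A1_property v (A1_extend CARD('n) ?A CARD('n)) ((3/2) ^ CARD('n) * (80 * \<rho>))"
    by (rule A1_property_extend[OF v]) simp
  \<comment> \<open>Bernoulli gives (3/2)^n \<ge> n / 2, so n enlargement steps from half-side 80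
    \<rho> reach 40 n \<rho>.\<close>
  moreover have "40 * real CARD('n) * \<rho> \<le> (3/2) ^ CARD('n) * (80 * \<rho>)"
  proof -
    have "1 + real CARD('n) * (1/2) \<le> (1 + 1/2) ^ CARD('n)" by (rule Bernoulli_inequality) simp
    then have "(1/2 * real CARD('n)) * (80 * \<rho>) \<le> (3/2) ^ CARD('n) * (80 * \<rho>)"
      using \<rho> by (intro mult_right_mono) auto
    then show ?thesis by simp
  qed
  ultimately have "A1_property v (A1_extend CARD('n) ?A CARD('n)) (40 * real CARD('n) * \<rho>)"
    by (rule A1_property_mono)
  then have "rh_weight (\<lambda>x. ennreal (v x powr (- (1 / (p - 1))))) \<rho> K \<alpha> p (doubling_const CARD('n) K)"
    by (rule rh_weight_dual[OF v pos fin _ _ \<rho> \<alpha> p K]) (simp add: A1_extend_nonneg)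
  then show thesis
  proof (rule that)
    show "AE y in lborel. ennreal (dual_weight p \<omega> y) = ennreal (v y powr (- (1 / (p - 1))))"
      using eq by eventually_elim (simp add: dual_weight_def)
    show "AE y in lborel. 0 < ennreal (v y powr (- (1 / (p - 1))))"
      using pos by eventually_elim simp
  qed
qed

theorem theorem4p3p8:
  fixes \<alpha> p q :: real
  assumes "0 < \<alpha>" "\<alpha> < real CARD('n::finite)"
    and "1 < p" "p < real CARD('n) / \<alpha>"
    and "(real CARD('n) - \<alpha> * p) / real CARD('n) < q"
  shows "\<exists>C :: ennreal \<Rightarrow> real. (\<forall>A. 0 < C A) \<and>
    (\<forall>(\<rho>::real) (\<omega> :: real^'n \<Rightarrow> real) (f :: real^'n \<Rightarrow> ereal).
       0 < \<rho> \<longrightarrow> A1_loc \<omega> \<longrightarrow> f \<in> borel_measurable lebesgue \<longrightarrow>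
       cap_Lq_norm (capacity \<alpha> p \<rho> \<omega>) q (M_loc \<rho> f)
         \<le> ennreal (C (A1_const (160 * \<rho>) \<omega>)) * cap_Lq_norm (capacity \<alpha> p \<rho> \<omega>) q f)"
proof -
  let ?n = "CARD('n)"
  have ap: "\<alpha> * p < real ?n" using assms(1,4) by (simp add: field_simps)
  \<comment> \<open>The midpoint between the critical exponent and min 1 q. Staying below q lets the
    interpolation series converge, and staying below 1 makes \<theta> = 1 - r positive.\<close>
  define r where "r = ((real ?n - \<alpha> * p) / real ?n + min 1 q) / 2"
  have "(real ?n - \<alpha> * p) / real ?n < 1" using assms(1,3) by simp
  with assms(5) have "(real ?n - \<alpha> * p) / real ?n < min 1 q" by simp
  moreover have "a < (a + min 1 q) / 2 \<and> (a + min 1 q) / 2 < 1 \<and> (a + min 1 q) / 2 < q" if "a < min 1 q" for a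
    using that by (auto simp: min_def split: if_splits)
  ultimately have r: "(real ?n - \<alpha> * p) / real ?n < r" "r < 1" "r < q" unfolding r_def by blast+
  have "0 < (real ?n - \<alpha> * p) / real ?n" using ap by simp
  then have r0: "0 < r" and q: "0 < q" using r by linarith+
  define \<theta> where "\<theta> = 1 - r"
  have \<theta>: "0 < \<theta>" "\<theta> < 1" "\<theta> * real ?n < \<alpha> * p"
    using r r0 by (auto simp: \<theta>_def field_simps)
  \<comment> \<open>K, c and b are functions of the A1 constant A alone, once n, \<alpha>, p and q
    are fixed, so the constant is chosen before \<rho>, \<omega> and f. The maximum with 1 in b
    ensures positivity for every A.\<close>
  define K where "K A = rh_const ?n p (A1_extend ?n (2 ^ ?n * enn2real A) ?n)" for A
  define c where "c A = weak_const ?n (K A) \<alpha> p \<theta>" for A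
  define b where "b A = max 1 (c A * choquet_const q r)" for A
  have b: "1 \<le> b A" "c A * choquet_const q r \<le> b A" for A by (auto simp: b_def)
  have main: "cap_Lq_norm (capacity \<alpha> p \<rho> \<omega>) q (M_loc \<rho> f)
      \<le> ennreal (b (A1_const (160 * \<rho>) \<omega>) powr (1 / q)) * cap_Lq_norm (capacity \<alpha> p \<rho> \<omega>) q f"
    if \<rho>: "0 < \<rho>" and \<omega>: "A1_loc \<omega>" and f: "f \<in> borel_measurable lebesgue"
    for \<rho> and \<omega> :: "real^'n \<Rightarrow> real" and f :: "real^'n \<Rightarrow> ereal"
  proof -
    let ?A = "A1_const (160 * \<rho>) \<omega>"
    obtain w where rhw: "rh_weight w \<rho> (K ?A) \<alpha> p (doubling_const ?n (K ?A))"
      and w: "AE y in lborel. ennreal (dual_weight p \<omega> y) = w y" "AE y in lborel. 0 < w y"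
      using A1_loc_rh_weight[OF \<omega> \<rho> assms(1) ap assms(3) K_def] by blast
    interpret rh_weight w \<rho> "K ?A" \<alpha> p "doubling_const ?n (K ?A)" by (fact rhw)
    let ?R = "borel_capacity \<alpha> p \<rho> w"
    have R: "capacity \<alpha> p \<rho> \<omega> = ?R"
      using capacity_le_borel_capacity[OF w w_meas] borel_capacity_le_capacity[OF w(1) w_meas]
      by (intro ext antisym)
    let ?h = "\<lambda>x. e2ennreal \<bar>f x\<bar>"
    have h: "?h \<in> borel_measurable lebesgue" using f by measurable
    obtain F where F: "F \<in> borel_measurable borel" "AE y in lborel. ?h y = F y" "\<And>y. F y \<le> ?h y"
      using borel_minorant_AE_eq[OF h] by blast
    have "avg Q ?h = avg Q F" for Q
    \<comment> \<open>The maximal function integrates over cubes, so it does not see the change from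
      |f| to its Borel minorant F.\<close>
    proof -
      have "(\<integral>\<^sup>+y\<in>Q. ?h y \<partial>lborel) = (\<integral>\<^sup>+y\<in>Q. F y \<partial>lborel)"
        by (rule nn_integral_cong_AE) (use F(2) in eventually_elim, simp)
      then show ?thesis by (simp add: avg_def nn_integral_completion)
    qed
    then have M: "e2ennreal \<bar>M_loc \<rho> f x\<bar> = (SUP Q\<in>{Q \<in> cubes \<rho>. x \<in> Q}. avg Q F)" for x
      by (simp add: M_loc_def)
    have weak: "?R (density_set \<rho> \<tau> E) \<le> ennreal (c ?A * \<tau> powr - r) * ?R E" if "E \<in> sets borel" "0 < \<tau>" "\<tau> \<le> 1" for E \<tau>
      using borel_capacity_density_set_le[OF that \<theta>] by (simp add: c_def \<theta>_def)
    have c0: "0 \<le> c ?A"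
      using dbl_ge local_const_nonneg by (simp add: c_def weak_const_def)
    have "(\<integral>\<^sup>+t\<in>{0<..}. ?R {x. ennreal t < ennreal_powr (e2ennreal \<bar>M_loc \<rho> f x\<bar>) q} \<partial>lebesgue)
        \<le> ennreal (c ?A * choquet_const q r) * (\<integral>\<^sup>+t\<in>{0<..}. ?R {x. ennreal t < ennreal_powr (F x) q} \<partial>lborel)"
      unfolding M nn_integral_completion
      by (rule choquet_maximal_bound[OF borel_capacity_mono borel_capacity_UN_le weak c0 r0 r(3) F(1)])
    also have "\<dots> \<le> ennreal (b ?A) * (\<integral>\<^sup>+t\<in>{0<..}. ?R {x. ennreal t < ennreal_powr (?h x) q} \<partial>lebesgue)"
      unfolding nn_integral_completion
    proof (intro mult_mono ennreal_leI b nn_integral_mono mult_right_mono borel_capacity_mono)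
      show "{x. ennreal t < ennreal_powr (F x) q} \<subseteq> {x. ennreal t < ennreal_powr (?h x) q}" for t
        using ennreal_powr_mono[OF _ F(3), of q] q by (auto intro: less_le_trans)
    qed auto
    finally have "cap_Lq_norm (capacity \<alpha> p \<rho> \<omega>) q (M_loc \<rho> f)
        \<le> ennreal_powr (ennreal (b ?A) * (\<integral>\<^sup>+t\<in>{0<..}. ?R {x. ennreal t < ennreal_powr (?h x) q} \<partial>lebesgue)) (1 / q)"
      unfolding cap_Lq_norm_def R using q by (intro ennreal_powr_mono) auto
    also have "\<dots> = ennreal (b ?A powr (1 / q)) * cap_Lq_norm (capacity \<alpha> p \<rho> \<omega>) q f"
      unfolding cap_Lq_norm_def R using b(1)[of ?A] by (intro ennreal_powr_cmult) simp
    finally show ?thesis .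
  qed
  have "0 < b A powr (1 / q)" for A using b(1)[of A] by simp
  then show ?thesis using main by (intro exI[of _ "\<lambda>A. b A powr (1 / q)"]) blast
qed

end
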